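(* Let $V$ be a set and, for each $v\in V$, let $\xi(1,v),\xi(2,v),\ldots$ be a sequence of centered martingale differences with respect to a common filtration $\{F(i)\}$ (not depending on $v$). Put $$\overline S(n,v)=n^{-1/2}\sum_{i=1}^n\xi(i,v),\qquad n=1,2,\ldots,$$ $$\tau(p)=\sup_n\sup_{v\in V}\left[(p-1)\left\{n^{-1}\sum_{i=1}^n|\xi(i,v)|_p^2\right\}^{1/2}\right],\qquad p\ge2,$$ and suppose that $a:=\sup\{p:\tau(p)<\infty\}>2$ (possibly $a=\infty$). Let $$\rho(v_1,v_2)=\sup_n\sup_{p\in(2,a)}\left\{\frac{(p-1)\left\{n^{-1}\sum_{i=1}^n|\xi(i,v_1)-\xi(i,v_2)|_p^2\right\}^{1/2}}{\tau(p)}\right\}.$$ Assume that $$\int_0^1\exp\left(\tau_*\big(\log2+H(V,\rho,\epsilon)\big)\right)d\epsilon<\infty,$$ and that for some fixed $v_0\in V$ the family of distributions on the real line of the random variables $\overline S(n,v_0)$, $n=1,2,\ldots$, is weakly compact. Then for every $n$ the trajectories of $\overline S(n,\cdot)$ are $\rho$-continuous with probability one, $${\bf P}\big(\overline S(n,\cdot)\in C(V,\rho)\big)=1,$$ and moreover the family of distributions on the space $C(V,\rho)$ generated by the random fields $\overline S(n,\cdot)$, $n=1,2,\ldots$, is weakly compact.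
   Context: For a real random variable $\eta$ and $p\in[1,\infty)$, $|\eta|_p=({\bf E}|\eta|^p)^{1/p}$. Centered martingale differences with respect to the filtration $\{F(i)\}$ on a probability space $(\Omega,F,{\bf P})$, where $F(0)=\{\emptyset,\Omega\}$ and $F(i)\subset F(i+1)\subset F$, are integrable real random variables $\xi(i)$ such that ${\bf E}\xi(i)=0$, $\xi(i)$ is $F(i)$-measurable, and ${\bf E}(\xi(i)\mid F(k))=0$ almost surely for all $0\le k\le i-1$. Standing assumptions: the random fields $\overline S(n,\cdot)$ are separable, and $V$ is compact with respect to the semi-distance $\rho$ ($\rho(v_1,v_2)=0$ need not imply $v_1=v_2$). $C(V,\rho)$ is the space of real $\rho$-continuous functions on $V$ with the uniform norm. The metric entropy $H(V,\rho,\epsilon)$, $\epsilon>0$, is the natural logarithm of the minimal number of closed $\rho$-balls of radius $\epsilon$ that cover $V$. The function $\tau_*$ is $$\tau_*(x)=\inf_{y}\left(xy+\log\tau(1/y)\right),$$ the infimum being over those $y\in(0,1)$ for which $1/y$ lies in the domain of $\tau$, i.e. $y\in(0,1/2]$ (points with $\tau(1/y)=\infty$ do not contribute). A family of distributions is called weakly compact if it is relatively compact in the topology of weak convergence of probability measures. Convention: $0/0=0$. *)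

theory Defs
  imports "HOL-Probability.Probability"
begin

section \<open>Extended powers, logarithm and exponential\<close>

(* Only used with r > 0, so that infinity is mapped to infinity. *)
definition ennreal_powr :: "ennreal \<Rightarrow> real \<Rightarrow> ennreal" where
  "ennreal_powr x r = (if x = \<top> then \<top> else ennreal (enn2real x powr r))"

definition ennreal_ln :: "ennreal \<Rightarrow> ereal" where
  "ennreal_ln x = (if x = 0 then - \<infinity> else if x = \<top> then \<infinity> else ereal (ln (enn2real x)))"

definition ereal_exp :: "ereal \<Rightarrow> ennreal" where
  "ereal_exp x = (if x = - \<infinity> then 0 else if x = \<infinity> then \<top> else ennreal (exp (real_of_ereal x)))"

section \<open>Martingale differences and normed sums\<close>

definition Lp_norm :: "'a measure \<Rightarrow> real \<Rightarrow> ('a \<Rightarrow> real) \<Rightarrow> ennreal" where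
  "Lp_norm M p \<eta> = ennreal_powr (\<integral>\<^sup>+ \<omega>. ennreal (\<bar>\<eta> \<omega>\<bar> powr p) \<partial>M) (1 / p)"

(* F i is a sigma-algebra, represented as a measure whose values are irrelevant. *)
definition prob_filtration :: "'a measure \<Rightarrow> (nat \<Rightarrow> 'a measure) \<Rightarrow> bool" where
  "prob_filtration M F \<longleftrightarrow>
     filtration (space M) F \<and> (\<forall>i. subalgebra M (F i)) \<and> sets (F 0) = {{}, space M}"

(* The sequence is indexed by i = 1, 2, ...; its value at 0 is never used. *)
definition centered_martingale_differences ::
    "'a measure \<Rightarrow> (nat \<Rightarrow> 'a measure) \<Rightarrow> (nat \<Rightarrow> 'a \<Rightarrow> real) \<Rightarrow> bool" where
  "centered_martingale_differences M F \<xi> \<longleftrightarrow>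
     (\<forall>i\<ge>1. integrable M (\<xi> i) \<and> (\<integral>\<omega>. \<xi> i \<omega> \<partial>M) = 0 \<and> \<xi> i \<in> borel_measurable (F i) \<and>
        (\<forall>k<i. AE \<omega> in M. real_cond_exp M (F k) (\<xi> i) \<omega> = 0))"

definition normed_sum :: "(nat \<Rightarrow> 'v \<Rightarrow> 'a \<Rightarrow> real) \<Rightarrow> nat \<Rightarrow> 'v \<Rightarrow> 'a \<Rightarrow> real" where
  "normed_sum \<xi> n v \<omega> = (\<Sum>i=1..n. \<xi> i v \<omega>) / sqrt (real n)"

(* (p - 1) {n^(-1) sum_(i=1..n) |eta(i)|_p^2}^(1/2), in [0, infinity] *)
definition mean_norm :: "'a measure \<Rightarrow> real \<Rightarrow> nat \<Rightarrow> (nat \<Rightarrow> 'a \<Rightarrow> real) \<Rightarrow> ennreal" where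
  "mean_norm M p n \<eta> =
     ennreal (p - 1) * ennreal_powr ((\<Sum>i=1..n. (Lp_norm M p (\<eta> i))\<^sup>2) / of_nat n) (1 / 2)"

(* Meaningful for p >= 2. *)
definition tau :: "'a measure \<Rightarrow> 'v set \<Rightarrow> (nat \<Rightarrow> 'v \<Rightarrow> 'a \<Rightarrow> real) \<Rightarrow> real \<Rightarrow> ennreal" where
  "tau M V \<xi> p = (SUP n\<in>{1..}. SUP v\<in>V. mean_norm M p n (\<lambda>i. \<xi> i v))"

definition tau_sup :: "'a measure \<Rightarrow> 'v set \<Rightarrow> (nat \<Rightarrow> 'v \<Rightarrow> 'a \<Rightarrow> real) \<Rightarrow> ereal" where
  "tau_sup M V \<xi> = Sup {ereal p |p. 2 \<le> p \<and> tau M V \<xi> p < \<top>}"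

(* Division on ennreal satisfies 0 / 0 = 0. *)
definition rho :: "'a measure \<Rightarrow> 'v set \<Rightarrow> (nat \<Rightarrow> 'v \<Rightarrow> 'a \<Rightarrow> real) \<Rightarrow> 'v \<Rightarrow> 'v \<Rightarrow> ennreal" where
  "rho M V \<xi> v1 v2 =
     (SUP n\<in>{1..}. SUP p\<in>{p. 2 < p \<and> ereal p < tau_sup M V \<xi>}.
        mean_norm M p n (\<lambda>i \<omega>. \<xi> i v1 \<omega> - \<xi> i v2 \<omega>) / tau M V \<xi> p)"

definition tau_star :: "(real \<Rightarrow> ennreal) \<Rightarrow> ereal \<Rightarrow> ereal" where
  "tau_star t x =
     (INF y\<in>{y. 0 < y \<and> y < 1 \<and> 2 \<le> 1 / y \<and> t (1 / y) < \<top>}. x * ereal y + ennreal_ln (t (1 / y)))"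

section \<open>Semi-metric spaces\<close>

definition semimetric_topology :: "'v set \<Rightarrow> ('v \<Rightarrow> 'v \<Rightarrow> ennreal) \<Rightarrow> 'v topology" where
  "semimetric_topology V d =
     topology (\<lambda>U. U \<subseteq> V \<and> (\<forall>x\<in>U. \<exists>e>0. \<forall>y\<in>V. d x y < e \<longrightarrow> y \<in> U))"

lemma openin_semimetric_topology:
  "openin (semimetric_topology V d) U \<longleftrightarrow>
     U \<subseteq> V \<and> (\<forall>x\<in>U. \<exists>e>0. \<forall>y\<in>V. d x y < e \<longrightarrow> y \<in> U)"
proof -
  let ?P = "\<lambda>U. U \<subseteq> V \<and> (\<forall>x\<in>U. \<exists>e>0. \<forall>y\<in>V. d x y < e \<longrightarrow> y \<in> U)"
  have "istopology ?P"
    unfolding istopology_def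
  proof (intro conjI allI impI)
    fix S T assume S: "?P S" and T: "?P T"
    then show "S \<inter> T \<subseteq> V" by blast
    show "\<forall>x\<in>S \<inter> T. \<exists>e>0. \<forall>y\<in>V. d x y < e \<longrightarrow> y \<in> S \<inter> T"
    proof
      fix x assume "x \<in> S \<inter> T"
      then obtain e1 e2 where "e1 > 0" "e2 > 0"
        and "\<forall>y\<in>V. d x y < e1 \<longrightarrow> y \<in> S" "\<forall>y\<in>V. d x y < e2 \<longrightarrow> y \<in> T"
        using S T by blast
      then have "min e1 e2 > 0 \<and> (\<forall>y\<in>V. d x y < min e1 e2 \<longrightarrow> y \<in> S \<inter> T)"
        by simp
      then show "\<exists>e>0. \<forall>y\<in>V. d x y < e \<longrightarrow> y \<in> S \<inter> T" by blast
    qed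
  next
    fix \<K> assume K: "\<forall>K\<in>\<K>. ?P K"
    then show "\<Union>\<K> \<subseteq> V" by blast
    show "\<forall>x\<in>\<Union>\<K>. \<exists>e>0. \<forall>y\<in>V. d x y < e \<longrightarrow> y \<in> \<Union>\<K>"
      using K by (meson UnionE UnionI)
  qed
  then show ?thesis
    unfolding semimetric_topology_def by (simp add: topology_inverse')
qed

lemma topspace_semimetric_topology [simp]: "topspace (semimetric_topology V d) = V"
proof -
  have "openin (semimetric_topology V d) V"
    unfolding openin_semimetric_topology by (auto intro: exI[of _ 1])
  then show ?thesis
    by (meson openin_semimetric_topology openin_subset openin_topspace subset_antisym)
qed

definition covering_number :: "'v set \<Rightarrow> ('v \<Rightarrow> 'v \<Rightarrow> ennreal) \<Rightarrow> real \<Rightarrow> ennreal" where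
  "covering_number V d \<epsilon> =
     (INF C\<in>{C. finite C \<and> C \<subseteq> V \<and> V \<subseteq> (\<Union>c\<in>C. {v\<in>V. d c v \<le> ennreal \<epsilon>})}. of_nat (card C))"

definition metric_entropy :: "'v set \<Rightarrow> ('v \<Rightarrow> 'v \<Rightarrow> ennreal) \<Rightarrow> real \<Rightarrow> ereal" where
  "metric_entropy V d \<epsilon> = ennreal_ln (covering_number V d \<epsilon>)"

(* C(V, d): the elements are continuous functions on V, extended by undefined outside V;
   boundedness, required by cfunspace, is automatic on a compact space. *)
definition cont_space :: "'v set \<Rightarrow> ('v \<Rightarrow> 'v \<Rightarrow> ennreal) \<Rightarrow> ('v \<Rightarrow> real) metric" where
  "cont_space V d = cfunspace (semimetric_topology V d) euclidean_metric"

(* Separability in the sense of Doob, with respect to all closed sets of values. *)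
definition separable_field :: "'a measure \<Rightarrow> 'v topology \<Rightarrow> ('v \<Rightarrow> 'a \<Rightarrow> real) \<Rightarrow> bool" where
  "separable_field M T X \<longleftrightarrow>
     (\<exists>D N. countable D \<and> D \<subseteq> topspace T \<and> N \<in> null_sets M \<and>
        (\<forall>G K. openin T G \<longrightarrow> closed K \<longrightarrow>
           {\<omega>\<in>space M. \<forall>v\<in>G \<inter> D. X v \<omega> \<in> K} - {\<omega>\<in>space M. \<forall>v\<in>G. X v \<omega> \<in> K} \<subseteq> N))"

section \<open>Weak topology on probability measures\<close>

definition borel_of :: "'b topology \<Rightarrow> 'b measure" where
  "borel_of X = sigma (topspace X) {U. openin X U}"

definition borel_probabilities :: "'b topology \<Rightarrow> 'b measure set" where
  "borel_probabilities X = {\<mu>. prob_space \<mu> \<and> sets \<mu> = sets (borel_of X)}"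

(* The coarsest topology making the integral of every bounded continuous function continuous. *)
definition weak_topology :: "'b topology \<Rightarrow> 'b measure topology" where
  "weak_topology X =
     topology_generated_by
       {{\<mu> \<in> borel_probabilities X. (\<integral>x. f x \<partial>\<mu>) \<in> U} |f U.
          continuous_map X euclideanreal f \<and> bounded (f ` topspace X) \<and> open U}"

lemma topspace_weak_topology [simp]: "topspace (weak_topology X) = borel_probabilities X"
proof -
  have "borel_probabilities X \<in>
      {{\<mu> \<in> borel_probabilities X. (\<integral>x. f x \<partial>\<mu>) \<in> U} |f U.
          continuous_map X euclideanreal f \<and> bounded (f ` topspace X) \<and> open U}"
    by (auto intro!: exI[of _ "\<lambda>_. 0"] exI[of _ UNIV] simp: image_constant_conv)
  then show ?thesis
    unfolding weak_topology_def topology_generated_by_topspace by blast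
qed

definition relatively_compactin :: "'b topology \<Rightarrow> 'b set \<Rightarrow> bool" where
  "relatively_compactin T S \<longleftrightarrow> S \<subseteq> topspace T \<and> compactin T (T closure_of S)"

definition weakly_compact :: "'b topology \<Rightarrow> 'b measure set \<Rightarrow> bool" where
  "weakly_compact X \<P> \<longleftrightarrow> relatively_compactin (weak_topology X) \<P>"

(* The law B \<mapsto> P(X \<in> B) of a random field on C(V, d).  Its paths are in C(V, d) only almost surely,
   and for a separable field the event X \<in> B is an event of M only up to a null set, so
   probabilities are taken in the completion of M. *)
definition field_law ::
    "'a measure \<Rightarrow> 'v set \<Rightarrow> ('v \<Rightarrow> 'v \<Rightarrow> ennreal) \<Rightarrow> ('v \<Rightarrow> 'a \<Rightarrow> real) \<Rightarrow> ('v \<Rightarrow> real) measure" where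
  "field_law M V d X =
     distr (completion M) (borel_of (mtopology_of (cont_space V d))) (\<lambda>\<omega>. \<lambda>v\<in>V. X v \<omega>)"

end

theory Submission
  imports Defs
begin

text \<open>A moment inequality for martingales bounds the \<open>L\<^sup>p\<close> norm of \<open>S(n, v) - S(n, w)\<close> by
  \<open>2 \<tau>(p) \<rho>(v, w)\<close>, uniformly in \<open>n\<close>. Hence the maximum of \<open>N\<close> increments over pairs
  at distance at most \<open>r\<close> has mean at most \<open>2 r N\<^bsup>1/p\<^esup> \<tau>(p)\<close>, and optimising \<open>p\<close>
  separately at each dyadic scale turns the entropy integral into a convergent chaining series. This
  bounds the mean modulus of continuity uniformly in \<open>n\<close>, so up to small probability all paths lie
  in one totally bounded subset of \<open>C(V, \<rho>)\<close>. Relative compactness of the laws follows from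
  Tychonoff's theorem, applied to the functionals \<open>f \<mapsto> \<integral>f d\<mu>\<close> on bounded continuous
  functions: by Dini's theorem, tightness makes every limit functional a Daniell integral.\<close>

section \<open>Moments of martingale sums\<close>

text \<open>For a net of N points the union bound costs N^(1/p) \<tau>(p), and the infimum over p of
  (2 N)^(1/p) \<tau>(p) is the exponential of \<open>tau_star\<close> at log 2 + log N; this is the
  integrand of the entropy condition. The exponent may change with the scale because
  \<open>rho\<close> is a supremum over all p between 2 and a. The factor p - 1 in
  \<open>mean_norm\<close> is the growth rate of the martingale constant: the squared L^p norm of a
  sum grows at each step by at most (2 (p - 1))^2 times that of the new difference, which leaves
  only the absolute factor 2.

  Two obstacles shape the rest. Separability yields, for each n, a countable set that no net need
  contain; one point of an enumeration is therefore added to every net, and N + 1 \<le> 2 N accounts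
  for the log 2. And the path map itself need not be measurable, so it is replaced on a null set by
  a Borel map into the function space.\<close>

lemma Youngs_inequality_nonneg:
  fixes a b :: real
  assumes "0 \<le> \<alpha>" "0 \<le> \<beta>" "\<alpha> + \<beta> = 1" "0 \<le> a" "0 \<le> b"
  shows "a powr \<alpha> * b powr \<beta> \<le> \<alpha> * a + \<beta> * b"
  using Youngs_inequality_0[of \<alpha> \<beta> a b] assms by (cases "a = 0 \<or> b = 0") auto

text \<open>Convexity of t^p: the tangent at a lies below the graph at b. Young's inequality with
  weights 1 - 1/p and 1/p gives this without derivatives and includes b = 0.\<close>

lemma powr_tangent:
  fixes a b p :: real
  assumes "1 \<le> p" "0 < a" "0 \<le> b"
  shows "p * a powr (p - 1) * b \<le> (p - 1) * a powr p + b powr p"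
proof -
  have "(a powr p) powr (1 - 1/p) * (b powr p) powr (1/p) \<le> (1 - 1/p) * a powr p + (1/p) * b powr p"
    using assms by (intro Youngs_inequality_nonneg) auto
  moreover have "(a powr p) powr (1 - 1/p) = a powr (p - 1)"
    using assms by (simp add: powr_powr right_diff_distrib)
  moreover have "(b powr p) powr (1/p) = b"
    using assms by (simp add: powr_powr)
  ultimately have "p * (a powr (p - 1) * b) \<le> p * ((1 - 1/p) * a powr p + (1/p) * b powr p)"
    using assms by (intro mult_left_mono) auto
  also have "\<dots> = (p - 1) * a powr p + b powr p"
    using assms by (simp add: field_simps)
  finally show ?thesis by (simp add: mult.assoc)
qed

lemma powr_diff_le:
  fixes a b p :: real
  assumes "1 \<le> p" "0 < a" "0 \<le> b"
  shows "a powr p - b powr p \<le> p * a powr (p - 1) * (a - b)"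
proof -
  have "a powr p = a powr (p - 1) * a"
    using assms by (metis diff_add_cancel powr_add powr_one less_imp_le)
  with powr_tangent[OF assms] show ?thesis by (simp add: algebra_simps)
qed

text \<open>For p > 1, \<open>p * signed_powr (p - 1)\<close> is the derivative of |x|^p, so the
  first-order term in an expansion of |x + y|^p can be written for all signs at once.\<close>

definition signed_powr :: "real \<Rightarrow> real \<Rightarrow> real" where
  "signed_powr q x = sgn x * \<bar>x\<bar> powr q"

lemma borel_measurable_signed_powr [measurable]: "signed_powr q \<in> borel_measurable borel"
  unfolding signed_powr_def[abs_def] by measurable

lemma abs_signed_powr: "\<bar>signed_powr q x\<bar> = \<bar>x\<bar> powr q"
  by (simp add: signed_powr_def abs_mult sgn_if)

lemma signed_powr_minus: "signed_powr q (- x) = - signed_powr q x"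
  by (simp add: signed_powr_def sgn_minus)

text \<open>The tangent inequality for |a| and |b| extends to signed arguments because the product
  of \<open>signed_powr (p - 1) a\<close> and b is at most |a|^(p - 1) |b|.\<close>

lemma abs_powr_diff_le:
  fixes a b p :: real
  assumes "1 \<le> p"
  shows "\<bar>a\<bar> powr p - \<bar>b\<bar> powr p \<le> p * signed_powr (p - 1) a * (a - b)"
proof (cases "a = 0")
  case True
  then show ?thesis by (simp add: signed_powr_def)
next
  case False
  have 1: "signed_powr (p - 1) a * b \<le> \<bar>a\<bar> powr (p - 1) * \<bar>b\<bar>"
    by (metis abs_ge_self abs_mult abs_signed_powr)
  have 2: "signed_powr (p - 1) a * a = \<bar>a\<bar> powr p"
  proof -
    have "signed_powr (p - 1) a * a = \<bar>a\<bar> powr (p - 1) * \<bar>a\<bar> powr 1"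
      by (simp add: signed_powr_def sgn_if)
    also have "\<dots> = \<bar>a\<bar> powr p"
      by (subst powr_add[symmetric]) simp
    finally show ?thesis .
  qed
  have "p * (signed_powr (p - 1) a * b) \<le> p * (\<bar>a\<bar> powr (p - 1) * \<bar>b\<bar>)"
    using 1 assms by (intro mult_left_mono) auto
  also have "\<dots> \<le> (p - 1) * \<bar>a\<bar> powr p + \<bar>b\<bar> powr p"
    using powr_tangent[of p "\<bar>a\<bar>" "\<bar>b\<bar>"] False assms by (simp add: mult.assoc)
  finally show ?thesis
    using 2 by (simp add: algebra_simps)
qed

text \<open>Mean value bound for a function whose derivative q |x|^(q - 1) is at most q m^(q - 1) on
  [-m, m]. Arguments of one sign reduce to the tangent inequality; for opposite signs |a| + |b| = |a
  - b|, and each power is estimated alone.\<close>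

lemma signed_powr_diff_le:
  fixes a b q m :: real
  assumes q: "1 \<le> q" and m: "\<bar>a\<bar> \<le> m" "\<bar>b\<bar> \<le> m"
  shows "\<bar>signed_powr q a - signed_powr q b\<bar> \<le> q * \<bar>a - b\<bar> * m powr (q - 1)"
proof -
  have same: "signed_powr q x - signed_powr q y \<le> q * \<bar>x - y\<bar> * m powr (q - 1)"
    if "0 \<le> y" "y \<le> x" "x \<le> m" for x y
  proof (cases "x = 0")
    case False
    then have "signed_powr q x - signed_powr q y = x powr q - y powr q"
      using that by (auto simp: signed_powr_def sgn_if)
    also have "\<dots> \<le> q * x powr (q - 1) * (x - y)"
      using that False q by (intro powr_diff_le) auto
    also have "\<dots> \<le> q * m powr (q - 1) * (x - y)"
      using that False q by (intro mult_right_mono mult_left_mono powr_mono2) auto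
    finally show ?thesis using that by (simp add: mult_ac)
  qed (use that in auto)
  have mono: "signed_powr q y \<le> signed_powr q x" if "0 \<le> y" "y \<le> x" for x y
    using that q by (auto simp: signed_powr_def sgn_if intro: powr_mono2)
  have same': "\<bar>signed_powr q x - signed_powr q y\<bar> \<le> q * \<bar>x - y\<bar> * m powr (q - 1)"
    if "0 \<le> y" "0 \<le> x" "x \<le> m" "y \<le> m" for x y
    using same[of x y] same[of y x] mono[of x y] mono[of y x] that
    by (cases "x \<le> y") (auto simp: abs_minus_commute)
  have bound: "\<bar>x\<bar> powr q \<le> \<bar>x\<bar> * m powr (q - 1)" if "\<bar>x\<bar> \<le> m" for x
  proof (cases "x = 0")
    case False
    have "\<bar>x\<bar> powr q = \<bar>x\<bar> powr 1 * \<bar>x\<bar> powr (q - 1)"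
      by (subst powr_add[symmetric]) simp
    also have "\<dots> \<le> \<bar>x\<bar> * m powr (q - 1)"
      using that q by (auto intro!: mult_left_mono powr_mono2)
    finally show ?thesis .
  qed simp
  show ?thesis
  proof (cases "0 \<le> a \<longleftrightarrow> 0 \<le> b")
    case True
    then consider "0 \<le> a" "0 \<le> b" | "a \<le> 0" "b \<le> 0" by linarith
    then show ?thesis
    proof cases
      case 2
      then show ?thesis
        using same'[of "- a" "- b"] m by (simp add: signed_powr_minus abs_minus_commute)
    qed (use m same' in auto)
  next
    case False
    have "\<bar>signed_powr q a - signed_powr q b\<bar> \<le> \<bar>a\<bar> powr q + \<bar>b\<bar> powr q"
      by (metis abs_signed_powr abs_triangle_ineq4)
    also have "\<dots> \<le> (\<bar>a\<bar> + \<bar>b\<bar>) * m powr (q - 1)"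
      using bound[OF m(1)] bound[OF m(2)] by (simp add: distrib_right)
    also have "\<bar>a\<bar> + \<bar>b\<bar> = \<bar>a - b\<bar>" using False by auto
    also have "\<bar>a - b\<bar> * m powr (q - 1) \<le> q * \<bar>a - b\<bar> * m powr (q - 1)"
      using q by (intro mult_right_mono) (auto simp: mult_le_cancel_right1)
    finally show ?thesis .
  qed
qed

text \<open>The tangent is taken at x + y, and moving its slope back to x costs the Lipschitz bound
  for \<open>signed_powr (p - 1)\<close> up to modulus |x| + |y|. The remainder thus carries p (p -
  1), without Taylor's factor 1/2.\<close>

lemma abs_powr_add_le:
  fixes x y p :: real
  assumes p: "2 \<le> p"
  shows "\<bar>x + y\<bar> powr p \<le> \<bar>x\<bar> powr p + p * signed_powr (p - 1) x * y
           + p * (p - 1) * (y\<^sup>2 * (\<bar>x\<bar> + \<bar>y\<bar>) powr (p - 2))"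
proof -
  have "\<bar>x + y\<bar> powr p - \<bar>x\<bar> powr p \<le> p * signed_powr (p - 1) (x + y) * y"
    using abs_powr_diff_le[of p "x + y" x] p by simp
  moreover have "(signed_powr (p - 1) (x + y) - signed_powr (p - 1) x) * y
      \<le> (p - 1) * (y\<^sup>2 * (\<bar>x\<bar> + \<bar>y\<bar>) powr (p - 2))"
  proof -
    have "(signed_powr (p - 1) (x + y) - signed_powr (p - 1) x) * y
        \<le> \<bar>signed_powr (p - 1) (x + y) - signed_powr (p - 1) x\<bar> * \<bar>y\<bar>"
      by (metis abs_ge_self abs_mult)
    also have "\<dots> \<le> ((p - 1) * \<bar>x + y - x\<bar> * (\<bar>x\<bar> + \<bar>y\<bar>) powr (p - 1 - 1)) * \<bar>y\<bar>"
      using p by (intro mult_right_mono signed_powr_diff_le) auto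
    also have "\<dots> = (p - 1) * (y\<^sup>2 * (\<bar>x\<bar> + \<bar>y\<bar>) powr (p - 2))"
    proof -
      have "\<bar>x + y - x\<bar> * \<bar>y\<bar> = y\<^sup>2" by (simp add: power2_eq_square flip: abs_mult)
      then show ?thesis by (simp add: mult_ac)
    qed
    finally show ?thesis .
  qed
  then have "p * ((signed_powr (p - 1) (x + y) - signed_powr (p - 1) x) * y)
      \<le> p * ((p - 1) * (y\<^sup>2 * (\<bar>x\<bar> + \<bar>y\<bar>) powr (p - 2)))"
    using p by (intro mult_left_mono) auto
  ultimately show ?thesis by (simp add: algebra_simps)
qed

text \<open>The factor 2 (p - 1) originates here. With s = b^2 and u = (2 (p - 1) y)^2, the two
  summands on the left are at most s and u times (s + u)^(p/2 - 1), and these add up to (s +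
  u)^(p/2). The bound by u rests on 2 p (p - 1) \<le> 4 (p - 1)^2, that is, on p \<ge> 2.\<close>

lemma powr_add_quadratic_le:
  fixes b y p :: real
  assumes p: "2 \<le> p" and b: "0 \<le> b" and y: "0 \<le> y"
  shows "b powr p + p * (p - 1) * (y\<^sup>2 * (b + y) powr (p - 2))
           \<le> (b\<^sup>2 + (2 * (p - 1) * y)\<^sup>2) powr (p / 2)"
proof (cases "y = 0")
  case True
  then show ?thesis using b p by (simp add: powr_powr flip: powr_numeral)
next
  case False
  define u where "u = (2 * (p - 1) * y)\<^sup>2"
  define s where "s = b\<^sup>2"
  have u: "0 < u" using False p by (simp add: u_def)
  have s: "0 \<le> s" by (simp add: s_def)
  have "(b + y) powr (p - 2) = ((b + y)\<^sup>2) powr (p / 2 - 1)"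
    using False b y by (simp add: powr_powr flip: powr_numeral)
  \<comment> \<open>Cauchy-Schwarz with weight p - 1: the loss 1 + 1/(p - 1) is so close to 1 that
    its power p/2 - 1 stays below exp (1/2) \<le> 2 for every p.\<close>
  also have "\<dots> \<le> ((1 + 1 / (p - 1)) * (s + u)) powr (p / 2 - 1)"
  proof (rule powr_mono2)
    have "0 \<le> (b - (p - 1) * y)\<^sup>2 / (p - 1)" using p by simp
    also have "\<dots> = b\<^sup>2 / (p - 1) - 2 * b * y + (p - 1) * y\<^sup>2"
      using p by (simp add: power2_eq_square field_simps)
    finally have "(b + y)\<^sup>2 \<le> (1 + 1 / (p - 1)) * (b\<^sup>2 + (p - 1) * y\<^sup>2)"
      using p by (simp add: power2_eq_square field_simps)
    also have "\<dots> \<le> (1 + 1 / (p - 1)) * (s + u)"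
    proof -
      have "(p - 1) * 1 \<le> (p - 1) * (4 * (p - 1))" using p by (intro mult_left_mono) auto
      then have "(p - 1) * y\<^sup>2 \<le> ((p - 1) * (4 * (p - 1))) * y\<^sup>2"
        by (intro mult_right_mono) auto
      also have "\<dots> = u" by (simp add: u_def power2_eq_square algebra_simps)
      finally show ?thesis
        using p by (intro mult_left_mono) (auto simp: s_def)
    qed
    finally show "(b + y)\<^sup>2 \<le> (1 + 1 / (p - 1)) * (s + u)" .
  qed (use p in auto)
  also have "\<dots> = (1 + 1 / (p - 1)) powr (p / 2 - 1) * (s + u) powr (p / 2 - 1)"
    using p s u by (simp add: powr_mult)
  also have "\<dots> \<le> 2 * (s + u) powr (p / 2 - 1)"
  proof (rule mult_right_mono)
    have "(1 + 1 / (p - 1)) powr (p / 2 - 1) \<le> exp (1 / (p - 1)) powr (p / 2 - 1)"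
      using p by (intro powr_mono2 exp_ge_add_one_self) auto
    also have "\<dots> = exp ((p / 2 - 1) / (p - 1))"
      by (simp add: powr_def)
    also have "\<dots> \<le> exp (1 / 2)"
      using p by (simp add: field_simps)
    also have "\<dots> \<le> 1 + 1 / 2 + (1 / 2)\<^sup>2"
      by (rule exp_bound) auto
    also have "\<dots> \<le> (2::real)" by (simp add: power2_eq_square)
    finally show "(1 + 1 / (p - 1)) powr (p / 2 - 1) \<le> 2" .
  qed simp
  finally have 1: "(b + y) powr (p - 2) \<le> 2 * (s + u) powr (p / 2 - 1)" .
  have "p * (p - 1) * (y\<^sup>2 * (b + y) powr (p - 2)) = (p * (p - 1) * y\<^sup>2) * (b + y) powr (p - 2)"
    by simp
  also have "\<dots> \<le> (p * (p - 1) * y\<^sup>2) * (2 * (s + u) powr (p / 2 - 1))"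
    using p by (intro mult_left_mono 1) auto
  also have "\<dots> = (2 * p * (p - 1) * y\<^sup>2) * (s + u) powr (p / 2 - 1)" by simp
  also have "\<dots> \<le> u * (s + u) powr (p / 2 - 1)"
  proof (rule mult_right_mono)
    have "(2 * p) * ((p - 1) * y\<^sup>2) \<le> (4 * (p - 1)) * ((p - 1) * y\<^sup>2)"
      using p by (intro mult_right_mono) auto
    moreover have "u = (4 * (p - 1)) * ((p - 1) * y\<^sup>2)" by (simp add: u_def power2_eq_square algebra_simps)
    ultimately show "2 * p * (p - 1) * y\<^sup>2 \<le> u" by (simp add: mult.assoc)
  qed simp
  finally have 2: "p * (p - 1) * (y\<^sup>2 * (b + y) powr (p - 2)) \<le> u * (s + u) powr (p / 2 - 1)" .
  have 3: "b powr p \<le> s * (s + u) powr (p / 2 - 1)"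
  proof (cases "b = 0")
    case False
    with b have b: "b > 0" by simp
    have "b powr p = s powr (1 + (p / 2 - 1))"
      using b by (simp add: s_def powr_powr flip: powr_numeral)
    also have "\<dots> = s * s powr (p / 2 - 1)"
      using s by (simp only: powr_add) simp
    also have "\<dots> \<le> s * (s + u) powr (p / 2 - 1)"
      using s u p by (intro mult_left_mono powr_mono2) auto
    finally show ?thesis .
  qed (use s in simp)
  have "b powr p + p * (p - 1) * (y\<^sup>2 * (b + y) powr (p - 2)) \<le> (s + u) * (s + u) powr (p / 2 - 1)"
    using 2 3 by (simp add: distrib_right)
  also have "\<dots> = (s + u) powr (1 + (p / 2 - 1))"
    using s u by (simp only: powr_add) simp
  finally show ?thesis by (simp add: s_def u_def)
qed

section \<open>Hoelder's and Minkowski's inequalities\<close>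

text \<open>Young's inequality for u / A and v / B, integrated; if a bound is 0 it cannot be a
  divisor, but then the integrand vanishes almost everywhere. In this form the lemma serves
  interpolation and also, with v = 1, Jensen's inequality on a probability space.\<close>

lemma nn_integral_Hoelder:
  fixes u v :: "'a \<Rightarrow> real"
  assumes [measurable]: "u \<in> borel_measurable M" "v \<in> borel_measurable M"
    and u: "\<And>x. 0 \<le> u x" and v: "\<And>x. 0 \<le> v x"
    and A: "(\<integral>\<^sup>+x. ennreal (u x) \<partial>M) \<le> ennreal A" "0 \<le> A"
    and B: "(\<integral>\<^sup>+x. ennreal (v x) \<partial>M) \<le> ennreal B" "0 \<le> B"
    and \<alpha>: "0 < \<alpha>" "\<alpha> < 1"
  shows "(\<integral>\<^sup>+x. ennreal (u x powr \<alpha> * v x powr (1 - \<alpha>)) \<partial>M) \<le> ennreal (A powr \<alpha> * B powr (1 - \<alpha>))"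
proof (cases "A = 0 \<or> B = 0")
  case True
  then have "(\<integral>\<^sup>+x. ennreal (u x) \<partial>M) = 0 \<or> (\<integral>\<^sup>+x. ennreal (v x) \<partial>M) = 0" using A B by auto
  then have "(AE x in M. u x = 0) \<or> (AE x in M. v x = 0)"
  proof (elim disjE)
    assume "(\<integral>\<^sup>+x. ennreal (u x) \<partial>M) = 0"
    then have "AE x in M. u x = 0"
      by (subst (asm) nn_integral_0_iff_AE) (auto simp: ennreal_eq_0_iff u antisym elim!: eventually_mono)
    then show ?thesis ..
  next
    assume "(\<integral>\<^sup>+x. ennreal (v x) \<partial>M) = 0"
    then have "AE x in M. v x = 0"
      by (subst (asm) nn_integral_0_iff_AE) (auto simp: ennreal_eq_0_iff v antisym elim!: eventually_mono)
    then show ?thesis ..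
  qed
  then have "AE x in M. u x powr \<alpha> * v x powr (1 - \<alpha>) = 0" by auto
  then have "(\<integral>\<^sup>+x. ennreal (u x powr \<alpha> * v x powr (1 - \<alpha>)) \<partial>M) = 0"
    by (subst nn_integral_0_iff_AE) auto
  then show ?thesis by simp
next
  case False
  then have A0: "0 < A" and B0: "0 < B" using A B by auto
  define C where "C = A powr \<alpha> * B powr (1 - \<alpha>)"
  have C: "C > 0" using A0 B0 by (simp add: C_def)
  have pw: "u x powr \<alpha> * v x powr (1 - \<alpha>) \<le> C * (\<alpha> / A) * u x + C * ((1 - \<alpha>) / B) * v x" for x
  proof -
    have "(u x / A) powr \<alpha> * (v x / B) powr (1 - \<alpha>) \<le> \<alpha> * (u x / A) + (1 - \<alpha>) * (v x / B)"
      using \<alpha> u v A0 B0 by (intro Youngs_inequality_nonneg) auto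
    also have "(u x / A) powr \<alpha> * (v x / B) powr (1 - \<alpha>) = (u x powr \<alpha> * v x powr (1 - \<alpha>)) / C"
      using u v A0 B0 by (simp add: powr_divide C_def)
    finally show ?thesis using C by (simp add: field_simps)
  qed
  have "(\<integral>\<^sup>+x. ennreal (u x powr \<alpha> * v x powr (1 - \<alpha>)) \<partial>M)
      \<le> (\<integral>\<^sup>+x. ennreal (C * (\<alpha> / A)) * ennreal (u x) + ennreal (C * ((1 - \<alpha>) / B)) * ennreal (v x) \<partial>M)"
  proof (intro nn_integral_mono)
    fix x
    have "ennreal (C * (\<alpha> / A)) * ennreal (u x) + ennreal (C * ((1 - \<alpha>) / B)) * ennreal (v x)
       = ennreal (C * (\<alpha> / A) * u x + C * ((1 - \<alpha>) / B) * v x)"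
      using u v \<alpha> A0 B0 C by (simp flip: ennreal_mult ennreal_plus)
    with pw[of x] show "ennreal (u x powr \<alpha> * v x powr (1 - \<alpha>)) \<le>
        ennreal (C * (\<alpha> / A)) * ennreal (u x) + ennreal (C * ((1 - \<alpha>) / B)) * ennreal (v x)"
      by (simp add: ennreal_leI)
  qed
  also have "\<dots> = ennreal (C * (\<alpha> / A)) * (\<integral>\<^sup>+x. u x \<partial>M) + ennreal (C * ((1 - \<alpha>) / B)) * (\<integral>\<^sup>+x. v x \<partial>M)"
    by (simp add: nn_integral_add nn_integral_cmult)
  also have "\<dots> \<le> ennreal (C * (\<alpha> / A)) * ennreal A + ennreal (C * ((1 - \<alpha>) / B)) * ennreal B"
    by (intro add_mono mult_left_mono A B) auto
  also have "\<dots> = ennreal (C * (\<alpha> / A) * A + C * ((1 - \<alpha>) / B) * B)"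
    using \<alpha> A0 B0 C by (simp add: ennreal_mult[symmetric])
  also have "C * (\<alpha> / A) * A + C * ((1 - \<alpha>) / B) * B = C"
    using A0 B0 by (simp add: field_simps)
  finally show ?thesis by (simp add: C_def)
qed

text \<open>For a \<ge> 0 this bounds the L^p norm by a without roots or finiteness side conditions;
  \<open>Lp_norm_le_iff\<close> is the translation.\<close>

abbreviation moment_le :: "'a measure \<Rightarrow> real \<Rightarrow> ('a \<Rightarrow> real) \<Rightarrow> real \<Rightarrow> bool" where
  "moment_le M p f a \<equiv> (\<integral>\<^sup>+x. ennreal (\<bar>f x\<bar> powr p) \<partial>M) \<le> ennreal (a powr p)"

text \<open>(|f| + |g|) / (a + b) is the convex combination of |f| / a and |g| / b with weights a /
  (a + b) and b / (a + b), so convexity of t^p applies pointwise.\<close>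

lemma nn_integral_Minkowski_pos:
  fixes f g :: "'a \<Rightarrow> real"
  assumes [measurable]: "f \<in> borel_measurable M" "g \<in> borel_measurable M" and p: "1 \<le> p"
    and a: "moment_le M p f a" "0 < a"
    and b: "moment_le M p g b" "0 < b"
  shows "(\<integral>\<^sup>+x. ennreal ((\<bar>f x\<bar> + \<bar>g x\<bar>) powr p) \<partial>M) \<le> ennreal ((a + b) powr p)"
proof -
  define C where "C = (a + b) powr p"
  define ca where "ca = C * (a / (a + b)) / a powr p"
  define cb where "cb = C * (b / (a + b)) / b powr p"
  have C: "C > 0" "ca \<ge> 0" "cb \<ge> 0" using a b by (simp_all add: C_def ca_def cb_def)
  \<comment> \<open>The tangent inequality at the mean z, averaged over x and y; z = 0, excluded by
    \<open>powr_tangent\<close>, is trivial.\<close>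
  have conv: "(t * x + (1 - t) * y) powr p \<le> t * x powr p + (1 - t) * y powr p"
    if xy: "0 \<le> x" "0 \<le> y" and t: "0 \<le> t" "t \<le> 1" for x y t :: real
  proof -
    define z where "z = t * x + (1 - t) * y"
    have z: "0 \<le> z" using xy t by (simp add: z_def)
    show ?thesis
    proof (cases "z = 0")
      case False
      then have z: "0 < z" using z by simp
      have "t * (p * z powr (p - 1) * x) + (1 - t) * (p * z powr (p - 1) * y)
          \<le> t * ((p - 1) * z powr p + x powr p) + (1 - t) * ((p - 1) * z powr p + y powr p)"
        using xy z p t by (intro add_mono mult_left_mono powr_tangent) auto
      also have "t * (p * z powr (p - 1) * x) + (1 - t) * (p * z powr (p - 1) * y)
          = p * (z powr (p - 1) * z)"
        by (simp add: z_def algebra_simps)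
      also have "z powr (p - 1) * z = z powr p"
        using z by (metis diff_add_cancel powr_add powr_one less_imp_le)
      finally have "z powr p \<le> t * x powr p + (1 - t) * y powr p" by (simp add: algebra_simps)
      then show ?thesis by (simp add: z_def)
    qed (use that in \<open>simp add: z_def\<close>)
  qed
  have pw: "(\<bar>f x\<bar> + \<bar>g x\<bar>) powr p \<le> ca * \<bar>f x\<bar> powr p + cb * \<bar>g x\<bar> powr p" for x
  proof -
    define t where "t = a / (a + b)"
    have t: "0 \<le> t" "t \<le> 1" "1 - t = b / (a + b)" using a b by (auto simp: t_def field_simps)
    have e1: "t * (\<bar>f x\<bar> / a) = \<bar>f x\<bar> / (a + b)" using a by (simp add: t_def)
    have e2: "(1 - t) * (\<bar>g x\<bar> / b) = \<bar>g x\<bar> / (a + b)" using b by (simp add: t(3))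
    have "(t * (\<bar>f x\<bar> / a) + (1 - t) * (\<bar>g x\<bar> / b)) powr p
        \<le> t * (\<bar>f x\<bar> / a) powr p + (1 - t) * (\<bar>g x\<bar> / b) powr p"
      using a b t by (intro conv) auto
    also have "(t * (\<bar>f x\<bar> / a) + (1 - t) * (\<bar>g x\<bar> / b)) = (\<bar>f x\<bar> + \<bar>g x\<bar>) / (a + b)"
      by (simp only: e1 e2 add_divide_distrib)
    also have "\<dots> powr p = (\<bar>f x\<bar> + \<bar>g x\<bar>) powr p / C"
      using a b by (simp add: powr_divide C_def)
    finally have "(\<bar>f x\<bar> + \<bar>g x\<bar>) powr p
        \<le> C * (t * (\<bar>f x\<bar> powr p / a powr p) + (1 - t) * (\<bar>g x\<bar> powr p / b powr p))"
      using C(1) a b by (simp add: pos_divide_le_eq powr_divide mult.commute)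
    then show ?thesis by (simp add: ca_def cb_def t(3)) (simp add: t_def algebra_simps)
  qed
  have "(\<integral>\<^sup>+x. ennreal ((\<bar>f x\<bar> + \<bar>g x\<bar>) powr p) \<partial>M)
      \<le> (\<integral>\<^sup>+x. ennreal ca * ennreal (\<bar>f x\<bar> powr p) + ennreal cb * ennreal (\<bar>g x\<bar> powr p) \<partial>M)"
    using pw C by (intro nn_integral_mono) (simp add: ennreal_mult[symmetric] ennreal_leI flip: ennreal_plus)
  also have "\<dots> = ennreal ca * (\<integral>\<^sup>+x. \<bar>f x\<bar> powr p \<partial>M) + ennreal cb * (\<integral>\<^sup>+x. \<bar>g x\<bar> powr p \<partial>M)"
    by (simp add: nn_integral_add nn_integral_cmult)
  also have "\<dots> \<le> ennreal ca * ennreal (a powr p) + ennreal cb * ennreal (b powr p)"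
    by (intro add_mono mult_left_mono a b) auto
  also have "\<dots> = ennreal (ca * a powr p + cb * b powr p)"
    using C by (simp add: ennreal_mult)
  also have "ca * a powr p + cb * b powr p = C * ((a + b) / (a + b))"
    using a b by (simp only: add_divide_distrib distrib_left) (simp add: ca_def cb_def)
  finally show ?thesis using a b by (simp add: C_def)
qed

lemma nn_integral_Minkowski:
  fixes f g :: "'a \<Rightarrow> real"
  assumes [measurable]: "f \<in> borel_measurable M" "g \<in> borel_measurable M" and p: "1 \<le> p"
    and a: "moment_le M p f a" "0 \<le> a"
    and b: "moment_le M p g b" "0 \<le> b"
  shows "(\<integral>\<^sup>+x. ennreal ((\<bar>f x\<bar> + \<bar>g x\<bar>) powr p) \<partial>M) \<le> ennreal ((a + b) powr p)"
proof -
  have zero: "AE x in M. h x = 0" if [measurable]: "h \<in> borel_measurable M"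
    and h: "moment_le M p h 0" for h :: "'a \<Rightarrow> real"
  proof -
    have "(\<integral>\<^sup>+x. ennreal (\<bar>h x\<bar> powr p) \<partial>M) = 0" using h by simp
    then have "AE x in M. \<bar>h x\<bar> powr p \<le> 0"
      by (subst (asm) nn_integral_0_iff_AE) (auto simp: ennreal_eq_0_iff)
    then show ?thesis by (auto elim!: eventually_mono)
  qed
  consider "a = 0" | "b = 0" | "0 < a" "0 < b" using a b by linarith
  then show ?thesis
  proof cases
    case 1
    with zero[of f] a have "AE x in M. f x = 0" by simp
    then have "(\<integral>\<^sup>+x. ennreal ((\<bar>f x\<bar> + \<bar>g x\<bar>) powr p) \<partial>M) = (\<integral>\<^sup>+x. ennreal (\<bar>g x\<bar> powr p) \<partial>M)"
      by (intro nn_integral_cong_AE) auto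
    with b 1 show ?thesis by simp
  next
    case 2
    with zero[of g] b have "AE x in M. g x = 0" by simp
    then have "(\<integral>\<^sup>+x. ennreal ((\<bar>f x\<bar> + \<bar>g x\<bar>) powr p) \<partial>M) = (\<integral>\<^sup>+x. ennreal (\<bar>f x\<bar> powr p) \<partial>M)"
      by (intro nn_integral_cong_AE) auto
    with a 2 show ?thesis by simp
  next
    case 3
    then show ?thesis using assms by (intro nn_integral_Minkowski_pos) auto
  qed
qed

section \<open>The martingale moment inequality\<close>

text \<open>In the expansion of |S + X|^p the linear term has mean zero, since its other factor is a
  function of S and hence G-measurable; Hoelder and Minkowski bound the quadratic remainder.
  \<open>powr_add_quadratic_le\<close> turns the result into a sum of squares, which makes the step
  iterable.\<close>

lemma (in prob_space) martingale_step_moment: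
  fixes S X :: "'a \<Rightarrow> real"
  assumes G: "subalgebra M G" and S_G: "S \<in> borel_measurable G"
    and X: "integrable M X" and XG: "AE x in M. real_cond_exp M G X x = 0"
    and p: "2 \<le> p"
    and b: "moment_le M p S b" "0 \<le> b"
    and y: "moment_le M p X y" "0 \<le> y"
  shows "(\<integral>\<^sup>+x. ennreal (\<bar>S x + X x\<bar> powr p) \<partial>M) \<le> ennreal ((b\<^sup>2 + (2 * (p - 1) * y)\<^sup>2) powr (p / 2))"
proof -
  interpret finite_measure_subalgebra M G by unfold_locales (rule G)
  have [measurable]: "S \<in> borel_measurable M" using measurable_from_subalg[OF G S_G] .
  have [measurable]: "X \<in> borel_measurable M" using X by auto
  define h where "h x = signed_powr (p - 1) (S x)" for x
  define W where "W x = (X x)\<^sup>2 * (\<bar>S x\<bar> + \<bar>X x\<bar>) powr (p - 2)" for x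
  have h_G: "h \<in> borel_measurable G"
    unfolding h_def by (rule measurable_compose[OF S_G]) auto
  have [measurable]: "h \<in> borel_measurable M" "W \<in> borel_measurable M"
    unfolding h_def W_def by measurable
  have W0: "0 \<le> W x" for x by (simp add: W_def)
  have iS: "integrable M (\<lambda>x. \<bar>S x\<bar> powr p)"
    using b by (intro integrableI_nonneg) (auto simp: less_top[symmetric] top_unique dest: order_trans)
  have iX: "integrable M (\<lambda>x. \<bar>X x\<bar> powr p)"
    using y by (intro integrableI_nonneg) (auto simp: less_top[symmetric] top_unique dest: order_trans)
  have W: "(\<integral>\<^sup>+x. ennreal (W x) \<partial>M) \<le> ennreal (y\<^sup>2 * (b + y) powr (p - 2))"
  \<comment> \<open>For p = 2 the Hoelder weight 2 / p would be 1, outside the open interval. The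
    convention 0 powr 0 = 0 does no harm here, because X is 0 wherever |S| + |X| is.\<close>
  proof (cases "p = 2")
    case True
    have "(\<integral>\<^sup>+x. ennreal (W x) \<partial>M) = (\<integral>\<^sup>+x. ennreal (\<bar>X x\<bar> powr p) \<partial>M)"
      by (intro nn_integral_cong) (auto simp: W_def True)
    with y b show ?thesis
      by (cases "y = 0") (auto simp: True)
  next
    case False
    with p have p2: "2 < p" by simp
    have "(\<integral>\<^sup>+x. ennreal ((\<bar>X x\<bar> powr p) powr (2 / p) * ((\<bar>S x\<bar> + \<bar>X x\<bar>) powr p) powr (1 - 2 / p)) \<partial>M)
        \<le> ennreal ((y powr p) powr (2 / p) * ((b + y) powr p) powr (1 - 2 / p))"
      using p2 b y by (intro nn_integral_Hoelder nn_integral_Minkowski) auto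
    moreover have "(\<bar>c\<bar> powr p) powr (2 / p) = c\<^sup>2" for c :: real
      using p2 by (cases "c = 0") (auto simp: powr_powr)
    moreover have "(c powr p) powr (1 - 2 / p) = c powr (p - 2)" for c :: real
      using p2 by (simp add: powr_powr right_diff_distrib)
    ultimately show ?thesis using y by (metis (no_types, lifting) W_def abs_of_nonneg nn_integral_cong)
  qed
  have iW: "integrable M W"
    using W W0 by (intro integrableI_nonneg) (auto simp: less_top[symmetric] top_unique dest: order_trans)
  \<comment> \<open>Pulling h out of the conditional expectation requires integrability of h X; the
    tangent inequality dominates |S|^(p - 1) |X| by p-th powers.\<close>
  have ihX: "integrable M (\<lambda>x. h x * X x)"
  proof (rule Bochner_Integration.integrable_bound)
    show "integrable M (\<lambda>x. \<bar>S x\<bar> powr p + \<bar>X x\<bar> powr p)" using iS iX by auto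
    have "\<bar>h x * X x\<bar> \<le> \<bar>S x\<bar> powr p + \<bar>X x\<bar> powr p" for x
    proof (cases "S x = 0")
      case False
      have "1 * (\<bar>S x\<bar> powr (p - 1) * \<bar>X x\<bar>) \<le> p * (\<bar>S x\<bar> powr (p - 1) * \<bar>X x\<bar>)"
        using p by (intro mult_right_mono) auto
      also have "\<dots> \<le> (p - 1) * \<bar>S x\<bar> powr p + \<bar>X x\<bar> powr p"
        using powr_tangent[of p "\<bar>S x\<bar>" "\<bar>X x\<bar>"] False p by (simp add: mult.assoc)
      finally have "p * (\<bar>S x\<bar> powr (p - 1) * \<bar>X x\<bar>) \<le> (p - 1) * \<bar>S x\<bar> powr p + \<bar>X x\<bar> powr p"
        using powr_tangent[of p "\<bar>S x\<bar>" "\<bar>X x\<bar>"] False p by (simp add: mult.assoc)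
      also have "\<dots> \<le> p * (\<bar>S x\<bar> powr p + \<bar>X x\<bar> powr p)"
      proof -
        have "1 * \<bar>X x\<bar> powr p \<le> p * \<bar>X x\<bar> powr p" using p by (intro mult_right_mono) auto
        then have "(p - 1) * \<bar>S x\<bar> powr p + \<bar>X x\<bar> powr p \<le> p * \<bar>S x\<bar> powr p + p * \<bar>X x\<bar> powr p"
          by (intro add_mono mult_right_mono) auto
        then show ?thesis by (simp add: distrib_left)
      qed
      finally have "\<bar>S x\<bar> powr (p - 1) * \<bar>X x\<bar> \<le> \<bar>S x\<bar> powr p + \<bar>X x\<bar> powr p"
        using p by simp
      then show ?thesis by (simp add: h_def abs_mult abs_signed_powr)
    qed (simp add: h_def signed_powr_def)
    then show "AE x in M. norm (h x * X x) \<le> norm (\<bar>S x\<bar> powr p + \<bar>X x\<bar> powr p)"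
      by (intro AE_I2) force
  qed auto
  have hX: "(\<integral>x. h x * X x \<partial>M) = 0"
  proof -
    have "(\<integral>x. h x * X x \<partial>M) = (\<integral>x. h x * real_cond_exp M G X x \<partial>M)"
      using real_cond_exp_intg(2)[OF ihX h_G] by simp
    also have "\<dots> = (\<integral>x. 0 \<partial>M)"
      using XG by (intro integral_cong_AE) auto
    finally show ?thesis by simp
  qed
  define R where "R x = \<bar>S x\<bar> powr p + p * (h x * X x) + p * (p - 1) * W x" for x
  have pw: "\<bar>S x + X x\<bar> powr p \<le> R x" for x
    using abs_powr_add_le[OF p, of "S x" "X x"] by (simp add: R_def W_def h_def mult.assoc)
  have iR: "integrable M R"
    unfolding R_def using iS ihX iW by auto
  have "(\<integral>\<^sup>+x. ennreal (\<bar>S x + X x\<bar> powr p) \<partial>M) \<le> (\<integral>\<^sup>+x. ennreal (R x) \<partial>M)"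
    using pw by (intro nn_integral_mono ennreal_leI)
  also have "\<dots> = ennreal (\<integral>x. R x \<partial>M)"
    using iR pw by (intro nn_integral_eq_integral) (auto intro!: AE_I2 order_trans[OF _ pw])
  also have "(\<integral>x. R x \<partial>M) = (\<integral>x. \<bar>S x\<bar> powr p \<partial>M) + p * (p - 1) * (\<integral>x. W x \<partial>M)"
    unfolding R_def using iS ihX iW hX by simp
  also have "\<dots> \<le> b powr p + p * (p - 1) * (y\<^sup>2 * (b + y) powr (p - 2))"
  proof (intro add_mono mult_left_mono)
    show "(\<integral>x. \<bar>S x\<bar> powr p \<partial>M) \<le> b powr p"
      using b iS by (simp add: nn_integral_eq_integral ennreal_le_iff)
    show "(\<integral>x. W x \<partial>M) \<le> y\<^sup>2 * (b + y) powr (p - 2)"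
      using W iW W0 by (simp add: nn_integral_eq_integral ennreal_le_iff)
  qed (use p in auto)
  also have "\<dots> \<le> (b\<^sup>2 + (2 * (p - 1) * y)\<^sup>2) powr (p / 2)"
    using p b y by (intro powr_add_quadratic_le) auto
  finally show ?thesis by (simp add: ennreal_leI)
qed

text \<open>Squares of the norm bounds add up, one martingale step at a time, so the constant 2 (p -
  1) does not depend on n.\<close>

lemma (in prob_space) martingale_moment:
  fixes X :: "nat \<Rightarrow> 'a \<Rightarrow> real"
  assumes F: "prob_filtration M F" and X: "centered_martingale_differences M F X" and p: "2 \<le> p"
    and a: "\<And>i. 1 \<le> i \<Longrightarrow> i \<le> n \<Longrightarrow> moment_le M p (X i) (a i)"
    and a0: "\<And>i. 0 \<le> a i"
  shows "moment_le M p (\<lambda>x. \<Sum>i=1..n. X i x) (2 * (p - 1) * sqrt (\<Sum>i=1..n. (a i)\<^sup>2))"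
proof -
  have sub: "subalgebra M (F i)" for i using F by (simp add: prob_filtration_def)
  have mono: "sets (F i) \<subseteq> sets (F j)" if "i \<le> j" for i j
    using F that by (auto simp: prob_filtration_def filtration_def)
  have XF: "X i \<in> borel_measurable (F j)" if "1 \<le> i" "i \<le> j" for i j
  proof -
    have "X i \<in> borel_measurable (F i)"
      using X that by (simp add: centered_martingale_differences_def)
    moreover have "subalgebra (F j) (F i)"
      using sub mono[OF that(2)] by (simp add: subalgebra_def)
    ultimately show ?thesis by (metis measurable_from_subalg)
  qed
  show ?thesis using a
  proof (induction n)
    case 0
    then show ?case using p by simp
  next
    case (Suc n)
    define b where "b = 2 * (p - 1) * sqrt (\<Sum>i=1..n. (a i)\<^sup>2)"
    have s0: "0 \<le> (\<Sum>i=1..n. (a i)\<^sup>2)" by (intro sum_nonneg) auto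
    have b0: "0 \<le> b" using p s0 by (simp add: b_def)
    have "(\<integral>\<^sup>+x. ennreal (\<bar>(\<Sum>i=1..n. X i x) + X (Suc n) x\<bar> powr p) \<partial>M)
        \<le> ennreal ((b\<^sup>2 + (2 * (p - 1) * a (Suc n))\<^sup>2) powr (p / 2))"
    proof (rule martingale_step_moment[OF sub[of n]])
      show "(\<lambda>x. \<Sum>i=1..n. X i x) \<in> borel_measurable (F n)"
        by (intro borel_measurable_sum XF) auto
      show "integrable M (X (Suc n))" "AE x in M. real_cond_exp M (F n) (X (Suc n)) x = 0"
        using X by (auto simp: centered_martingale_differences_def)
    qed (use Suc a0 b0 p in \<open>auto simp: b_def\<close>)
    also have "b\<^sup>2 + (2 * (p - 1) * a (Suc n))\<^sup>2 = (2 * (p - 1) * sqrt (\<Sum>i=1..Suc n. (a i)\<^sup>2))\<^sup>2"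
      using s0 by (simp add: b_def power_mult_distrib distrib_left)
    also have "\<dots> powr (p / 2) = (2 * (p - 1) * sqrt (\<Sum>i=1..Suc n. (a i)\<^sup>2)) powr p"
      using p by (cases "2 * (p - 1) * sqrt (\<Sum>i=1..Suc n. (a i)\<^sup>2) = 0")
        (auto simp: powr_powr sum_nonneg simp flip: powr_numeral)
    finally show ?case by simp
  qed
qed

section \<open>Chaining\<close>

text \<open>The maximum is at most the q-th root of the sum of q-th powers; Hoelder against the
  constant 1 moves the root outside the integral.\<close>

lemma (in prob_space) nn_integral_SUP_finite_le:
  fixes f :: "'i \<Rightarrow> 'a \<Rightarrow> real"
  assumes fin: "finite T" and [measurable]: "\<And>i. i \<in> T \<Longrightarrow> f i \<in> borel_measurable M"
    and q: "1 < q" and a: "0 \<le> a" and card: "real (card T) \<le> c"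
    and f: "\<And>i. i \<in> T \<Longrightarrow> moment_le M q (f i) a"
  shows "(\<integral>\<^sup>+x. (SUP i\<in>T. ennreal \<bar>f i x\<bar>) \<partial>M) \<le> ennreal (c powr (1 / q) * a)"
proof -
  define u where "u x = (\<Sum>i\<in>T. \<bar>f i x\<bar> powr q)" for x
  have [measurable]: "u \<in> borel_measurable M" unfolding u_def by measurable
  have u0: "0 \<le> u x" for x by (auto simp: u_def intro: sum_nonneg)
  have c0: "0 \<le> c" using card by (metis of_nat_0_le_iff order_trans)
  have "(SUP i\<in>T. ennreal \<bar>f i x\<bar>) \<le> ennreal (u x powr (1 / q) * 1 powr (1 - 1 / q))" for x
  proof (intro SUP_least)
    fix i assume "i \<in> T"
    then have "\<bar>f i x\<bar> powr q \<le> u x"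
      unfolding u_def using fin by (intro member_le_sum) auto
    then have "(\<bar>f i x\<bar> powr q) powr (1 / q) \<le> u x powr (1 / q)"
      using q by (intro powr_mono2) auto
    then show "ennreal \<bar>f i x\<bar> \<le> ennreal (u x powr (1 / q) * 1 powr (1 - 1 / q))"
      using q by (intro ennreal_leI) (simp add: powr_powr)
  qed
  then have "(\<integral>\<^sup>+x. (SUP i\<in>T. ennreal \<bar>f i x\<bar>) \<partial>M)
      \<le> (\<integral>\<^sup>+x. ennreal (u x powr (1 / q) * 1 powr (1 - 1 / q)) \<partial>M)"
    by (intro nn_integral_mono)
  also have "\<dots> \<le> ennreal ((c * a powr q) powr (1 / q) * 1 powr (1 - 1 / q))"
  proof (rule nn_integral_Hoelder)
    have "(\<integral>\<^sup>+x. ennreal (u x) \<partial>M) = (\<Sum>i\<in>T. \<integral>\<^sup>+x. ennreal (\<bar>f i x\<bar> powr q) \<partial>M)"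
      by (simp add: u_def nn_integral_sum sum_ennreal[symmetric] del: sum_ennreal)
    also have "\<dots> \<le> (\<Sum>i\<in>T. ennreal (a powr q))" by (intro sum_mono f)
    also have "\<dots> = ennreal (real (card T) * a powr q)"
      by (simp add: ennreal_mult ennreal_of_nat_eq_real_of_nat)
    also have "\<dots> \<le> ennreal (c * a powr q)"
      using card by (intro ennreal_leI mult_right_mono) auto
    finally show "(\<integral>\<^sup>+x. ennreal (u x) \<partial>M) \<le> ennreal (c * a powr q)" .
  qed (use u0 q c0 emeasure_space_1 in auto)
  also have "(c * a powr q) powr (1 / q) * 1 powr (1 - 1 / q) = c powr (1 / q) * a"
    using a q c0 by (simp add: powr_mult powr_powr)
  finally show ?thesis .
qed

text \<open>Taken over a set D that will be countable, which makes it measurable as a function of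
  the sample point.\<close>

definition modulus :: "('v \<Rightarrow> 'v \<Rightarrow> ennreal) \<Rightarrow> 'v set \<Rightarrow> real \<Rightarrow> ('v \<Rightarrow> real) \<Rightarrow> ennreal" where
  "modulus d D \<delta> x = (SUP (v, w)\<in>{(v, w). v \<in> D \<and> w \<in> D \<and> d v w < ennreal \<delta>}. ennreal \<bar>x v - x w\<bar>)"

text \<open>Pairs of close points are compared by choosing one representative pair for every pair of
  ancestors at a fixed level; the ancestors themselves need not be close.\<close>

lemma (in prob_space) chaining_modulus:
  fixes d :: "'v \<Rightarrow> 'v \<Rightarrow> ennreal" and X :: "'n \<Rightarrow> 'v \<Rightarrow> 'a \<Rightarrow> real"
    and C :: "nat \<Rightarrow> 'v set" and q A :: "nat \<Rightarrow> real"
  assumes C: "\<And>k. finite (C k)" "\<And>k. C k \<subseteq> V" "\<And>k v. v \<in> V \<Longrightarrow> \<exists>c\<in>C k. d c v \<le> ennreal ((1/2) ^ k)"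
    and E: "countable E" "E \<subseteq> V" "E \<noteq> {}"
    and X [measurable]: "\<And>n v. n \<in> I \<Longrightarrow> v \<in> V \<Longrightarrow> X n v \<in> borel_measurable M"
    and q: "\<And>k. 1 < q k" and A: "\<And>k. 0 \<le> A k"
    and link: "\<And>k n v w r. n \<in> I \<Longrightarrow> v \<in> V \<Longrightarrow> w \<in> V \<Longrightarrow> 0 \<le> r \<Longrightarrow> d v w \<le> ennreal r \<Longrightarrow>
       moment_le M (q k) (\<lambda>x. X n v x - X n w x) (A k * r)"
    and sum: "summable (\<lambda>k. (1/2) ^ k * ((real (card (C k)) + 1) powr (1 / q k) * A k))"
  obtains D where "countable D" "E \<subseteq> D" "D \<subseteq> V" "\<And>k. C k \<subseteq> D"
    "\<And>e. 0 < e \<Longrightarrow> \<exists>\<delta>>0. \<forall>n\<in>I. (\<integral>\<^sup>+x. modulus d D \<delta> (\<lambda>v. X n v x) \<partial>M) \<le> ennreal e"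
proof -
  \<comment> \<open>The k-th point of an enumeration of E joins the k-th net. This brings all of E
    into D at the price of one extra point per level.\<close>
  define L where "L k = insert (from_nat_into E k) (C k)" for k
  define D where "D = (\<Union>k. L k)"
  define T where "T k = (\<Union>j\<le>k. L j)" for k
  \<comment> \<open>Chains follow the levels at which points first occur: a parent is a point of the
    net one level coarser, hence of strictly smaller level, so every chain is finite.\<close>
  define lev where "lev v = (LEAST k. v \<in> L k)" for v
  define par where "par v = (if lev v = 0 then v
      else SOME c. c \<in> C (lev v - 1) \<and> d c v \<le> ennreal ((1/2) ^ (lev v - 1)))" for v
  define K where "K j = {v \<in> L j. lev v = j}" for j
  define Y where "Y x j = (SUP v\<in>K j. ennreal \<bar>x (par v) - x v\<bar>)" for x :: "'v \<Rightarrow> real" and j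
  have finL: "finite (L k)" for k by (simp add: L_def C)
  have finT: "finite (T k)" for k by (simp add: T_def finL)
  have LV: "L k \<subseteq> V" for k using C(2) from_nat_into[OF E(3), of k] E(2) by (auto simp: L_def)
  have DV: "D \<subseteq> V" using LV by (auto simp: D_def)
  have levL: "v \<in> L (lev v)" if "v \<in> D" for v
    using that unfolding D_def lev_def by (auto intro: LeastI)
  have lev_le: "lev v \<le> k" if "v \<in> L k" for v k
    using that unfolding lev_def by (rule Least_le)
  have parC: "par v \<in> C (lev v - 1) \<and> d (par v) v \<le> ennreal ((1/2) ^ (lev v - 1))"
    if "v \<in> D" "lev v \<noteq> 0" for v
  proof -
    have "\<exists>c. c \<in> C (lev v - 1) \<and> d c v \<le> ennreal ((1/2) ^ (lev v - 1))"
      using C(3)[of v "lev v - 1"] that DV by blast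
    from someI_ex[OF this] that show ?thesis by (simp add: par_def)
  qed
  have parD: "par v \<in> D" if "v \<in> D" for v
    using that parC[of v] by (cases "lev v = 0") (auto simp: par_def D_def L_def)
  have Y_le: "ennreal \<bar>x (par v) - x v\<bar> \<le> Y x (lev v)" if "v \<in> D" for x v
    unfolding Y_def K_def using levL[OF that] by (intro SUP_upper) auto
  \<comment> \<open>The ancestor must not depend on x, which will be a random path; hence the
    quantifier over x stands inside the existence.\<close>
  have anc_ex: "\<exists>a\<in>T k. \<forall>x. ennreal \<bar>x a - x v\<bar> \<le> (\<Sum>j\<in>{k<..lev v}. Y x j)" if "v \<in> D" for v k
    using that
  proof (induction "lev v" arbitrary: v rule: less_induct)
    case less
    show ?case
    proof (cases "lev v \<le> k")
      case True
      then have "v \<in> T k" using levL[OF less.prems] by (auto simp: T_def)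
      then show ?thesis by (intro bexI[of _ v]) auto
    next
      case False
      then have "lev v \<noteq> 0" by auto
      with parC[OF less.prems] have "par v \<in> L (lev v - 1)" by (auto simp: L_def)
      then have lt: "lev (par v) \<le> lev v - 1" by (rule lev_le)
      then have "lev (par v) < lev v" using \<open>lev v \<noteq> 0\<close> by linarith
      from less.hyps[OF this parD[OF less.prems]]
      obtain a where a: "a \<in> T k" "\<And>x. ennreal \<bar>x a - x (par v)\<bar> \<le> (\<Sum>j\<in>{k<..lev (par v)}. Y x j)"
        by auto
      have "ennreal \<bar>x a - x v\<bar> \<le> (\<Sum>j\<in>{k<..lev v}. Y x j)" for x
      proof -
        have "ennreal \<bar>x a - x v\<bar> \<le> ennreal \<bar>x a - x (par v)\<bar> + ennreal \<bar>x (par v) - x v\<bar>"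
          by (simp flip: ennreal_plus)
        also have "\<dots> \<le> (\<Sum>j\<in>{k<..lev v - 1}. Y x j) + Y x (lev v)"
          using lt by (intro add_mono order_trans[OF a(2)] sum_mono2 Y_le less.prems) auto
        also have "\<dots> = (\<Sum>j\<in>insert (lev v) {k<..lev v - 1}. Y x j)"
          using \<open>lev v \<noteq> 0\<close> by (subst sum.insert) (auto simp: add.commute)
        also have "insert (lev v) {k<..lev v - 1} = {k<..lev v}"
          using False by auto
        finally show ?thesis .
      qed
      with a(1) show ?thesis by blast
    qed
  qed
  have "\<forall>v k. \<exists>a. v \<in> D \<longrightarrow> a \<in> T k \<and> (\<forall>x. ennreal \<bar>x a - x v\<bar> \<le> (\<Sum>j\<in>{k<..lev v}. Y x j))"
    using anc_ex by blast
  then obtain anc where anc: "\<And>v k. v \<in> D \<Longrightarrow> anc v k \<in> T k"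
      "\<And>v k x. v \<in> D \<Longrightarrow> ennreal \<bar>x (anc v k) - x v\<bar> \<le> (\<Sum>j\<in>{k<..lev v}. Y x j)"
    by metis
  define R where "R x k = (\<Sum>i. Y x (i + Suc k))" for x k
  have anc_R: "ennreal \<bar>x (anc v k) - x v\<bar> \<le> R x k" if "v \<in> D" for x v k
  proof -
    have "(\<Sum>j\<in>{k<..lev v}. Y x j) = (\<Sum>i<lev v - k. Y x (i + Suc k))"
      by (rule sum.reindex_bij_witness[of _ "\<lambda>i. i + Suc k" "\<lambda>j. j - Suc k"]) auto
    also have "\<dots> \<le> R x k" unfolding R_def by (intro sum_le_suminf) auto
    finally show ?thesis using anc(2)[OF that] by (metis order_trans)
  qed
  define b where "b k = (1/2) ^ k * ((real (card (C k)) + 1) powr (1 / q k) * A k)" for k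
  have b0: "0 \<le> b k" for k using A by (simp add: b_def)
  have KD: "K j \<subseteq> D" for j by (auto simp: K_def D_def)
  have KV: "K j \<subseteq> V" "par ` K j \<subseteq> V" for j
    using KD[of j] parD DV by blast+
  have Ymeas: "(\<lambda>x. Y (\<lambda>v. X n v x) j) \<in> borel_measurable M" if "n \<in> I" for n j
  proof -
    have "countable (K j)" using finL[of j] by (simp add: K_def uncountable_infinite countable_finite)
    then show ?thesis unfolding Y_def using that KV[of j]
      by (intro borel_measurable_SUP measurable_compose[OF _ measurable_ennreal] borel_measurable_abs
          borel_measurable_diff X) auto
  qed
  \<comment> \<open>A link into level j + 1 has length (1/2)^j, twice the scale of its own level;
    hence the factor 2.\<close>
  have EY: "(\<integral>\<^sup>+x. Y (\<lambda>v. X n v x) (Suc j) \<partial>M) \<le> ennreal (2 * b (Suc j))" if "n \<in> I" for n j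
  proof -
    have "(\<integral>\<^sup>+x. Y (\<lambda>v. X n v x) (Suc j) \<partial>M)
        \<le> ennreal ((real (card (C (Suc j))) + 1) powr (1 / q (Suc j)) * (A (Suc j) * (1/2) ^ j))"
      unfolding Y_def
    proof (rule nn_integral_SUP_finite_le)
      show "finite (K (Suc j))" using finL by (simp add: K_def)
      have "card (K (Suc j)) \<le> card (L (Suc j))" using finL by (intro card_mono) (auto simp: K_def)
      also have "\<dots> \<le> Suc (card (C (Suc j)))" unfolding L_def by (rule card_insert_le_m1) auto
      finally show "real (card (K (Suc j))) \<le> real (card (C (Suc j))) + 1" by simp
      fix v assume v: "v \<in> K (Suc j)"
      then have "v \<in> D" "lev v = Suc j" by (auto simp: K_def D_def)
      with parC[of v] have "d (par v) v \<le> ennreal ((1/2) ^ j)" by simp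
      with v KV[of "Suc j"] that show "(\<integral>\<^sup>+x. ennreal (\<bar>X n (par v) x - X n v x\<bar> powr q (Suc j)) \<partial>M)
          \<le> ennreal ((A (Suc j) * (1/2) ^ j) powr q (Suc j))"
        by (intro link) auto
      show "(\<lambda>x. X n (par v) x - X n v x) \<in> borel_measurable M"
        using v KV[of "Suc j"] that by (intro borel_measurable_diff X) auto
    qed (use q A in auto)
    also have "(real (card (C (Suc j))) + 1) powr (1 / q (Suc j)) * (A (Suc j) * (1/2) ^ j) = 2 * b (Suc j)"
      by (simp add: b_def)
    finally show ?thesis .
  qed
  have uniform: "\<exists>\<delta>>0. \<forall>n\<in>I. (\<integral>\<^sup>+x. modulus d D \<delta> (\<lambda>v. X n v x) \<partial>M) \<le> ennreal e" if e: "0 < e" for e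
  proof -
    have sb: "summable b" using sum by (simp add: b_def[abs_def])
    \<comment> \<open>Four chains, each of mean at most 2 e / 16, use up e / 2; the representative
      pairs get the other half.\<close>
    from suminf_exist_split[of "e / 16" b] e sb obtain k0 where
      k0: "\<And>n. n \<ge> k0 \<Longrightarrow> norm (\<Sum>i. b (i + n)) < e / 16" by auto
    have "norm (\<Sum>i. b (i + Suc k0)) < e / 16" by (rule k0) simp
    then have tail: "(\<Sum>i. b (i + Suc k0)) \<le> e / 16" by simp
    define c where "c = real ((card (T k0))\<^sup>2)"
    \<comment> \<open>With k0 fixed, a maximum over at most c pairs at distance \<delta> becomes
      small with \<delta> for any exponent; \<open>q 0\<close> is taken. The summand 1 keeps the
      divisor in \<open>\<delta>\<close> positive.\<close>
    define s where "s = c powr (1 / q 0) * A 0 + 1"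
    define \<delta> where "\<delta> = e / (2 * s)"
    have den: "0 < s" using A[of 0] by (simp add: s_def add_nonneg_pos)
    have \<delta>: "0 < \<delta>" using den e by (simp add: \<delta>_def)
    define P where "P = (\<lambda>(v, w). (anc v k0, anc w k0)) ` {(v, w). v \<in> D \<and> w \<in> D \<and> d v w < ennreal \<delta>}"
    have PT: "P \<subseteq> T k0 \<times> T k0" using anc(1) by (auto simp: P_def)
    then have finP: "finite P" using finT finite_subset by blast
    have cardP: "real (card P) \<le> c"
      using card_mono[OF _ PT] finT by (simp add: c_def card_cartesian_product power2_eq_square flip: of_nat_mult)
    have "\<forall>z\<in>P. \<exists>v w. v \<in> D \<and> w \<in> D \<and> d v w < ennreal \<delta> \<and> z = (anc v k0, anc w k0)"
      by (auto simp: P_def)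
    then obtain f g where fg: "\<And>z. z \<in> P \<Longrightarrow> f z \<in> D \<and> g z \<in> D \<and> d (f z) (g z) < ennreal \<delta> \<and> z = (anc (f z) k0, anc (g z) k0)"
      by metis
    show ?thesis
    proof (intro exI[of _ \<delta>] conjI \<delta> ballI)
      fix n assume n: "n \<in> I"
      define Z where "Z x = (SUP z\<in>P. ennreal \<bar>X n (f z) x - X n (g z) x\<bar>)" for x
      have [measurable]: "(\<lambda>x. X n (f z) x - X n (g z) x) \<in> borel_measurable M" if "z \<in> P" for z
        using fg[OF that] DV n by (intro borel_measurable_diff X) auto
      have [measurable]: "Z \<in> borel_measurable M"
        unfolding Z_def using finP by (intro borel_measurable_SUP) (auto simp: countable_finite)
      have Rm [measurable]: "(\<lambda>x. R (\<lambda>v. X n v x) k0) \<in> borel_measurable M"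
        unfolding R_def using Ymeas[OF n] by measurable
      have pw: "modulus d D \<delta> (\<lambda>v. X n v x)
          \<le> 4 * R (\<lambda>v. X n v x) k0 + Z x" for x
        unfolding modulus_def
      proof (intro SUP_least, clarify)
        fix v w assume vw: "v \<in> D" "w \<in> D" "d v w < ennreal \<delta>"
        define z where "z = (anc v k0, anc w k0)"
        have z: "z \<in> P" using vw by (auto simp: P_def z_def)
        let ?x = "\<lambda>v. X n v x"
        \<comment> \<open>v and \<open>f z\<close> share their ancestor, as do w and
          \<open>g z\<close>: the way from v to w leads up to the first ancestor, down to
          \<open>f z\<close>, across to \<open>g z\<close>, up to the second ancestor and down to
          w.\<close>
        have "\<bar>?x v - ?x w\<bar> \<le> \<bar>?x (anc v k0) - ?x v\<bar> + \<bar>?x (anc (f z) k0) - ?x (f z)\<bar>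
            + \<bar>?x (anc (g z) k0) - ?x (g z)\<bar> + \<bar>?x (anc w k0) - ?x w\<bar> + \<bar>?x (f z) - ?x (g z)\<bar>"
          using fg[OF z] by (simp add: z_def)
        then have "ennreal \<bar>?x v - ?x w\<bar> \<le> ennreal (\<bar>?x (anc v k0) - ?x v\<bar> + \<bar>?x (anc (f z) k0) - ?x (f z)\<bar>
            + \<bar>?x (anc (g z) k0) - ?x (g z)\<bar> + \<bar>?x (anc w k0) - ?x w\<bar> + \<bar>?x (f z) - ?x (g z)\<bar>)"
          by (rule ennreal_leI)
        also have "\<dots> = ennreal \<bar>?x (anc v k0) - ?x v\<bar> + ennreal \<bar>?x (anc (f z) k0) - ?x (f z)\<bar>
            + ennreal \<bar>?x (anc (g z) k0) - ?x (g z)\<bar> + ennreal \<bar>?x (anc w k0) - ?x w\<bar> + ennreal \<bar>?x (f z) - ?x (g z)\<bar>"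
          by (simp add: ennreal_plus[symmetric] del: ennreal_plus)
        also have "\<dots> \<le> R ?x k0 + R ?x k0 + R ?x k0 + R ?x k0 + Z x"
        proof -
          note a = anc_R[of _ ?x k0]
          have "ennreal \<bar>?x (f z) - ?x (g z)\<bar> \<le> Z x" unfolding Z_def using z by (intro SUP_upper)
          then show ?thesis using fg[OF z] vw by (intro add_mono a) auto
        qed
        also have "\<dots> = 4 * R ?x k0 + Z x"
        proof -
          have "r + r + r + r = 4 * r" for r :: ennreal
          proof -
            have "4 * r = (1 + 1 + 1 + 1) * r" by simp
            then show ?thesis by (simp only: distrib_right mult_1_left)
          qed
          then show ?thesis by simp
        qed
        finally show "ennreal \<bar>?x v - ?x w\<bar> \<le> 4 * R ?x k0 + Z x" .
      qed
      have ER: "(\<integral>\<^sup>+x. R (\<lambda>v. X n v x) k0 \<partial>M) \<le> ennreal (e / 8)"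
      proof -
        have "(\<integral>\<^sup>+x. R (\<lambda>v. X n v x) k0 \<partial>M) = (\<Sum>i. \<integral>\<^sup>+x. Y (\<lambda>v. X n v x) (i + Suc k0) \<partial>M)"
          unfolding R_def using Ymeas[OF n] by (intro nn_integral_suminf) auto
        also have "\<dots> \<le> (\<Sum>i. ennreal (2 * b (i + Suc k0)))"
          using EY[OF n] by (intro suminf_le) auto
        also have "\<dots> = ennreal (\<Sum>i. 2 * b (i + Suc k0))"
          using sb b0 by (intro suminf_ennreal2 summable_mult) (auto simp only: summable_iff_shift mult_nonneg_nonneg zero_le_numeral)
        also have "(\<Sum>i. 2 * b (i + Suc k0)) = 2 * (\<Sum>i. b (i + Suc k0))"
          using sb by (intro suminf_mult) (simp only: summable_iff_shift)
        also have "ennreal \<dots> \<le> ennreal (e / 8)" using tail by (intro ennreal_leI) simp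
        finally show ?thesis .
      qed
      have EZ: "(\<integral>\<^sup>+x. Z x \<partial>M) \<le> ennreal (e / 2)"
      proof -
        have "(\<integral>\<^sup>+x. Z x \<partial>M) \<le> ennreal (c powr (1 / q 0) * (A 0 * \<delta>))"
          unfolding Z_def
        proof (rule nn_integral_SUP_finite_le[OF finP])
          fix z assume "z \<in> P"
          with fg[OF this] DV n \<delta> show "moment_le M (q 0) (\<lambda>x. X n (f z) x - X n (g z) x) (A 0 * \<delta>)"
            by (intro link) (auto simp: less_imp_le)
        qed (use q A \<delta> cardP in auto)
        also have "c powr (1 / q 0) * (A 0 * \<delta>) \<le> s * \<delta>"
          using \<delta> by (simp add: s_def algebra_simps)
        also have "\<dots> = e / 2" using den by (simp add: \<delta>_def)
        finally show ?thesis by (simp add: ennreal_leI)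
      qed
      have "(\<integral>\<^sup>+x. modulus d D \<delta> (\<lambda>v. X n v x) \<partial>M) \<le> (\<integral>\<^sup>+x. 4 * R (\<lambda>v. X n v x) k0 + Z x \<partial>M)"
        by (intro nn_integral_mono pw)
      also have "\<dots> = 4 * (\<integral>\<^sup>+x. R (\<lambda>v. X n v x) k0 \<partial>M) + (\<integral>\<^sup>+x. Z x \<partial>M)"
        by (simp add: nn_integral_add nn_integral_cmult)
      also have "\<dots> \<le> 4 * ennreal (e / 8) + ennreal (e / 2)"
        by (intro add_mono mult_left_mono ER EZ) auto
      also have "\<dots> = ennreal (4 * (e / 8) + e / 2)"
      proof -
        have "4 * ennreal (e / 8) = ennreal (4 * (e / 8))" using e by (subst ennreal_mult) auto
        then show ?thesis using e by (simp only: ennreal_plus)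
      qed
      also have "4 * (e / 8) + e / 2 = e" by simp
      finally show "(\<integral>\<^sup>+x. modulus d D \<delta> (\<lambda>v. X n v x) \<partial>M) \<le> ennreal e" .
    qed
  qed
  show ?thesis
  proof (rule that[of D])
    show "countable D" unfolding D_def using finL by (simp add: countable_finite)
    have "E = range (from_nat_into E)" using E by (simp add: range_from_nat_into)
    then show "E \<subseteq> D" by (auto simp: D_def L_def)
    show "C k \<subseteq> D" for k by (auto simp: D_def L_def)
  qed (use DV uniform in auto)
qed

section \<open>The moment function and the semi-distance\<close>

lemma ennreal_powr_mono: "x \<le> y \<Longrightarrow> 0 < r \<Longrightarrow> ennreal_powr x r \<le> ennreal_powr y r"
  by (cases x; cases y) (auto simp: ennreal_powr_def top_unique intro!: ennreal_leI powr_mono2)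

lemma ennreal_powr_le_iff:
  assumes "0 < p" "0 \<le> a"
  shows "ennreal_powr x (1 / p) \<le> ennreal a \<longleftrightarrow> x \<le> ennreal (a powr p)"
proof (cases x)
  case (real r)
  have "r powr (1 / p) \<le> a \<longleftrightarrow> r \<le> a powr p"
  proof
    assume "r powr (1 / p) \<le> a"
    then have "(r powr (1 / p)) powr p \<le> a powr p" using assms by (intro powr_mono2) auto
    then show "r \<le> a powr p" using assms real by (simp add: powr_powr)
  next
    assume "r \<le> a powr p"
    then have "r powr (1 / p) \<le> (a powr p) powr (1 / p)" using assms real by (intro powr_mono2) auto
    then show "r powr (1 / p) \<le> a" using assms by (simp add: powr_powr)
  qed
  with real assms show ?thesis by (simp add: ennreal_powr_def ennreal_le_iff)
qed (auto simp: ennreal_powr_def top_unique)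

lemma Lp_norm_le_iff:
  assumes "0 < p" "0 \<le> a"
  shows "Lp_norm M p f \<le> ennreal a \<longleftrightarrow> moment_le M p f a"
  unfolding Lp_norm_def by (rule ennreal_powr_le_iff[OF assms])

lemma Lp_norm_eq_0_iff:
  assumes [measurable]: "f \<in> borel_measurable M" and p: "0 < p"
  shows "Lp_norm M p f = 0 \<longleftrightarrow> (AE x in M. f x = 0)"
proof -
  have "Lp_norm M p f = 0 \<longleftrightarrow> (\<integral>\<^sup>+x. ennreal (\<bar>f x\<bar> powr p) \<partial>M) = 0"
    using Lp_norm_le_iff[OF p, of 0 M f] by simp
  also have "\<dots> \<longleftrightarrow> (AE x in M. \<bar>f x\<bar> powr p \<le> 0)"
    by (subst nn_integral_0_iff_AE) (auto simp: ennreal_eq_0_iff)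
  also have "\<dots> \<longleftrightarrow> (AE x in M. f x = 0)" by (intro AE_cong) simp
  finally show ?thesis .
qed

lemma (in prob_space) Lp_norm_mono:
  assumes [measurable]: "f \<in> borel_measurable M" and p: "1 \<le> p" "p \<le> q"
  shows "Lp_norm M p f \<le> Lp_norm M q f"
proof (cases "Lp_norm M q f = \<top> \<or> p = q")
  case False
  define a where "a = enn2real (Lp_norm M q f)"
  have a: "0 \<le> a" "Lp_norm M q f = ennreal a" using False by (auto simp: a_def less_top)
  have q: "moment_le M q f a"
    using a p Lp_norm_le_iff[of q a M f] by simp
  have "(\<integral>\<^sup>+x. ennreal ((\<bar>f x\<bar> powr q) powr (p / q) * 1 powr (1 - p / q)) \<partial>M)
      \<le> ennreal ((a powr q) powr (p / q) * 1 powr (1 - p / q))"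
    using p False by (intro nn_integral_Hoelder q) (auto simp: emeasure_space_1)
  then have "Lp_norm M p f \<le> ennreal a"
    using p a(1) by (subst Lp_norm_le_iff) (auto simp: powr_powr)
  with a show ?thesis by simp
qed auto

lemma (in prob_space) mean_norm_mono:
  assumes "\<And>i. 1 \<le> i \<Longrightarrow> \<eta> i \<in> borel_measurable M" and p: "1 \<le> p" "p \<le> q"
  shows "mean_norm M p n \<eta> \<le> mean_norm M q n \<eta>"
  unfolding mean_norm_def using assms
  by (intro mult_mono ennreal_leI ennreal_powr_mono divide_right_mono_ennreal sum_mono power_mono Lp_norm_mono) auto

lemma mean_norm_eq_0_iff:
  assumes p: "1 < p" and n: "1 \<le> n"
  shows "mean_norm M p n \<eta> = 0 \<longleftrightarrow> (\<forall>i\<in>{1..n}. Lp_norm M p (\<eta> i) = 0)"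
proof -
  have *: "ennreal_powr x (1 / 2) = 0 \<longleftrightarrow> x = 0" for x
    using ennreal_powr_le_iff[of 2 0 x] by simp
  have "(\<Sum>i=1..n. (Lp_norm M p (\<eta> i))\<^sup>2) / of_nat n = 0 \<longleftrightarrow> (\<Sum>i=1..n. (Lp_norm M p (\<eta> i))\<^sup>2) = 0"
    using n by (auto simp: ennreal_divide_eq_0_iff)
  then show ?thesis using p by (auto simp: mean_norm_def * ennreal_eq_0_iff)
qed

lemma centered_martingale_differences_diff:
  assumes "prob_space M" "prob_filtration M F"
    and X: "centered_martingale_differences M F X" and Y: "centered_martingale_differences M F Y"
  shows "centered_martingale_differences M F (\<lambda>i \<omega>. X i \<omega> - Y i \<omega>)"
  unfolding centered_martingale_differences_def
proof (intro allI impI conjI)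
  fix i :: nat assume i: "1 \<le> i"
  note XY = X[unfolded centered_martingale_differences_def, rule_format, OF i]
      Y[unfolded centered_martingale_differences_def, rule_format, OF i]
  show "integrable M (\<lambda>\<omega>. X i \<omega> - Y i \<omega>)" "(\<integral>\<omega>. X i \<omega> - Y i \<omega> \<partial>M) = 0"
      "(\<lambda>\<omega>. X i \<omega> - Y i \<omega>) \<in> borel_measurable (F i)"
    using XY by auto
  fix k assume k: "k < i"
  interpret prob_space M by fact
  interpret finite_measure_subalgebra M "F k"
    using assms(2) by unfold_locales (simp add: prob_filtration_def)
  have "AE x in M. real_cond_exp M (F k) (\<lambda>x. X i x - Y i x) x
      = real_cond_exp M (F k) (X i) x - real_cond_exp M (F k) (Y i) x"
    using XY by (intro real_cond_exp_diff) auto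
  moreover have "AE x in M. real_cond_exp M (F k) (X i) x = 0" "AE x in M. real_cond_exp M (F k) (Y i) x = 0"
    using XY k by auto
  ultimately show "AE x in M. real_cond_exp M (F k) (\<lambda>x. X i x - Y i x) x = 0" by auto
qed

text \<open>Exhibits \<open>mean_norm\<close> as a scaled Euclidean norm of the vector of L^p norms,
  so that the triangle inequality for \<open>L2_set\<close> becomes available.\<close>

lemma mean_norm_eq_ennreal:
  assumes p: "1 \<le> p" and n: "1 \<le> n" and a: "\<And>i. i \<in> {1..n} \<Longrightarrow> Lp_norm M p (\<eta> i) = ennreal (a i)" "\<And>i. 0 \<le> a i"
  shows "mean_norm M p n \<eta> = ennreal ((p - 1) / sqrt n * L2_set a {1..n})"
proof -
  have "(\<Sum>i=1..n. (Lp_norm M p (\<eta> i))\<^sup>2) = (\<Sum>i=1..n. ennreal ((a i)\<^sup>2))"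
    using a by (intro sum.cong) (auto simp: ennreal_power)
  also have "\<dots> = ennreal (\<Sum>i=1..n. (a i)\<^sup>2)" by (subst sum_ennreal) auto
  finally have "(\<Sum>i=1..n. (Lp_norm M p (\<eta> i))\<^sup>2) / of_nat n = ennreal ((\<Sum>i=1..n. (a i)\<^sup>2) / n)"
    using n by (simp add: divide_ennreal ennreal_of_nat_eq_real_of_nat sum_nonneg)
  then have "mean_norm M p n \<eta> = ennreal (p - 1) * ennreal (sqrt ((\<Sum>i=1..n. (a i)\<^sup>2) / n))"
    unfolding mean_norm_def by (simp add: ennreal_powr_def powr_half_sqrt sum_nonneg)
  also have "\<dots> = ennreal ((p - 1) * sqrt ((\<Sum>i=1..n. (a i)\<^sup>2) / n))"
    using p by (simp add: ennreal_mult sum_nonneg)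
  finally show ?thesis by (simp add: L2_set_def real_sqrt_divide)
qed

lemma mean_norm_eq_top:
  assumes p: "1 < p" and i: "i \<in> {1..n}" "Lp_norm M p (\<eta> i) = \<top>"
  shows "mean_norm M p n \<eta> = \<top>"
proof -
  have "(Lp_norm M p (\<eta> i))\<^sup>2 \<le> (\<Sum>i=1..n. (Lp_norm M p (\<eta> i))\<^sup>2)"
    using i by (intro member_le_sum) auto
  then have "(\<Sum>i=1..n. (Lp_norm M p (\<eta> i))\<^sup>2) = \<top>" using i by (simp add: power2_eq_square top_unique)
  then have "(\<Sum>i=1..n. (Lp_norm M p (\<eta> i))\<^sup>2) / of_nat n = \<top>"
    by (simp only: ennreal_top_divide) simp
  then show ?thesis using p unfolding mean_norm_def
    by (simp only: ennreal_powr_def if_True simp_thms) (simp add: ennreal_mult_top)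
qed

text \<open>The factors p - 1 and n^(-1/2) in \<open>mean_norm\<close> absorb those of the normed
  sum in \<open>martingale_moment\<close>, which leaves the absolute constant 2.\<close>

lemma (in prob_space) normed_sum_moment:
  assumes F: "prob_filtration M F" and X: "centered_martingale_differences M F X" and p: "2 \<le> p"
    and n: "1 \<le> n" and m: "mean_norm M p n X \<le> ennreal m" "0 \<le> m"
  shows "moment_le M p (\<lambda>x. (\<Sum>i=1..n. X i x) / sqrt (real n)) (2 * m)"
proof -
  have Xm: "(\<lambda>x. \<Sum>i=1..n. X i x) \<in> borel_measurable M"
    using X by (intro borel_measurable_sum) (auto simp: centered_martingale_differences_def)
  have fin: "Lp_norm M p (X i) \<noteq> \<top>" if "i \<in> {1..n}" for i
    using mean_norm_eq_top[OF _ that, of p M X] m p by (auto simp: top_unique)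
  define a where "a i = enn2real (Lp_norm M p (X i))" for i
  have a0: "0 \<le> a i" for i by (simp add: a_def)
  have a: "Lp_norm M p (X i) = ennreal (a i)" if "i \<in> {1..n}" for i
    using fin[OF that] by (simp add: a_def less_top)
  define \<sigma> where "\<sigma> = L2_set a {1..n}"
  have \<sigma>: "0 \<le> \<sigma>" by (simp add: \<sigma>_def)
  have "mean_norm M p n X = ennreal ((p - 1) / sqrt n * \<sigma>)"
    unfolding \<sigma>_def using p n a a0 by (intro mean_norm_eq_ennreal) auto
  then have "(p - 1) / sqrt n * \<sigma> \<le> m"
    using p m \<sigma> by (simp add: ennreal_le_iff)
  then have le: "2 * (p - 1) * \<sigma> \<le> 2 * m * sqrt n"
    using n by (simp add: field_simps)
  have "moment_le M p (\<lambda>x. \<Sum>i=1..n. X i x) (2 * (p - 1) * \<sigma>)"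
    unfolding \<sigma>_def L2_set_def
  proof (rule martingale_moment[OF F X p])
    fix i assume "1 \<le> i" "i \<le> n"
    then show "moment_le M p (X i) (a i)"
      using Lp_norm_le_iff[of p "a i" M "X i"] p a[of i] a0[of i] by simp
  qed (rule a0)
  also have "\<dots> \<le> ennreal ((2 * m * sqrt n) powr p)"
    using le p \<sigma> by (intro ennreal_leI powr_mono2) auto
  finally have 1: "moment_le M p (\<lambda>x. \<Sum>i=1..n. X i x) (2 * m * sqrt n)" .
  have "(\<integral>\<^sup>+x. ennreal (\<bar>(\<Sum>i=1..n. X i x) / sqrt (real n)\<bar> powr p) \<partial>M)
     = (\<integral>\<^sup>+x. ennreal (1 / sqrt n powr p) * ennreal (\<bar>\<Sum>i=1..n. X i x\<bar> powr p) \<partial>M)"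
    by (intro nn_integral_cong) (auto simp: powr_divide abs_divide simp flip: ennreal_mult)
  also have "\<dots> = ennreal (1 / sqrt n powr p) * (\<integral>\<^sup>+x. ennreal (\<bar>\<Sum>i=1..n. X i x\<bar> powr p) \<partial>M)"
    by (intro nn_integral_cmult measurable_compose[OF Xm, of "\<lambda>s. ennreal (\<bar>s\<bar> powr p)"]) measurable
  also have "\<dots> \<le> ennreal (1 / sqrt n powr p) * ennreal ((2 * m * sqrt n) powr p)"
    by (intro mult_left_mono 1) auto
  also have "\<dots> = ennreal ((2 * m) powr p)"
    using n m by (simp add: powr_mult flip: ennreal_mult)
  finally show ?thesis .
qed

section \<open>Moments of the field and of its increments\<close>

locale martingale_field = prob_space M for M :: "'a measure" +
  fixes F :: "nat \<Rightarrow> 'a measure" and V :: "'v set" and \<xi> :: "nat \<Rightarrow> 'v \<Rightarrow> 'a \<Rightarrow> real"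
  assumes F: "prob_filtration M F"
    and \<xi>: "\<And>v. v \<in> V \<Longrightarrow> centered_martingale_differences M F (\<lambda>i. \<xi> i v)"
    and V_nonempty: "V \<noteq> {}"
    and tau_sup: "2 < tau_sup M V \<xi>"
begin

abbreviation "\<tau> \<equiv> tau M V \<xi>"
abbreviation "d \<equiv> rho M V \<xi>"
abbreviation "S \<equiv> normed_sum \<xi>"

definition \<tau>r :: "real \<Rightarrow> real" where "\<tau>r p = enn2real (\<tau> p)"

lemma \<tau>r_nonneg: "0 \<le> \<tau>r p"
  by (simp add: \<tau>r_def)

lemma \<tau>_eq: "\<tau> p < \<top> \<Longrightarrow> \<tau> p = ennreal (\<tau>r p)"
  by (simp add: \<tau>r_def)

lemma measurable_\<xi>: "1 \<le> i \<Longrightarrow> v \<in> V \<Longrightarrow> \<xi> i v \<in> borel_measurable M"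
  using \<xi>[of v] by (auto simp: centered_martingale_differences_def)

lemma measurable_normed_sum: "v \<in> V \<Longrightarrow> S n v \<in> borel_measurable M"
  unfolding normed_sum_def[abs_def] by (intro borel_measurable_divide borel_measurable_sum measurable_\<xi>) auto

lemma tau_mono: "1 \<le> p \<Longrightarrow> p \<le> q \<Longrightarrow> \<tau> p \<le> \<tau> q"
  unfolding tau_def by (intro SUP_subset_mono subset_refl mean_norm_mono) (simp_all add: measurable_\<xi>)

text \<open>Below the supremum there is some larger q with finite value, and monotonicity brings
  finiteness down to p.\<close>

lemma tau_finite:
  assumes "2 < p" "ereal p < tau_sup M V \<xi>" shows "\<tau> p < \<top>"
proof -
  obtain q where q: "p < q" "\<tau> q < \<top>"
    using assms(2) unfolding tau_sup_def less_Sup_iff by auto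
  with tau_mono[of p q] assms show ?thesis by (auto intro: le_less_trans)
qed

lemma le_tau_sup: "2 \<le> p \<Longrightarrow> \<tau> p < \<top> \<Longrightarrow> ereal p \<le> tau_sup M V \<xi>"
  unfolding tau_sup_def by (intro Sup_upper) auto

text \<open>\<open>Lp_norm_eq_0_iff\<close> characterises vanishing without reference to p. This is
  for the comparison of two values of \<open>tau\<close> whose quotient would have denominator
  0.\<close>

lemma tau_zero:
  assumes "\<tau> p = 0" "1 < p" "1 < q" shows "\<tau> q = 0"
proof -
  have "mean_norm M q n (\<lambda>i. \<xi> i v) = 0" if n: "1 \<le> n" and v: "v \<in> V" for n v
  proof -
    have "mean_norm M p n (\<lambda>i. \<xi> i v) \<le> \<tau> p"
      unfolding tau_def using n v by (intro SUP_upper2[where i = n] SUP_upper2[where i = v]) auto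
    then have "\<forall>i\<in>{1..n}. Lp_norm M p (\<xi> i v) = 0"
      by (simp only: mean_norm_eq_0_iff[OF assms(2) n] assms(1) le_zero_eq)
    then have "\<forall>i\<in>{1..n}. Lp_norm M q (\<xi> i v) = 0"
      using assms v by (auto simp: Lp_norm_eq_0_iff measurable_\<xi>)
    then show ?thesis by (simp only: mean_norm_eq_0_iff[OF assms(3) n])
  qed
  then have "\<tau> q \<le> 0" unfolding tau_def by (intro SUP_least) auto
  then show ?thesis by simp
qed

lemma normed_sum_moment_bound:
  assumes q: "2 < q" "ereal q < tau_sup M V \<xi>" and n: "1 \<le> n" and v: "v \<in> V"
  shows "moment_le M q (S n v) (2 * \<tau>r q)"
  unfolding normed_sum_def
proof (rule normed_sum_moment[OF F \<xi>[OF v]])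
  have "mean_norm M q n (\<lambda>i. \<xi> i v) \<le> \<tau> q"
    unfolding tau_def using n v by (intro SUP_upper2[where i = n] SUP_upper2[where i = v]) auto
  then show "mean_norm M q n (\<lambda>i. \<xi> i v) \<le> ennreal (\<tau>r q)"
    using \<tau>_eq[OF tau_finite[OF q]] by simp
qed (use q n \<tau>r_nonneg in auto)

lemma normed_sum_diff_moment_bound:
  assumes q: "2 < q" "ereal q < tau_sup M V \<xi>" and n: "1 \<le> n" and v: "v \<in> V" and w: "w \<in> V"
    and r: "0 \<le> r" "d v w \<le> ennreal r"
  shows "moment_le M q (\<lambda>x. S n v x - S n w x) (2 * \<tau>r q * r)"
proof -
  let ?\<eta> = "\<lambda>i \<omega>. \<xi> i v \<omega> - \<xi> i w \<omega>"
  have t: "\<tau> q = ennreal (\<tau>r q)" using \<tau>_eq[OF tau_finite[OF q]] .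
  have "mean_norm M q n ?\<eta> / \<tau> q \<le> d v w"
    unfolding rho_def using q n by (intro SUP_upper2[where i = n] SUP_upper2[where i = q]) auto
  with r have *: "mean_norm M q n ?\<eta> / ennreal (\<tau>r q) \<le> ennreal r" by (simp add: t)
  have "mean_norm M q n ?\<eta> \<le> ennreal (\<tau>r q * r)"
  \<comment> \<open>Division by 0 sends every nonzero value to infinity, so a finite
    \<open>rho\<close> forces the norm of the increment to vanish along with \<tau> at q.\<close>
  proof (cases "\<tau>r q = 0")
    case True
    with * have "mean_norm M q n ?\<eta> = 0"
      by (cases "mean_norm M q n ?\<eta> = 0") (auto simp: divide_ennreal_def ennreal_mult_top top_unique)
    with True show ?thesis by simp
  next
    case False
    then have pos: "0 < \<tau>r q" using \<tau>r_nonneg[of q] by simp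
    show ?thesis
    proof (cases "mean_norm M q n ?\<eta>")
      case (real m)
      with * pos r have "m / \<tau>r q \<le> r" by (simp add: divide_ennreal ennreal_le_iff)
      with real pos show ?thesis by (simp add: pos_divide_le_eq mult.commute ennreal_leI)
    next
      case top
      with * pos show ?thesis by (simp add: ennreal_top_divide top_unique)
    qed
  qed
  then have "moment_le M q (\<lambda>x. (\<Sum>i=1..n. ?\<eta> i x) / sqrt (real n)) (2 * (\<tau>r q * r))"
    using q n r \<tau>r_nonneg[of q]
    by (intro normed_sum_moment[OF F] centered_martingale_differences_diff[OF prob_space_axioms F] \<xi> v w) auto
  then show ?thesis
    by (simp add: normed_sum_def sum_subtractf diff_divide_distrib mult.assoc)
qed

text \<open>\<open>d\<close> only controls exponents strictly between \<open>2\<close> and \<open>tau_sup\<close>, whereas \<open>tau_star\<close>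
  also uses the two end points; there \<open>\<tau>\<close> may jump.\<close>

lemma exponent_exists:
  obtains c where "0 < c"
    "\<And>N p. 1 \<le> N \<Longrightarrow> 2 \<le> p \<Longrightarrow> \<tau> p < \<top> \<Longrightarrow>
       \<exists>q>2. ereal q < tau_sup M V \<xi> \<and> N powr (1 / q) * \<tau>r q \<le> c * (N powr (1 / p) * \<tau>r p)"
proof -
  obtain p1 where p1: "2 < p1" "ereal p1 < tau_sup M V \<xi>"
    using ereal_dense2[OF tau_sup] by auto
  \<comment> \<open>The 2 pays for approximating p > 2 from the left, the quotient for moving from
    the end point 2 to p1. If \<open>\<tau>r 2\<close> is 0 the quotient is 0 by convention, and
    \<open>tau_zero\<close> makes \<open>\<tau>r p1\<close> vanish too.\<close>
  define c where "c = max 2 (\<tau>r p1 / \<tau>r 2)"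
  show ?thesis
  proof (rule that[of c])
    show "0 < c" by (simp add: c_def)
    fix N p :: real assume N: "1 \<le> N" and p: "2 \<le> p" "\<tau> p < \<top>"
    show "\<exists>q>2. ereal q < tau_sup M V \<xi> \<and> N powr (1 / q) * \<tau>r q \<le> c * (N powr (1 / p) * \<tau>r p)"
    proof (cases "p = 2")
      case True
      have "\<tau>r p1 \<le> c * \<tau>r 2"
      proof (cases "\<tau>r 2 = 0")
        case True
        then have "\<tau> 2 = 0" using \<tau>_eq[OF p(2)] \<open>p = 2\<close> by simp
        from tau_zero[OF this, of p1] have "\<tau> p1 = 0" using p1 by simp
        then have "\<tau>r p1 = 0" by (simp add: \<tau>r_def)
        then show ?thesis by (simp add: True)
      next
        case False
        then have "0 < \<tau>r 2" using \<tau>r_nonneg[of 2] by simp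
        moreover have "\<tau>r p1 / \<tau>r 2 \<le> c" by (simp add: c_def)
        ultimately show ?thesis by (simp add: pos_divide_le_eq)
      qed
      moreover have "N powr (1 / p1) \<le> N powr (1 / 2)"
        using N p1 by (intro powr_mono) (auto simp: field_simps)
      ultimately have "N powr (1 / p1) * \<tau>r p1 \<le> N powr (1 / 2) * (c * \<tau>r 2)"
        using \<tau>r_nonneg[of p1] by (intro mult_mono) auto
      with p1 True show ?thesis by (auto intro!: exI[of _ p1] simp: mult_ac)
    next
      case False
      with p have p2: "2 < p" by simp
      \<comment> \<open>p may equal \<open>tau_sup\<close>, an exponent absent from
        \<open>rho\<close>, so it is approached from below. The q found depends on N, but c does
        not, and \<tau> can only decrease on the way.\<close>
      have "((\<lambda>q. N powr (1 / q)) \<longlongrightarrow> N powr (1 / p)) (at_left p)"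
        using N p2 by (intro tendsto_intros) auto
      then have "\<forall>\<^sub>F q in at_left p. N powr (1 / q) < 2 * N powr (1 / p)"
        by (rule order_tendstoD) (use N in auto)
      moreover have "\<forall>\<^sub>F q in at_left p. q \<in> {2<..<p}"
        using p2 by (intro eventually_at_leftI[of 2]) auto
      ultimately have "\<forall>\<^sub>F q in at_left p. N powr (1 / q) < 2 * N powr (1 / p) \<and> q \<in> {2<..<p}"
        by (rule eventually_conj)
      then obtain q where q: "N powr (1 / q) < 2 * N powr (1 / p)" "2 < q" "q < p"
        using eventually_happens'[OF trivial_limit_at_left_real] by (metis (no_types, lifting) greaterThanLessThan_iff)
      have qs: "ereal q < tau_sup M V \<xi>"
        using le_tau_sup[OF p] q by (meson ereal_less_eq(3) less_ereal.simps(1) less_le_trans)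
      have "\<tau>r q \<le> \<tau>r p"
        unfolding \<tau>r_def using p q tau_mono[of q p] by (intro enn2real_mono) auto
      then have "N powr (1 / q) * \<tau>r q \<le> (2 * N powr (1 / p)) * \<tau>r p"
        using q \<tau>r_nonneg by (intro mult_mono) auto
      also have "\<dots> \<le> (c * N powr (1 / p)) * \<tau>r p"
        using \<tau>r_nonneg by (intro mult_right_mono) (auto simp: c_def)
      finally show ?thesis using q qs by (auto simp: mult.assoc)
    qed
  qed
qed

end

section \<open>From the entropy integral to a dyadic series\<close>

lemma ennreal_ln_mono: "x \<le> y \<Longrightarrow> ennreal_ln x \<le> ennreal_ln y"
  by (cases x; cases y) (auto simp: ennreal_ln_def top_unique ennreal_le_iff ennreal_eq_0_iff)

lemma ereal_exp_mono: "x \<le> y \<Longrightarrow> ereal_exp x \<le> ereal_exp y"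
  by (cases x; cases y) (auto simp: ereal_exp_def ennreal_leI)

lemma tau_star_mono: "x \<le> y \<Longrightarrow> tau_star t x \<le> tau_star t y"
  unfolding tau_star_def by (intro INF_mono) (auto intro!: add_right_mono ereal_mult_right_mono)

lemma covering_number_antimono:
  assumes "\<epsilon> \<le> \<epsilon>'" shows "covering_number V d \<epsilon>' \<le> covering_number V d \<epsilon>"
proof -
  have "(\<Union>c\<in>C. {v\<in>V. d c v \<le> ennreal \<epsilon>}) \<subseteq> (\<Union>c\<in>C. {v\<in>V. d c v \<le> ennreal \<epsilon>'})" for C
    using order_trans[OF _ ennreal_leI[OF assms]] by (intro UN_mono order_refl) blast
  then show ?thesis
    unfolding covering_number_def
    by (intro INF_superset_mono order_refl Collect_mono) (meson subset_trans)
qed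

text \<open>Cardinalities are natural numbers, so the infimum is a minimum as soon as some finite
  net exists.\<close>

lemma covering_number_attained:
  assumes "covering_number V d \<epsilon> < \<top>"
  obtains C where "finite C" "C \<subseteq> V" "\<And>v. v \<in> V \<Longrightarrow> \<exists>c\<in>C. d c v \<le> ennreal \<epsilon>"
    "covering_number V d \<epsilon> = of_nat (card C)"
proof -
  define \<C> where "\<C> = {C. finite C \<and> C \<subseteq> V \<and> V \<subseteq> (\<Union>c\<in>C. {v\<in>V. d c v \<le> ennreal \<epsilon>})}"
  have cn: "covering_number V d \<epsilon> = (INF C\<in>\<C>. of_nat (card C))"
    by (simp add: covering_number_def \<C>_def)
  have "\<C> \<noteq> {}" using assms by (auto simp: cn)
  then obtain C where C: "C \<in> \<C>" "\<And>C'. C' \<in> \<C> \<Longrightarrow> card C \<le> card C'"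
    using ex_has_least_nat[of "\<lambda>C. C \<in> \<C>" _ card] by blast
  have "covering_number V d \<epsilon> = of_nat (card C)"
    unfolding cn using C by (intro INF_eqI) auto
  with C(1) show ?thesis by (intro that[of C]) (auto simp: \<C>_def)
qed

text \<open>Integral test: on each dyadic interval f is at least its value at the right end.
  Monotonicity of \<open>nn_integral\<close> compares f with these step functions without a
  measurability argument for f.\<close>

lemma dyadic_sum_of_antimono:
  fixes f :: "real \<Rightarrow> ennreal"
  assumes mono: "\<And>x y. 0 < x \<Longrightarrow> x \<le> y \<Longrightarrow> f y \<le> f x"
    and int: "(\<integral>\<^sup>+x\<in>{0<..<1}. f x \<partial>lborel) < \<infinity>"
  shows "f ((1/2) ^ k) < \<top>" "summable (\<lambda>k. (1/2) ^ k * enn2real (f ((1/2) ^ k)))"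
proof -
  define J where "J = (\<integral>\<^sup>+x\<in>{0<..<1}. f x \<partial>lborel)"
  have J: "J < \<top>" using int by (simp add: J_def)
  \<comment> \<open>Starting at 1/2 keeps all intervals inside (0, 1); the dyadic point 1 is
    recovered by monotonicity and an index shift.\<close>
  define I :: "nat \<Rightarrow> real set" where "I k = {(1/2) ^ (k + 2)<..(1/2) ^ (k + 1)}" for k
  have disj: "j = k" if "x \<in> I j" "x \<in> I k" for x j k
  proof -
    have "\<not> j < k" if "x \<in> I j" "x \<in> I k" for j k
    proof
      assume "j < k"
      then have "(1/2::real) ^ (k + 1) \<le> (1/2) ^ (j + 2)" by (intro power_decreasing) auto
      with that show False by (auto simp: I_def)
    qed
    from this[of j k] this[of k j] that show ?thesis by auto
  qed
  have I01: "x \<in> {0<..<1}" if "x \<in> I k" for x k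
  proof -
    have "(1/2::real) ^ (k + 1) \<le> 1/2" using power_decreasing[of 1 "k + 1" "1/2::real"] by simp
    moreover have "0 < (1/2::real) ^ (k + 2)" by simp
    moreover have "(1/2) ^ (k + 2) < x" "x \<le> (1/2) ^ (k + 1)" using that by (auto simp: I_def)
    ultimately show ?thesis unfolding greaterThanLessThan_iff by linarith
  qed
  have sumJ: "(\<Sum>k<K. ennreal ((1/2) ^ (k + 2)) * f ((1/2) ^ (k + 1))) \<le> J" for K
  proof -
    have "(\<Sum>k<K. f ((1/2) ^ (k + 1)) * indicator (I k) x) \<le> f x * indicator {0<..<1} x" for x
    proof (cases "\<exists>k<K. x \<in> I k")
      case True
      then obtain k where k: "k < K" "x \<in> I k" by auto
      have "(\<Sum>k<K. f ((1/2) ^ (k + 1)) * indicator (I k) x) = (\<Sum>k\<in>{k}. f ((1/2) ^ (k + 1)) * indicator (I k) x)"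
        using k disj by (intro sum.mono_neutral_right) (auto simp: indicator_def)
      also have "\<dots> = f ((1/2) ^ (k + 1))" using k by simp
      also have "\<dots> \<le> f x" using k I01[OF k(2)] by (intro mono) (auto simp: I_def)
      finally show ?thesis using I01[OF k(2)] by simp
    next
      case False
      then have "(\<Sum>k<K. f ((1/2) ^ (k + 1)) * indicator (I k) x) = 0" by (intro sum.neutral) auto
      then show ?thesis by simp
    qed
    then have "(\<integral>\<^sup>+x. (\<Sum>k<K. f ((1/2) ^ (k + 1)) * indicator (I k) x) \<partial>lborel) \<le> J"
      unfolding J_def by (intro nn_integral_mono)
    also have "(\<integral>\<^sup>+x. (\<Sum>k<K. f ((1/2) ^ (k + 1)) * indicator (I k) x) \<partial>lborel)
        = (\<Sum>k<K. f ((1/2) ^ (k + 1)) * emeasure lborel (I k))"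
    proof -
      have Im: "I k \<in> sets lborel" for k by (simp add: I_def)
      show ?thesis
        by (subst nn_integral_sum)
          (intro borel_measurable_times_ennreal borel_measurable_const borel_measurable_indicator Im
            sum.cong refl nn_integral_cmult_indicator)+
    qed
    also have "\<dots> = (\<Sum>k<K. ennreal ((1/2) ^ (k + 2)) * f ((1/2) ^ (k + 1)))"
      by (intro sum.cong refl) (simp add: I_def mult.commute)
    finally show ?thesis .
  qed
  have fin: "f ((1/2) ^ (k + 1)) < \<top>" for k
  proof (rule ccontr)
    assume "\<not> ?thesis"
    then have "f ((1/2) ^ (k + 1)) = \<top>" by (metis less_top)
    then have "ennreal ((1/2) ^ (k + 2)) * f ((1/2) ^ (k + 1)) = \<top>"
      by (simp only: ennreal_mult_top) (simp add: ennreal_mult_top)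
    moreover have "ennreal ((1/2) ^ (k + 2)) * f ((1/2) ^ (k + 1))
        \<le> (\<Sum>k<Suc k. ennreal ((1/2) ^ (k + 2)) * f ((1/2) ^ (k + 1)))"
      by (intro member_le_sum) auto
    ultimately show False using sumJ[of "Suc k"] J by (auto simp: top_unique)
  qed
  show "f ((1/2) ^ k) < \<top>"
  proof (cases k)
    case 0
    have "f 1 \<le> f ((1/2) ^ (0 + 1))" by (intro mono) auto
    with fin[of 0] 0 show ?thesis by (auto intro: le_less_trans)
  qed (use fin in simp)
  have "summable (\<lambda>k. (1/2) ^ (k + 2) * enn2real (f ((1/2) ^ (k + 1))))"
  proof (rule summableI_nonneg_bounded)
    fix K
    have "ennreal (\<Sum>k<K. (1/2) ^ (k + 2) * enn2real (f ((1/2) ^ (k + 1))))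
        = (\<Sum>k<K. ennreal ((1/2) ^ (k + 2) * enn2real (f ((1/2) ^ (k + 1)))))"
      by (subst sum_ennreal) auto
    also have "\<dots> = (\<Sum>k<K. ennreal ((1/2) ^ (k + 2)) * f ((1/2) ^ (k + 1)))"
      using fin by (intro sum.cong refl) (subst ennreal_mult, auto)
    also have "\<dots> \<le> ennreal (enn2real J)" using sumJ J by simp
    finally show "(\<Sum>k<K. (1/2) ^ (k + 2) * enn2real (f ((1/2) ^ (k + 1)))) \<le> enn2real J"
      by (subst (asm) ennreal_le_iff) auto
  qed auto
  then have "summable (\<lambda>k. 2 * ((1/2) ^ (k + 2) * enn2real (f ((1/2) ^ (k + 1)))))"
    by (rule summable_mult)
  then have "summable (\<lambda>k. (1/2) ^ Suc k * enn2real (f ((1/2) ^ Suc k)))"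
    by simp
  then show "summable (\<lambda>k. (1/2) ^ k * enn2real (f ((1/2) ^ k)))"
    by (subst (asm) summable_Suc_iff)
qed

context martingale_field
begin

abbreviation "entropy_term \<epsilon> \<equiv> ereal_exp (tau_star \<tau> (ereal (ln 2) + metric_entropy V d \<epsilon>))"

lemma entropy_term_antimono: "\<epsilon> \<le> \<epsilon>' \<Longrightarrow> entropy_term \<epsilon>' \<le> entropy_term \<epsilon>"
  unfolding metric_entropy_def
  by (intro ereal_exp_mono tau_star_mono add_left_mono ennreal_ln_mono covering_number_antimono)

text \<open>For a minimal net of N points \<open>entropy_term\<close> is the infimum over p = 1/y of
  (2 N)^(1/p) \<tau>(p). The infimum need not be attained; adding 1 makes room for a near-minimiser
  even if the infimum is 0.\<close>

lemma net_exponent_exists: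
  assumes G: "entropy_term \<epsilon> < \<top>"
  obtains C p where "finite C" "C \<subseteq> V" "\<And>v. v \<in> V \<Longrightarrow> \<exists>c\<in>C. d c v \<le> ennreal \<epsilon>" "1 \<le> card C"
    "2 \<le> p" "\<tau> p < \<top>" "(2 * real (card C)) powr (1 / p) * \<tau>r p \<le> enn2real (entropy_term \<epsilon>) + 1"
proof -
  have "covering_number V d \<epsilon> < \<top>"
  proof (rule ccontr)
    assume "\<not> ?thesis"
    then have "covering_number V d \<epsilon> = \<top>" by (metis less_top)
    then have "metric_entropy V d \<epsilon> = \<infinity>" by (simp add: metric_entropy_def ennreal_ln_def)
    \<comment> \<open>In \<open>ereal\<close>, infinity plus minus infinity is infinity, so every y
      contributes infinity even where \<tau> vanishes; over no y at all the infimum is infinity as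
      well.\<close>
    then have "tau_star \<tau> (ereal (ln 2) + metric_entropy V d \<epsilon>) = \<infinity>"
      unfolding tau_star_def by (simp add: ereal_infty_mult top_ereal_def) (auto intro!: INF_eqI)
    with G show False by (simp add: ereal_exp_def)
  qed
  then obtain C where C: "finite C" "C \<subseteq> V" "\<And>v. v \<in> V \<Longrightarrow> \<exists>c\<in>C. d c v \<le> ennreal \<epsilon>"
    "covering_number V d \<epsilon> = of_nat (card C)"
    using covering_number_attained by blast
  have "C \<noteq> {}" using C(3) V_nonempty by blast
  then have N: "1 \<le> card C" using C(1) by (simp add: Suc_leI card_gt_0_iff)
  define x where "x = ln (2 * real (card C))"
  have x: "ereal (ln 2) + metric_entropy V d \<epsilon> = ereal x"
    using N by (simp add: metric_entropy_def C(4) ennreal_ln_def x_def ln_mult ennreal_of_nat_eq_real_of_nat)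
  define g where "g = enn2real (entropy_term \<epsilon>)"
  have g: "entropy_term \<epsilon> = ennreal g" "0 \<le> g" using G by (simp_all add: g_def)
  have "tau_star \<tau> (ereal x) < ereal (ln (g + 1))"
  proof (cases "tau_star \<tau> (ereal x)")
    case (real r)
    with g x have "exp r = g" by (simp add: ereal_exp_def)
    then have "r < ln (g + 1)" using g(2) by (metis exp_gt_zero less_add_one ln_exp ln_less_cancel_iff add_pos_pos zero_less_one)
    with real show ?thesis by simp
  next
    case PInf
    with G x show ?thesis by (simp add: ereal_exp_def)
  qed simp
  then obtain y where y: "0 < y" "y < 1" "2 \<le> 1 / y" "\<tau> (1 / y) < \<top>"
    "ereal x * ereal y + ennreal_ln (\<tau> (1 / y)) < ereal (ln (g + 1))"
    unfolding tau_star_def INF_less_iff by auto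
  have "(2 * real (card C)) powr y * \<tau>r (1 / y) \<le> g + 1"
  proof (cases "\<tau>r (1 / y) = 0")
    case False
    then have t: "0 < \<tau>r (1 / y)" using \<tau>r_nonneg[of "1 / y"] by simp
    with y(5) \<tau>_eq[OF y(4)] have "x * y + ln (\<tau>r (1 / y)) < ln (g + 1)"
      by (simp add: ennreal_ln_def)
    then have "exp (x * y + ln (\<tau>r (1 / y))) < g + 1"
      using g(2) by (metis add_nonneg_pos exp_less_mono exp_ln zero_less_one)
    then show ?thesis using t N by (simp add: exp_add powr_def x_def mult.commute)
  qed (use g in simp)
  then show ?thesis using C N y by (intro that[of C "1 / y"]) (auto simp: g_def)
qed

lemma uniform_modulus:
  assumes int: "(\<integral>\<^sup>+\<epsilon>\<in>{0<..<1}. entropy_term \<epsilon> \<partial>lborel) < \<infinity>"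
    and E: "countable E" "E \<subseteq> V" "E \<noteq> {}"
  obtains D C where "countable D" "E \<subseteq> D" "D \<subseteq> V"
    "\<And>k. finite (C k)" "\<And>k. C k \<subseteq> D" "\<And>k v. v \<in> V \<Longrightarrow> \<exists>c\<in>C k. d c v \<le> ennreal ((1/2) ^ k)"
    "\<And>e. 0 < e \<Longrightarrow> \<exists>\<delta>>0. \<forall>n\<in>{1..}. (\<integral>\<^sup>+x. modulus d D \<delta> (\<lambda>v. S n v x) \<partial>M) \<le> ennreal e"
proof -
  note thesisI = that
  note G = dyadic_sum_of_antimono[OF entropy_term_antimono int]
  define g where "g k = enn2real (entropy_term ((1/2) ^ k))" for k :: nat
  have "\<exists>C p. finite C \<and> C \<subseteq> V \<and> (\<forall>v\<in>V. \<exists>c\<in>C. d c v \<le> ennreal ((1/2) ^ k)) \<and> 1 \<le> card C \<and>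
      2 \<le> p \<and> \<tau> p < \<top> \<and> (2 * real (card C)) powr (1 / p) * \<tau>r p \<le> g k + 1" for k
  proof (rule net_exponent_exists[OF G(1)[of k]])
    fix C p assume "finite C" "C \<subseteq> V" "\<And>v. v \<in> V \<Longrightarrow> \<exists>c\<in>C. d c v \<le> ennreal ((1/2) ^ k)" "1 \<le> card C"
      "2 \<le> p" "\<tau> p < \<top>" "(2 * real (card C)) powr (1 / p) * \<tau>r p \<le> enn2real (entropy_term ((1/2) ^ k)) + 1"
    then show ?thesis unfolding g_def by (intro exI[of _ C] exI[of _ p] conjI ballI)
  qed
  then obtain C p where C: "\<And>k. finite (C k)" "\<And>k. C k \<subseteq> V"
      "\<And>k v. v \<in> V \<Longrightarrow> \<exists>c\<in>C k. d c v \<le> ennreal ((1/2) ^ k)" "\<And>k. 1 \<le> card (C k)"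
    and p: "\<And>k. 2 \<le> p k" "\<And>k. \<tau> (p k) < \<top>"
      "\<And>k. (2 * real (card (C k))) powr (1 / p k) * \<tau>r (p k) \<le> g k + 1"
    by metis
  obtain c where c: "0 < c" "\<And>N p. 1 \<le> N \<Longrightarrow> 2 \<le> p \<Longrightarrow> \<tau> p < \<top> \<Longrightarrow>
       \<exists>q>2. ereal q < tau_sup M V \<xi> \<and> N powr (1 / q) * \<tau>r q \<le> c * (N powr (1 / p) * \<tau>r p)"
    using exponent_exists by blast
  have "\<exists>q>2. ereal q < tau_sup M V \<xi> \<and> (2 * real (card (C k))) powr (1 / q) * \<tau>r q \<le> c * (g k + 1)" for k
  proof -
    have "1 \<le> 2 * real (card (C k))" using C(4)[of k] by simp
    from c(2)[OF this p(1)[of k] p(2)[of k]] obtain q where q: "2 < q" "ereal q < tau_sup M V \<xi>"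
      "(2 * real (card (C k))) powr (1 / q) * \<tau>r q \<le> c * ((2 * real (card (C k))) powr (1 / p k) * \<tau>r (p k))"
      by auto
    note q(3)
    also have "c * ((2 * real (card (C k))) powr (1 / p k) * \<tau>r (p k)) \<le> c * (g k + 1)"
      using c(1) p(3)[of k] by (intro mult_left_mono) auto
    finally show ?thesis using q(1,2) by auto
  qed
  then obtain q where q: "\<And>k. 2 < q k" "\<And>k. ereal (q k) < tau_sup M V \<xi>"
      "\<And>k. (2 * real (card (C k))) powr (1 / q k) * \<tau>r (q k) \<le> c * (g k + 1)"
    by metis
  have "summable (\<lambda>k. (1/2) ^ k * ((real (card (C k)) + 1) powr (1 / q k) * (2 * \<tau>r (q k))))"
  proof (rule summable_comparison_test')
    have "summable (\<lambda>k. 2 * c * ((1/2) ^ k * g k) + 2 * c * (1/2) ^ k)"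
      using G(2) unfolding g_def by (intro summable_add summable_mult summable_geometric) auto
    then show "summable (\<lambda>k. (1/2) ^ k * (2 * (c * (g k + 1))))"
      by (simp add: algebra_simps)
    fix k
    \<comment> \<open>The extra point of each level is absorbed by the log 2 of the entropy
      integral: N + 1 \<le> 2 N.\<close>
    have "(real (card (C k)) + 1) powr (1 / q k) * \<tau>r (q k) \<le> (2 * real (card (C k))) powr (1 / q k) * \<tau>r (q k)"
      using C(4)[of k] q(1)[of k] \<tau>r_nonneg by (intro mult_right_mono powr_mono2) auto
    also have "\<dots> \<le> c * (g k + 1)" by (rule q(3))
    finally show "norm ((1/2) ^ k * ((real (card (C k)) + 1) powr (1 / q k) * (2 * \<tau>r (q k))))
        \<le> (1/2) ^ k * (2 * (c * (g k + 1)))"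
      using \<tau>r_nonneg[of "q k"] by (simp add: abs_mult mult_left_mono)
  qed
  note sum = this
  show ?thesis
  proof (rule chaining_modulus[of C V d E "{1..}" "S" q "\<lambda>k. 2 * \<tau>r (q k)", OF C(1-3) E])
    show "1 < q k" for k using q(1)[of k] by simp
    show "moment_le M (q k) (\<lambda>x. S n v x - S n w x) (2 * \<tau>r (q k) * r)"
      if "n \<in> {1..}" "v \<in> V" "w \<in> V" "0 \<le> r" "d v w \<le> ennreal r" for k n v w r
      using that q by (intro normed_sum_diff_moment_bound) auto
    show thesis if "countable D" "E \<subseteq> D" "D \<subseteq> V" "\<And>k. C k \<subseteq> D"
      "\<And>e. 0 < e \<Longrightarrow> \<exists>\<delta>>0. \<forall>n\<in>{1..}. (\<integral>\<^sup>+x. modulus d D \<delta> (\<lambda>v. S n v x) \<partial>M) \<le> ennreal e" for D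
      using that C by (intro thesisI[of D C])
  qed (use sum measurable_normed_sum \<tau>r_nonneg in auto)
qed

end

section \<open>The semi-distance axioms for \<open>rho\<close>\<close>

lemma Lp_norm_triangle:
  assumes [measurable]: "f \<in> borel_measurable M" "g \<in> borel_measurable M" and p: "1 \<le> p"
  shows "Lp_norm M p (\<lambda>x. f x + g x) \<le> Lp_norm M p f + Lp_norm M p g"
proof (cases "Lp_norm M p f = \<top> \<or> Lp_norm M p g = \<top>")
  case False
  define a b where "a = enn2real (Lp_norm M p f)" and "b = enn2real (Lp_norm M p g)"
  have a: "Lp_norm M p f = ennreal a" "0 \<le> a" and b: "Lp_norm M p g = ennreal b" "0 \<le> b"
    using False by (simp_all add: a_def b_def less_top)
  have "(\<integral>\<^sup>+x. ennreal (\<bar>f x + g x\<bar> powr p) \<partial>M) \<le> (\<integral>\<^sup>+x. ennreal ((\<bar>f x\<bar> + \<bar>g x\<bar>) powr p) \<partial>M)"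
    using p by (intro nn_integral_mono ennreal_leI powr_mono2) auto
  also have "\<dots> \<le> ennreal ((a + b) powr p)"
    using a b p Lp_norm_le_iff[of p a M f] Lp_norm_le_iff[of p b M g]
    by (intro nn_integral_Minkowski) auto
  finally have "Lp_norm M p (\<lambda>x. f x + g x) \<le> ennreal (a + b)"
    using a b p by (subst Lp_norm_le_iff) auto
  then show ?thesis using a b by simp
qed auto

text \<open>Two triangle inequalities are combined, in L^p for each i and then in Euclidean space
  over i; infinite norms are set aside first.\<close>

lemma mean_norm_triangle:
  assumes "\<And>i. 1 \<le> i \<Longrightarrow> \<eta> i \<in> borel_measurable M" "\<And>i. 1 \<le> i \<Longrightarrow> \<zeta> i \<in> borel_measurable M"
    and p: "1 < p" and n: "1 \<le> n"
  shows "mean_norm M p n (\<lambda>i x. \<eta> i x + \<zeta> i x) \<le> mean_norm M p n \<eta> + mean_norm M p n \<zeta>"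
proof (cases "\<exists>i\<in>{1..n}. Lp_norm M p (\<eta> i) = \<top> \<or> Lp_norm M p (\<zeta> i) = \<top>")
  case True
  then show ?thesis using mean_norm_eq_top[OF p] by force
next
  case False
  define a b c where "a i = enn2real (Lp_norm M p (\<eta> i))" and "b i = enn2real (Lp_norm M p (\<zeta> i))"
    and "c i = enn2real (Lp_norm M p (\<lambda>x. \<eta> i x + \<zeta> i x))" for i
  have a: "Lp_norm M p (\<eta> i) = ennreal (a i)" and b: "Lp_norm M p (\<zeta> i) = ennreal (b i)" if "i \<in> {1..n}" for i
    using False that by (auto simp: a_def b_def less_top)
  have le: "Lp_norm M p (\<lambda>x. \<eta> i x + \<zeta> i x) \<le> ennreal (a i + b i)" if "i \<in> {1..n}" for i
  proof -
    have "Lp_norm M p (\<lambda>x. \<eta> i x + \<zeta> i x) \<le> Lp_norm M p (\<eta> i) + Lp_norm M p (\<zeta> i)"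
      using assms that by (intro Lp_norm_triangle) auto
    also have "\<dots> = ennreal (a i + b i)"
      unfolding a[OF that] b[OF that] by (simp add: a_def b_def)
    finally show ?thesis .
  qed
  then have c: "Lp_norm M p (\<lambda>x. \<eta> i x + \<zeta> i x) = ennreal (c i)" if "i \<in> {1..n}" for i
    using that by (metis c_def ennreal_enn2real ennreal_less_top le_less_trans)
  have nn: "0 \<le> a i" "0 \<le> b i" "0 \<le> c i" for i by (simp_all add: a_def b_def c_def)
  have cab: "c i \<le> a i + b i" if "i \<in> {1..n}" for i
    using le[OF that] unfolding c[OF that] using nn by (simp add: ennreal_le_iff del: ennreal_plus)
  have "(p - 1) / sqrt n * L2_set c {1..n} \<le> (p - 1) / sqrt n * L2_set (\<lambda>i. a i + b i) {1..n}"
    using p nn cab by (intro mult_left_mono L2_set_mono) auto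
  also have "\<dots> \<le> (p - 1) / sqrt n * (L2_set a {1..n} + L2_set b {1..n})"
    using p by (intro mult_left_mono L2_set_triangle_ineq) auto
  finally have "ennreal ((p - 1) / sqrt n * L2_set c {1..n})
      \<le> ennreal ((p - 1) / sqrt n * L2_set a {1..n} + (p - 1) / sqrt n * L2_set b {1..n})"
    by (intro ennreal_leI) (simp add: distrib_left)
  also have "\<dots> = ennreal ((p - 1) / sqrt n * L2_set a {1..n}) + ennreal ((p - 1) / sqrt n * L2_set b {1..n})"
    using p by (intro ennreal_plus) auto
  moreover have "mean_norm M p n (\<lambda>i x. \<eta> i x + \<zeta> i x) = ennreal ((p - 1) / sqrt n * L2_set c {1..n})"
      "mean_norm M p n \<eta> = ennreal ((p - 1) / sqrt n * L2_set a {1..n})"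
      "mean_norm M p n \<zeta> = ennreal ((p - 1) / sqrt n * L2_set b {1..n})"
    using p n a b c nn by (intro mean_norm_eq_ennreal; simp)+
  ultimately show ?thesis by simp
qed

lemma rho_self: "rho M V \<xi> v v = 0"
proof -
  have "Lp_norm M p (\<lambda>\<omega>. 0) = 0" for p by (simp add: Lp_norm_def ennreal_powr_def)
  then have "mean_norm M p n (\<lambda>i \<omega>. 0) = 0" for p n
    by (simp add: mean_norm_def ennreal_powr_def)
  then have "rho M V \<xi> v v \<le> 0"
    unfolding rho_def by (intro SUP_least) simp
  then show ?thesis by simp
qed

lemma rho_commute: "rho M V \<xi> v w = rho M V \<xi> w v"
proof -
  have "Lp_norm M p (\<lambda>\<omega>. \<xi> i v \<omega> - \<xi> i w \<omega>) = Lp_norm M p (\<lambda>\<omega>. \<xi> i w \<omega> - \<xi> i v \<omega>)" for p i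
    by (simp add: Lp_norm_def abs_minus_commute)
  then show ?thesis by (simp add: rho_def mean_norm_def)
qed

context martingale_field
begin

lemma rho_triangle:
  assumes "u \<in> V" "v \<in> V" "w \<in> V"
  shows "d u w \<le> d u v + d v w"
  unfolding rho_def[of M V \<xi> u w]
proof (intro SUP_least)
  fix n p assume n: "n \<in> {1::nat..}" and p: "p \<in> {p. 2 < p \<and> ereal p < tau_sup M V \<xi>}"
  have "mean_norm M p n (\<lambda>i \<omega>. (\<xi> i u \<omega> - \<xi> i v \<omega>) + (\<xi> i v \<omega> - \<xi> i w \<omega>))
      \<le> mean_norm M p n (\<lambda>i \<omega>. \<xi> i u \<omega> - \<xi> i v \<omega>) + mean_norm M p n (\<lambda>i \<omega>. \<xi> i v \<omega> - \<xi> i w \<omega>)"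
    using n p assms by (intro mean_norm_triangle borel_measurable_diff measurable_\<xi>) auto
  then have "mean_norm M p n (\<lambda>i \<omega>. \<xi> i u \<omega> - \<xi> i w \<omega>) / \<tau> p
      \<le> (mean_norm M p n (\<lambda>i \<omega>. \<xi> i u \<omega> - \<xi> i v \<omega>) + mean_norm M p n (\<lambda>i \<omega>. \<xi> i v \<omega> - \<xi> i w \<omega>)) / \<tau> p"
    by (intro divide_right_mono_ennreal) simp
  also have "\<dots> = mean_norm M p n (\<lambda>i \<omega>. \<xi> i u \<omega> - \<xi> i v \<omega>) / \<tau> p + mean_norm M p n (\<lambda>i \<omega>. \<xi> i v \<omega> - \<xi> i w \<omega>) / \<tau> p"
    by (simp add: add_divide_distrib_ennreal)
  also have "\<dots> \<le> d u v + d v w"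
    unfolding rho_def using n p by (intro add_mono SUP_upper2[where i = n] SUP_upper2[where i = p]) auto
  finally show "mean_norm M p n (\<lambda>i \<omega>. \<xi> i u \<omega> - \<xi> i w \<omega>) / \<tau> p \<le> d u v + d v w" .
qed

end

section \<open>Uniformly smooth families of probability measures\<close>

text \<open>Membership constrains f on \<open>topspace X\<close> only. That a functional ignores the
  values elsewhere follows from its monotonicity, applied in both directions.\<close>

definition Cb :: "'b topology \<Rightarrow> ('b \<Rightarrow> real) set" where
  "Cb X = {f. continuous_map X euclideanreal f \<and> bounded (f ` topspace X)}"

lemma CbI:
  assumes "continuous_map X euclideanreal f" "\<And>x. x \<in> topspace X \<Longrightarrow> \<bar>f x\<bar> \<le> B"
  shows "f \<in> Cb X"
  using assms by (auto simp: Cb_def bounded_iff)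

lemma CbE:
  assumes "f \<in> Cb X"
  obtains B where "continuous_map X euclideanreal f" "0 < B" "\<And>x. x \<in> topspace X \<Longrightarrow> \<bar>f x\<bar> \<le> B"
  using assms unfolding Cb_def bounded_pos by auto

lemma Cb_const [simp]: "(\<lambda>x. c) \<in> Cb X"
  by (rule CbI[of _ _ "\<bar>c\<bar>"]) auto

lemma Cb_add:
  assumes "f \<in> Cb X" "g \<in> Cb X"
  shows "(\<lambda>x. f x + g x) \<in> Cb X"
proof -
  obtain A where "continuous_map X euclideanreal f" "\<And>x. x \<in> topspace X \<Longrightarrow> \<bar>f x\<bar> \<le> A"
    using assms(1) by (rule CbE) blast
  moreover obtain B where "continuous_map X euclideanreal g" "\<And>x. x \<in> topspace X \<Longrightarrow> \<bar>g x\<bar> \<le> B"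
    using assms(2) by (rule CbE) blast
  ultimately show ?thesis
    by (intro CbI[of _ _ "A + B"] continuous_map_add) (auto intro: order_trans[OF abs_triangle_ineq add_mono])
qed

lemma Cb_cmult:
  assumes "f \<in> Cb X" shows "(\<lambda>x. c * f x) \<in> Cb X"
proof -
  obtain A where "continuous_map X euclideanreal f" "\<And>x. x \<in> topspace X \<Longrightarrow> \<bar>f x\<bar> \<le> A"
    using assms by (rule CbE) blast
  then show ?thesis
    by (intro CbI[of _ _ "\<bar>c\<bar> * A"] continuous_map_real_mult)
      (auto simp: abs_mult intro: mult_left_mono)
qed

lemma Cb_diff:
  assumes "f \<in> Cb X" "g \<in> Cb X"
  shows "(\<lambda>x. f x - g x) \<in> Cb X"
  using Cb_add[OF assms(1) Cb_cmult[OF assms(2), of "-1"]] by simp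

lemma Cb_min:
  assumes "f \<in> Cb X" "g \<in> Cb X"
  shows "(\<lambda>x. min (f x) (g x)) \<in> Cb X"
proof -
  obtain A where f: "continuous_map X euclideanreal f" "\<And>x. x \<in> topspace X \<Longrightarrow> \<bar>f x\<bar> \<le> A"
    using assms(1) by (rule CbE) blast
  obtain B where g: "continuous_map X euclideanreal g" "\<And>x. x \<in> topspace X \<Longrightarrow> \<bar>g x\<bar> \<le> B"
    using assms(2) by (rule CbE) blast
  show ?thesis
  proof (rule CbI[of _ _ "max A B"])
    fix x assume x: "x \<in> topspace X"
    from f(2)[OF x] g(2)[OF x] show "\<bar>min (f x) (g x)\<bar> \<le> max A B" by linarith
  qed (intro continuous_map_real_min f g)
qed

lemma Cb_max:
  assumes "f \<in> Cb X" "g \<in> Cb X"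
  shows "(\<lambda>x. max (f x) (g x)) \<in> Cb X"
proof -
  have "(\<lambda>x. f x + g x - min (f x) (g x)) \<in> Cb X" by (intro Cb_diff Cb_add Cb_min assms)
  also have "(\<lambda>x. f x + g x - min (f x) (g x)) = (\<lambda>x. max (f x) (g x))" by (auto simp: min_def max_def)
  finally show ?thesis .
qed

lemma Cb_sum:
  "(\<And>i. i \<in> J \<Longrightarrow> f i \<in> Cb X) \<Longrightarrow> (\<lambda>x. \<Sum>i\<in>J. f i x) \<in> Cb X"
  by (induction J rule: infinite_finite_induct) (auto intro: Cb_add)

lemmas Cb_intros = Cb_add Cb_cmult
  Cb_diff Cb_min Cb_max Cb_sum Cb_const

lemma openin_greater: "f \<in> Cb X \<Longrightarrow> openin X {x \<in> topspace X. c < f x}"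
  using openin_continuous_map_preimage[of X euclideanreal f "{c<..}"]
  by (auto simp: Cb_def)

lemma openin_less: "f \<in> Cb X \<Longrightarrow> openin X {x \<in> topspace X. f x < c}"
  using openin_continuous_map_preimage[of X euclideanreal f "{..<c}"]
  by (auto simp: Cb_def)

lemma opens_subset_Pow: "{U. openin X U} \<subseteq> Pow (topspace X)"
  using openin_subset by auto

lemma space_borel_of [simp]: "space (borel_of X) = topspace X"
  unfolding borel_of_def by (rule space_measure_of[OF opens_subset_Pow])

lemma sets_borel_of: "sets (borel_of X) = sigma_sets (topspace X) {U. openin X U}"
  unfolding borel_of_def by (rule sets_measure_of[OF opens_subset_Pow])

lemma openin_sets_borel_of: "openin X U \<Longrightarrow> U \<in> sets (borel_of X)"
  by (simp add: sets_borel_of)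

lemma Cb_measurable:
  assumes "sets \<mu> = sets (borel_of X)" "f \<in> Cb X"
  shows "f \<in> borel_measurable \<mu>"
proof -
  have "f \<in> borel_measurable (borel_of X)"
  proof (rule borel_measurableI)
    fix S :: "real set" assume "open S"
    then have "openin X {x \<in> topspace X. f x \<in> S}"
      using assms(2) by (intro openin_continuous_map_preimage) (auto simp: Cb_def)
    moreover have "{x \<in> topspace X. f x \<in> S} = f -` S \<inter> space (borel_of X)" by auto
    ultimately show "f -` S \<inter> space (borel_of X) \<in> sets (borel_of X)"
      using openin_sets_borel_of by metis
  qed
  then show ?thesis using measurable_cong_sets[OF assms(1) refl] by blast
qed

lemma Cb_integrable:
  assumes "\<mu> \<in> borel_probabilities X" "f \<in> Cb X"
  shows "integrable \<mu> f"
proof -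
  interpret prob_space \<mu> using assms by (simp add: borel_probabilities_def)
  have sp: "space \<mu> = topspace X"
    using assms(1) sets_eq_imp_space_eq[of \<mu> "borel_of X"] by (simp add: borel_probabilities_def)
  obtain B where "\<And>x. x \<in> topspace X \<Longrightarrow> \<bar>f x\<bar> \<le> B" using assms(2) by (rule CbE) blast
  then show ?thesis
    using assms Cb_measurable[of \<mu> X f]
    by (intro integrable_const_bound[of _ B]) (auto simp: borel_probabilities_def sp)
qed

text \<open>Daniell's construction, with the outer measure obtained from open sets.\<close>

locale daniell =
  fixes X :: "'b topology" and L :: "('b \<Rightarrow> real) \<Rightarrow> real"
  assumes cozero: "\<And>U. openin X U \<Longrightarrow> \<exists>h\<in>Cb X. (\<forall>x\<in>topspace X. 0 \<le> h x) \<and> U = {x \<in> topspace X. 0 < h x}"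
    and L_add: "\<And>f g. f \<in> Cb X \<Longrightarrow> g \<in> Cb X \<Longrightarrow> L (\<lambda>x. f x + g x) = L f + L g"
    and L_cmult: "\<And>f c. f \<in> Cb X \<Longrightarrow> L (\<lambda>x. c * f x) = c * L f"
    and L_mono: "\<And>f g. f \<in> Cb X \<Longrightarrow> g \<in> Cb X \<Longrightarrow>
      (\<And>x. x \<in> topspace X \<Longrightarrow> f x \<le> g x) \<Longrightarrow> L f \<le> L g"
    and L_one: "L (\<lambda>x. 1) = 1"
    and L_smooth: "\<And>f. (\<And>k. f k \<in> Cb X) \<Longrightarrow>
      (\<And>k x. x \<in> topspace X \<Longrightarrow> f (Suc k) x \<le> f k x) \<Longrightarrow>
      (\<And>x. x \<in> topspace X \<Longrightarrow> (\<lambda>k. f k x) \<longlonglongrightarrow> 0) \<Longrightarrow> (\<lambda>k. L (f k)) \<longlonglongrightarrow> 0"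
begin

lemma L_const: "L (\<lambda>x. c) = c"
  using L_cmult[of "\<lambda>x. 1" c] L_one by simp

lemma L_sum: "(\<And>i. i \<in> J \<Longrightarrow> f i \<in> Cb X) \<Longrightarrow> L (\<lambda>x. \<Sum>i\<in>J. f i x) = (\<Sum>i\<in>J. L (f i))"
  by (induction J rule: infinite_finite_induct) (simp_all add: L_const L_add Cb_sum)

text \<open>No condition on closed supports is imposed: if h is positive exactly on U, the functions
  min 1 (k h) are of this kind and increase to the indicator of U.\<close>

definition below :: "'b set \<Rightarrow> ('b \<Rightarrow> real) set" where
  "below U = {f \<in> Cb X. \<forall>x\<in>topspace X. 0 \<le> f x \<and> f x \<le> 1 \<and> (x \<notin> U \<longrightarrow> f x = 0)}"

definition content :: "'b set \<Rightarrow> ennreal" where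
  "content U = (SUP f\<in>below U. ennreal (L f))"

definition outer :: "'b set \<Rightarrow> ennreal" where
  "outer A = (INF U\<in>{U. openin X U \<and> A \<subseteq> U}. content U)"

lemma L_nonneg: "f \<in> below U \<Longrightarrow> 0 \<le> L f"
  using L_mono[of "\<lambda>x. 0" f] L_const[of 0] by (auto simp: below_def)

lemma L_le_1: "f \<in> below U \<Longrightarrow> L f \<le> 1"
  using L_mono[of f "\<lambda>x. 1"] L_one by (auto simp: below_def)

lemma L_le_content: "f \<in> below U \<Longrightarrow> ennreal (L f) \<le> content U"
  unfolding content_def by (rule SUP_upper)

lemma content_le_1: "content U \<le> 1"
  unfolding content_def using L_le_1 by (intro SUP_least) (simp add: ennreal_leI flip: ennreal_1)

lemma content_mono: "U \<subseteq> W \<Longrightarrow> content U \<le> content W"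
  unfolding content_def by (intro SUP_subset_mono) (auto simp: below_def)

lemma content_empty: "content {} = 0"
proof -
  have "L f = 0" if "f \<in> below {}" for f
  proof (rule antisym)
    show "L f \<le> 0" using L_mono[of f "\<lambda>x. 0"] L_const[of 0] that by (auto simp: below_def)
  qed (rule L_nonneg[OF that])
  then have "content {} \<le> 0" unfolding content_def by (intro SUP_least) simp
  then show ?thesis by simp
qed

lemma content_topspace: "content (topspace X) = 1"
proof (rule antisym[OF content_le_1])
  have "(\<lambda>x. 1) \<in> below (topspace X)" by (auto simp: below_def)
  from L_le_content[OF this] show "1 \<le> content (topspace X)" by (simp add: L_one)
qed

text \<open>Here smoothness of L enters: the part of f that exceeds finitely many test functions
  decreases to 0 pointwise as more of them are used, so its value under L tends to 0.\<close>

lemma content_UN_le: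
  assumes U: "\<And>i::nat. openin X (U i)"
  shows "content (\<Union>i. U i) \<le> (\<Sum>i. content (U i))"
  unfolding content_def[of "\<Union>i. U i"]
proof (rule SUP_least)
  fix f assume f: "f \<in> below (\<Union>i. U i)"
  have fb: "f \<in> Cb X" using f by (simp add: below_def)
  have "\<forall>i. \<exists>h. h \<in> Cb X \<and> (\<forall>x\<in>topspace X. 0 \<le> h x) \<and> U i = {x \<in> topspace X. 0 < h x}"
    using cozero[OF U] by blast
  then obtain h where h: "\<And>i. h i \<in> Cb X" "\<And>i x. x \<in> topspace X \<Longrightarrow> 0 \<le> h i x"
      "\<And>i. U i = {x \<in> topspace X. 0 < h i x}"
    by metis
  define g where "g k i x = min 1 (real k * h i x)" for k i :: nat and x
  have gb: "g k i \<in> Cb X" for k i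
    unfolding g_def by (intro Cb_intros h)
  have g0: "0 \<le> g k i x" if "x \<in> topspace X" for k i x using h(2)[OF that] by (simp add: g_def)
  have g_below: "g k i \<in> below (U i)" for k i
  proof -
    have "h i x = 0" if "x \<in> topspace X" "x \<notin> U i" for x
      using h(2)[OF that(1), of i] that h(3)[of i] by auto
    then show ?thesis using gb[of k i] g0 by (auto simp: below_def g_def)
  qed
  \<comment> \<open>k is both the slope of the test functions and their number, so that a single
    index exhausts the union.\<close>
  define G where "G k x = (\<Sum>i<k. g k i x)" for k x
  have Gb: "G k \<in> Cb X" for k unfolding G_def by (intro Cb_sum gb)
  have G_mono: "G k x \<le> G (Suc k) x" if "x \<in> topspace X" for k x
  proof -
    have "G k x \<le> (\<Sum>i<k. g (Suc k) i x)"
      unfolding G_def g_def using h(2)[OF that] by (intro sum_mono min.mono mult_right_mono) auto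
    also have "\<dots> \<le> G (Suc k) x" unfolding G_def using g0[OF that] by simp
    finally show ?thesis .
  qed
  define e where "e k x = max 0 (f x - G k x)" for k x
  have eb: "e k \<in> Cb X" for k unfolding e_def by (intro Cb_intros fb Gb)
  have lim: "(\<lambda>k. L (e k)) \<longlonglongrightarrow> 0"
  proof (rule L_smooth[OF eb])
    fix k x assume x: "x \<in> topspace X"
    show "e (Suc k) x \<le> e k x" using G_mono[OF x, of k] by (auto simp: e_def)
  next
    fix x assume x: "x \<in> topspace X"
    show "(\<lambda>k. e k x) \<longlonglongrightarrow> 0"
    proof (cases "\<exists>i. x \<in> U i")
      case False
      then have "f x = 0" using f x by (auto simp: below_def)
      then have "e k x = 0" for k using sum_nonneg[of "{..<k}" "\<lambda>i. g k i x"] g0[OF x] by (simp add: e_def G_def)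
      then show ?thesis by simp
    next
      case True
      then obtain i where i: "x \<in> U i" by auto
      then have hi: "0 < h i x" using h(3)[of i] by auto
      obtain m where m: "1 / h i x < real m" using reals_Archimedean2 by blast
      have "e k x = 0" if k: "max m (Suc i) \<le> k" for k
      proof -
        have "1 / h i x \<le> real k" using m k by simp
        then have "1 \<le> real k * h i x" using hi by (simp add: field_simps)
        then have "1 = g k i x" by (simp add: g_def)
        also have "\<dots> \<le> G k x" unfolding G_def using k g0[OF x] by (intro member_le_sum) auto
        finally show ?thesis using f x by (auto simp: below_def e_def)
      qed
      then have "\<forall>\<^sub>F k in sequentially. e k x = 0" unfolding eventually_sequentially by blast
      then show ?thesis by (rule tendsto_eventually)
    qed
  qed
  have Lf: "ennreal (L f) \<le> (\<Sum>i. content (U i)) + ennreal (L (e k))" for k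
  proof -
    have e0: "0 \<le> L (e k)"
      using L_mono[of "\<lambda>x. 0" "e k"] eb L_const[of 0] by (simp add: e_def)
    have G0: "0 \<le> L (g k i)" for i using L_nonneg[OF g_below] .
    have "L f \<le> L (\<lambda>x. G k x + e k x)"
      by (intro L_mono Cb_add Gb eb fb) (simp add: e_def)
    also have "\<dots> = (\<Sum>i<k. L (g k i)) + L (e k)"
      using L_add[OF Gb eb] L_sum[of "{..<k}" "g k"] gb by (simp add: G_def[abs_def])
    finally have "ennreal (L f) \<le> ennreal ((\<Sum>i<k. L (g k i)) + L (e k))" by (rule ennreal_leI)
    also have "\<dots> = (\<Sum>i<k. ennreal (L (g k i))) + ennreal (L (e k))"
      using e0 G0 by (simp add: sum_nonneg)
    also have "\<dots> \<le> (\<Sum>i<k. content (U i)) + ennreal (L (e k))"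
      by (intro add_mono sum_mono L_le_content g_below order_refl)
    also have "\<dots> \<le> (\<Sum>i. content (U i)) + ennreal (L (e k))"
      by (intro add_mono sum_le_suminf order_refl) auto
    finally show ?thesis .
  qed
  have "(\<lambda>k. (\<Sum>i. content (U i)) + ennreal (L (e k))) \<longlonglongrightarrow> (\<Sum>i. content (U i)) + ennreal 0"
    by (intro tendsto_add tendsto_const tendsto_ennrealI lim)
  then show "ennreal (L f) \<le> (\<Sum>i. content (U i))"
    using Lf by (intro LIMSEQ_le_const[where X = "\<lambda>k. (\<Sum>i. content (U i)) + ennreal (L (e k))"]) auto
qed

lemma outer_openin: "openin X U \<Longrightarrow> outer U = content U"
  unfolding outer_def by (intro antisym INF_lower INF_greatest) (auto intro: content_mono)

lemma outer_le_content: "openin X U \<Longrightarrow> A \<subseteq> U \<Longrightarrow> outer A \<le> content U"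
  unfolding outer_def by (rule INF_lower) auto

lemma outer_mono: "A \<subseteq> B \<Longrightarrow> outer A \<le> outer B"
  unfolding outer_def by (rule INF_superset_mono) auto

lemma outer_UN_le:
  assumes A: "\<And>i::nat. A i \<subseteq> topspace X"
  shows "outer (\<Union>i. A i) \<le> (\<Sum>i. outer (A i))"
proof (rule ennreal_le_epsilon)
  fix e :: real assume e: "0 < e"
  have "\<exists>U. openin X U \<and> A i \<subseteq> U \<and> content U \<le> outer (A i) + ennreal (e * (1/2) ^ Suc i)" for i
  proof -
    have "outer (A i) \<le> content (topspace X)" using A by (intro outer_le_content) auto
    then have "outer (A i) < \<top>" using content_topspace by (auto simp: le_less_trans)
    then have "outer (A i) < outer (A i) + ennreal (e * (1/2) ^ Suc i)"
      using e by (cases "outer (A i)") (auto simp: ennreal_less_iff simp flip: ennreal_plus)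
    then show ?thesis unfolding outer_def[of "A i"] INF_less_iff by (auto intro: less_imp_le)
  qed
  then obtain U where U: "\<And>i. openin X (U i)" "\<And>i. A i \<subseteq> U i"
    "\<And>i. content (U i) \<le> outer (A i) + ennreal (e * (1/2) ^ Suc i)" by metis
  have "outer (\<Union>i. A i) \<le> content (\<Union>i. U i)"
    using U by (intro outer_le_content openin_Union) auto
  also have "\<dots> \<le> (\<Sum>i. content (U i))" by (intro content_UN_le U)
  also have "\<dots> \<le> (\<Sum>i. outer (A i) + ennreal (e * (1/2) ^ Suc i))" by (intro suminf_le U) auto
  also have "\<dots> = (\<Sum>i. outer (A i)) + (\<Sum>i. ennreal (e * (1/2) ^ Suc i))"
    by (rule suminf_add[symmetric]) auto
  also have "(\<Sum>i. ennreal (e * (1/2) ^ Suc i)) = ennreal e"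
    using e sums_mult[OF power_half_series, of e]
    by (intro suminf_ennreal_eq) auto
  finally show "outer (\<Union>i. A i) \<le> (\<Sum>i. outer (A i)) + ennreal e" .
qed

lemma outer_measure_space_outer: "outer_measure_space (Pow (topspace X)) outer"
proof -
  have "outer {} = 0" by (simp add: outer_openin content_empty)
  then show ?thesis
    unfolding outer_measure_space_def positive_def increasing_def countably_subadditive_def
    by (auto intro: outer_mono outer_UN_le)
qed

text \<open>A test function f for W \<inter> U is complemented by a g living on W \<inter> {f < e},
  an open set that contains W - U. Where g is nonzero, f is below e; so f + g \<le> 1 + e, and
  division by 1 + e gives a test function for W.\<close>

lemma content_split:
  assumes U: "openin X U" and W: "openin X W"
  shows "content (W \<inter> U) + outer (W - U) \<le> content W"
proof -
  have "ennreal (L f) + outer (W - U) \<le> content W" if f: "f \<in> below (W \<inter> U)" for f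
  proof (rule ennreal_le_epsilon)
    fix e :: real assume e: "0 < e"
    have fb: "f \<in> Cb X" using f by (simp add: below_def)
    define W' where "W' = W \<inter> {x \<in> topspace X. f x < e}"
    have "openin X W'" unfolding W'_def using W openin_less[OF fb] by auto
    moreover have "W - U \<subseteq> W'"
    proof
      fix x assume x: "x \<in> W - U"
      then have "x \<in> topspace X" using openin_subset[OF W] by auto
      with x f e show "x \<in> W'" by (auto simp: below_def W'_def)
    qed
    ultimately have oW: "outer (W - U) \<le> content W'" by (rule outer_le_content)
    have "ennreal (L f) + ennreal (L g) \<le> content W + ennreal e" if g: "g \<in> below W'" for g
    proof -
      have gb: "g \<in> Cb X" using g by (simp add: below_def)
      define k where "k x = 1 / (1 + e) * (f x + g x)" for x
      have "k \<in> Cb X" unfolding k_def by (intro Cb_intros fb gb)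
      moreover have "0 \<le> k x \<and> k x \<le> 1 \<and> (x \<notin> W \<longrightarrow> k x = 0)" if x: "x \<in> topspace X" for x
      proof -
        have "f x + g x \<le> 1 + e"
          using f g x e by (cases "x \<in> W'") (auto simp: below_def W'_def add.commute intro: add_mono)
        moreover have "0 \<le> f x" "0 \<le> g x" "x \<notin> W \<longrightarrow> f x = 0 \<and> g x = 0"
          using f g x by (auto simp: below_def W'_def)
        ultimately show ?thesis using e by (auto simp: k_def)
      qed
      ultimately have kW: "k \<in> below W" by (auto simp: below_def)
      have "L k = 1 / (1 + e) * (L f + L g)"
        unfolding k_def using L_cmult[of "\<lambda>x. f x + g x" "1 / (1 + e)"] L_add[OF fb gb] fb gb
        by (simp add: Cb_add)
      then have "L f + L g = L k + e * L k" using e by (simp add: field_simps)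
      also have "\<dots> \<le> L k + e" using e L_le_1[OF kW] by (simp add: mult_le_cancel_left1)
      finally have "ennreal (L f + L g) \<le> ennreal (L k + e)" by (rule ennreal_leI)
      also have "\<dots> = ennreal (L k) + ennreal e" using e L_nonneg[OF kW] by simp
      also have "\<dots> \<le> content W + ennreal e" by (intro add_mono L_le_content kW order_refl)
      finally show ?thesis using L_nonneg[OF f] L_nonneg[OF g] by simp
    qed
    then have "(SUP g\<in>below W'. ennreal (L f) + ennreal (L g)) \<le> content W + ennreal e"
      by (intro SUP_least)
    also have "(SUP g\<in>below W'. ennreal (L f) + ennreal (L g)) = ennreal (L f) + content W'"
      unfolding content_def
    proof (rule ennreal_SUP_add_right[symmetric])
      show "below W' \<noteq> {}" by (auto simp: below_def intro!: exI[of _ "\<lambda>x. 0"])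
    qed
    finally have "ennreal (L f) + content W' \<le> content W + ennreal e" .
    with oW show "ennreal (L f) + outer (W - U) \<le> content W + ennreal e"
      by (meson add_left_mono order_trans)
  qed
  then have "(SUP f\<in>below (W \<inter> U). ennreal (L f) + outer (W - U)) \<le> content W" by (intro SUP_least)
  also have "(SUP f\<in>below (W \<inter> U). ennreal (L f) + outer (W - U)) = content (W \<inter> U) + outer (W - U)"
    unfolding content_def
  proof (rule ennreal_SUP_add_left)
    show "below (W \<inter> U) \<noteq> {}" by (auto simp: below_def intro!: exI[of _ "\<lambda>x. 0"])
  qed
  finally show ?thesis .
qed

text \<open>Caratheodory's condition need only be tested on open W containing A, which is
  \<open>content_split\<close>; the reverse inequality is subadditivity.\<close>

lemma openin_lambda_system:
  assumes U: "openin X U"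
  shows "U \<in> lambda_system (topspace X) (Pow (topspace X)) outer"
proof -
  have "outer (A \<inter> U) + outer (A - U) = outer A" if A: "A \<subseteq> topspace X" for A
  proof (rule antisym)
    show "outer (A \<inter> U) + outer (A - U) \<le> outer A"
      unfolding outer_def[of A]
    proof (rule INF_greatest)
      fix W assume W: "W \<in> {W. openin X W \<and> A \<subseteq> W}"
      then have "outer (A \<inter> U) + outer (A - U) \<le> content (W \<inter> U) + outer (W - U)"
        using U by (intro add_mono outer_le_content outer_mono) auto
      also have "\<dots> \<le> content W" using W U by (intro content_split) auto
      finally show "outer (A \<inter> U) + outer (A - U) \<le> content W" .
    qed
    have "outer A = outer (\<Union>i::nat. if i = 0 then A \<inter> U else if i = 1 then A - U else {})"
      by (rule arg_cong[where f = outer]) (auto split: if_splits)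
    also have "\<dots> \<le> (\<Sum>i::nat. outer (if i = 0 then A \<inter> U else if i = 1 then A - U else {}))"
      using A by (intro outer_UN_le) auto
    also have "\<dots> = (\<Sum>i\<in>{0, 1::nat}. outer (if i = 0 then A \<inter> U else if i = 1 then A - U else {}))"
      by (rule suminf_finite) (auto simp: outer_openin content_empty)
    also have "\<dots> = outer (A \<inter> U) + outer (A - U)" by simp
    finally show "outer A \<le> outer (A \<inter> U) + outer (A - U)" .
  qed
  then show ?thesis
    using openin_subset[OF U] by (auto simp: algebra.lambda_system_eq[OF algebra_Pow])
qed

section \<open>The representing measure and its integrals\<close>

definition repr :: "'b measure" where
  "repr = measure_of (topspace X) {U. openin X U} outer"

lemma measure_space_outer:
  "measure_space (topspace X) (sigma_sets (topspace X) {U. openin X U}) outer"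
proof -
  interpret P: sigma_algebra "topspace X" "Pow (topspace X)" by (rule sigma_algebra_Pow)
  have *: "measure_space (topspace X) (lambda_system (topspace X) (Pow (topspace X)) outer) outer"
    by (rule P.caratheodory_lemma[OF outer_measure_space_outer])
  then interpret l: sigma_algebra "topspace X" "lambda_system (topspace X) (Pow (topspace X)) outer"
    by (simp add: measure_space_def)
  show ?thesis
    by (rule measure_down[OF *])
      (auto intro!: sigma_algebra_sigma_sets l.sigma_sets_subset opens_subset_Pow[THEN subsetD, THEN PowD] openin_lambda_system
        dest: openin_subset)
qed

lemma sets_repr: "sets repr = sets (borel_of X)"
  unfolding repr_def sets_borel_of by (rule sets_measure_of[OF opens_subset_Pow])

lemma emeasure_repr: "A \<in> sets (borel_of X) \<Longrightarrow> emeasure repr A = outer A"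
  using measure_space_outer
  by (intro emeasure_measure_of[OF repr_def opens_subset_Pow])
    (auto simp: measure_space_def sets_repr sets_borel_of)

lemma repr_prob: "repr \<in> borel_probabilities X"
proof -
  have "space repr = topspace X" using sets_eq_imp_space_eq[OF sets_repr] by simp
  then have "prob_space repr"
    by (intro prob_spaceI) (simp add: emeasure_repr openin_sets_borel_of outer_openin content_topspace)
  then show ?thesis by (simp add: borel_probabilities_def sets_repr)
qed

lemma sum_slices: "0 \<le> s \<Longrightarrow> (\<Sum>k<m. min 1 (max 0 (s - real k))) = min (real m) s"
  by (induction m) (auto simp: min_def max_def)

text \<open>Layer cake: for both \<open>L\<close> and the integral, the \<open>k\<close>-th slice of height \<open>1/n\<close> of \<open>f\<close> has mass between
  the measures of \<open>{f > (k + 1)/n}\<close> and \<open>{f > k/n}\<close>, so the two differ by at most \<open>1/n\<close>.\<close>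

lemma integral_repr_unit:
  assumes f: "f \<in> Cb X" and f01: "\<And>x. x \<in> topspace X \<Longrightarrow> 0 \<le> f x \<and> f x \<le> 1"
  shows "(\<integral>x. f x \<partial>repr) = L f"
proof -
  interpret prob_space repr using repr_prob by (simp add: borel_probabilities_def)
  have sp: "space repr = topspace X" using sets_eq_imp_space_eq[OF sets_repr] by simp
  note int = Cb_integrable[OF repr_prob]
  have "\<bar>real n * ((\<integral>x. f x \<partial>repr) - L f)\<bar> \<le> 1" for n
  proof -
    \<comment> \<open>The k-th slice vanishes off \<open>U k\<close> and is 1 on
      \<open>U (Suc k)\<close>; the first n slices add up to n f because f \<le> 1.\<close>
    define \<phi> where "\<phi> k x = min 1 (max 0 (real n * f x - real k))" for k :: nat and x
    define U where "U k = {x \<in> topspace X. real k < real n * f x}" for k :: nat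
    have \<phi>b: "\<phi> k \<in> Cb X" for k unfolding \<phi>_def by (intro Cb_intros f)
    have Uo: "openin X (U k)" for k unfolding U_def by (intro openin_greater Cb_intros f)
    have Um: "U k \<in> sets repr" for k using openin_sets_borel_of[OF Uo] by (simp add: sets_repr)
    have mU: "ennreal (measure repr (U k)) = content (U k)" for k
      using emeasure_repr[OF openin_sets_borel_of[OF Uo]] by (simp add: outer_openin[OF Uo] emeasure_eq_measure)
    have L1: "L (\<phi> k) \<le> measure repr (U k)" for k
    proof -
      have "\<phi> k \<in> below (U k)" using \<phi>b by (auto simp: below_def \<phi>_def U_def)
      from L_le_content[OF this] show ?thesis by (simp flip: mU)
    qed
    have L2: "measure repr (U (Suc k)) \<le> L (\<phi> k)" for k
    proof -
      have p0: "0 \<le> L (\<phi> k)" using \<phi>b by (intro L_nonneg[of _ "topspace X"]) (auto simp: below_def \<phi>_def)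
      have "content (U (Suc k)) \<le> ennreal (L (\<phi> k))"
        unfolding content_def
      proof (intro SUP_least ennreal_leI L_mono \<phi>b)
        fix g x assume g: "g \<in> below (U (Suc k))" and x: "x \<in> topspace X"
        show "g x \<le> \<phi> k x"
        proof (cases "x \<in> U (Suc k)")
          case True
          then have "\<phi> k x = 1" by (auto simp: \<phi>_def U_def)
          with g x show ?thesis by (auto simp: below_def)
        next
          case False
          with g x show ?thesis by (auto simp: below_def \<phi>_def)
        qed
      qed (auto simp: below_def)
      with p0 show ?thesis by (simp flip: mU)
    qed
    have ii: "integrable repr (indicator (U k) :: 'b \<Rightarrow> real)" for k
      using Um[of k] by (intro integrable_real_indicator) (auto simp: emeasure_eq_measure)
    have I1: "(\<integral>x. \<phi> k x \<partial>repr) \<le> measure repr (U k)" for k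
    proof -
      have "(\<integral>x. \<phi> k x \<partial>repr) \<le> (\<integral>x. indicator (U k) x \<partial>repr)"
        by (intro integral_mono ii int \<phi>b) (auto simp: \<phi>_def U_def sp indicator_def)
      then show ?thesis using Um sets.sets_into_space[OF Um] by (simp add: Int_absorb2)
    qed
    have I2: "measure repr (U (Suc k)) \<le> (\<integral>x. \<phi> k x \<partial>repr)" for k
    proof -
      have "(\<integral>x. indicator (U (Suc k)) x \<partial>repr) \<le> (\<integral>x. \<phi> k x \<partial>repr)"
        by (intro integral_mono ii int \<phi>b) (auto simp: \<phi>_def U_def sp indicator_def)
      then show ?thesis using Um sets.sets_into_space[OF Um] by (simp add: Int_absorb2)
    qed
    have sum\<phi>: "(\<Sum>k<n. \<phi> k x) = real n * f x" if "x \<in> topspace X" for x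
      unfolding \<phi>_def using f01[OF that] by (subst sum_slices) (auto simp: min_def mult_le_cancel_left1)
    \<comment> \<open>The two functions agree on \<open>topspace X\<close> only, so the equality
      passes through L as two inequalities.\<close>
    have "real n * L f = L (\<lambda>x. \<Sum>k<n. \<phi> k x)"
      using L_cmult[OF f, of "real n"] f sum\<phi>
      by (auto intro!: antisym L_mono Cb_intros \<phi>b simp flip: L_cmult[OF f])
    also have "\<dots> = (\<Sum>k<n. L (\<phi> k))" by (intro L_sum \<phi>b)
    finally have nL: "real n * L f = (\<Sum>k<n. L (\<phi> k))" .
    have "real n * (\<integral>x. f x \<partial>repr) = (\<integral>x. (\<Sum>k<n. \<phi> k x) \<partial>repr)"
    proof -
      have "(\<integral>x. (\<Sum>k<n. \<phi> k x) \<partial>repr) = (\<integral>x. real n * f x \<partial>repr)"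
        by (intro Bochner_Integration.integral_cong refl sum\<phi>) (simp add: sp)
      then show ?thesis by simp
    qed
    also have "\<dots> = (\<Sum>k<n. (\<integral>x. \<phi> k x \<partial>repr))" by (intro Bochner_Integration.integral_sum int \<phi>b)
    finally have "real n * ((\<integral>x. f x \<partial>repr) - L f) = (\<Sum>k<n. (\<integral>x. \<phi> k x \<partial>repr) - L (\<phi> k))"
      using nL by (simp add: right_diff_distrib sum_subtractf)
    also have "\<bar>\<dots>\<bar> \<le> (\<Sum>k<n. measure repr (U k) - measure repr (U (Suc k)))"
    proof (intro order_trans[OF sum_abs] sum_mono)
      fix k show "\<bar>(\<integral>x. \<phi> k x \<partial>repr) - L (\<phi> k)\<bar> \<le> measure repr (U k) - measure repr (U (Suc k))"
        using L1[of k] L2[of k] I1[of k] I2[of k] by linarith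
    qed
    also have "\<dots> = measure repr (U 0) - measure repr (U n)" by (rule sum_lessThan_telescope')
    also have "\<dots> \<le> 1" using prob_le_1[of "U 0"] measure_nonneg[of repr "U n"] by linarith
    finally show ?thesis .
  qed
  then have bd: "\<bar>(\<integral>x. f x \<partial>repr) - L f\<bar> * real n \<le> 1" for n by (simp add: abs_mult mult.commute)
  show ?thesis
  proof (rule ccontr)
    assume "\<not> ?thesis"
    then have pos: "0 < \<bar>(\<integral>x. f x \<partial>repr) - L f\<bar>" by simp
    obtain n where "1 / \<bar>(\<integral>x. f x \<partial>repr) - L f\<bar> < real n" using reals_Archimedean2 by blast
    with pos have "1 < \<bar>(\<integral>x. f x \<partial>repr) - L f\<bar> * real n" by (simp add: pos_divide_less_eq mult.commute)
    with bd[of n] show False by simp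
  qed
qed

text \<open>(f + B) / (2 B) has values between 0 and 1 on the space, and both the integral and L
  respect this affine change.\<close>

lemma integral_repr:
  assumes f: "f \<in> Cb X"
  shows "(\<integral>x. f x \<partial>repr) = L f"
proof -
  interpret prob_space repr using repr_prob by (simp add: borel_probabilities_def)
  obtain B where B: "0 < B" "\<And>x. x \<in> topspace X \<Longrightarrow> \<bar>f x\<bar> \<le> B" using f by (rule CbE) blast
  define g where "g x = 1 / (2 * B) * (f x + B)" for x
  have gb: "g \<in> Cb X" unfolding g_def by (intro Cb_intros f)
  have "(\<integral>x. g x \<partial>repr) = L g"
  proof (rule integral_repr_unit[OF gb])
    fix x assume "x \<in> topspace X"
    from B(2)[OF this] B(1) show "0 \<le> g x \<and> g x \<le> 1" by (auto simp: g_def field_simps abs_le_iff)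
  qed
  moreover have "(\<integral>x. g x \<partial>repr) = 1 / (2 * B) * ((\<integral>x. f x \<partial>repr) + B)"
    unfolding g_def using Cb_integrable[OF repr_prob f] by (simp add: prob_space)
  moreover have "L g = 1 / (2 * B) * (L f + B)"
    unfolding g_def
    by (subst L_cmult) (simp_all only: Cb_add Cb_const f L_add L_const)
  ultimately show ?thesis using B(1) by simp
qed

end

section \<open>The weak topology inside a product of real lines\<close>

text \<open>Restricted to \<open>Cb X\<close> because the points of the product topology are
  extensional functions.\<close>

definition integral_functional :: "'b topology \<Rightarrow> 'b measure \<Rightarrow> ('b \<Rightarrow> real) \<Rightarrow> real" where
  "integral_functional X \<mu> = (\<lambda>f\<in>Cb X. \<integral>x. f x \<partial>\<mu>)"

abbreviation functional_topology :: "'b topology \<Rightarrow> (('b \<Rightarrow> real) \<Rightarrow> real) topology" where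
  "functional_topology X \<equiv> product_topology (\<lambda>_. euclideanreal) (Cb X)"

lemma continuous_map_integral_functional:
  "continuous_map (weak_topology X) (functional_topology X) (integral_functional X)"
  unfolding continuous_map_componentwise
proof (intro conjI ballI)
  show "integral_functional X ` topspace (weak_topology X) \<subseteq> extensional (Cb X)"
    by (auto simp: integral_functional_def)
  fix f assume f: "f \<in> Cb X"
  have "openin (weak_topology X) {\<mu> \<in> borel_probabilities X. (\<integral>x. f x \<partial>\<mu>) \<in> U}" if "open U" for U
    unfolding weak_topology_def using f that
    by (intro topology_generated_by_Basis) (auto simp: Cb_def)
  then show "continuous_map (weak_topology X) euclideanreal (\<lambda>\<mu>. integral_functional X \<mu> f)"
    using f by (simp add: continuous_map_def integral_functional_def)
qed

text \<open>The weak topology is the initial topology of \<open>integral_functional\<close>, which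
  induction over the generation of U makes explicit. Covers can then be moved to the product space
  without an inverse map.\<close>

lemma openin_weak_topology_preimage:
  assumes "openin (weak_topology X) U"
  shows "\<exists>W. openin (functional_topology X) W \<and> U = {\<mu> \<in> borel_probabilities X. integral_functional X \<mu> \<in> W}"
proof -
  let ?T = "functional_topology X" and ?pre = "\<lambda>W. {\<mu> \<in> borel_probabilities X. integral_functional X \<mu> \<in> W}"
  let ?B = "{{\<mu> \<in> borel_probabilities X. (\<integral>x. f x \<partial>\<mu>) \<in> U} |f U.
          continuous_map X euclideanreal f \<and> bounded (f ` topspace X) \<and> open U}"
  let ?P = "\<lambda>U. \<exists>W. openin (?T) W \<and> U = ?pre W"
  have "generate_topology_on ?B U"
    using assms by (simp add: weak_topology_def openin_topology_generated_by_iff)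
  then show "?P U"
  proof (induction rule: generate_topology_on.induct)
    case Empty
    show ?case by (intro exI[of _ "{}"]) auto
  next
    case (Int a b)
    then obtain W1 W2 where "openin (?T) W1" "openin (?T) W2"
      "a = ?pre W1"
      "b = ?pre W2" by blast
    then show ?case by (intro exI[of _ "W1 \<inter> W2"]) auto
  next
    case (UN K)
    then have "\<forall>k\<in>K. \<exists>W. openin (?T) W \<and>
        (\<forall>\<mu>. \<mu> \<in> k \<longleftrightarrow> \<mu> \<in> borel_probabilities X \<and> integral_functional X \<mu> \<in> W)" by blast
    from bchoice[OF this] obtain W where W: "\<And>k. k \<in> K \<Longrightarrow> openin (?T) (W k)"
      "\<And>k \<mu>. k \<in> K \<Longrightarrow> \<mu> \<in> k \<longleftrightarrow> \<mu> \<in> borel_probabilities X \<and> integral_functional X \<mu> \<in> W k" by blast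
    have "\<Union>K = ?pre (\<Union>k\<in>K. W k)"
      using W(2) by blast
    moreover have "openin (?T) (\<Union>k\<in>K. W k)" using W(1) by blast
    ultimately show ?case by blast
  next
    case (Basis s)
    then obtain f U where fU: "s = {\<mu> \<in> borel_probabilities X. (\<integral>x. f x \<partial>\<mu>) \<in> U}"
      "f \<in> Cb X" "open U" by (auto simp: Cb_def)
    have "openin (?T) {L \<in> topspace (?T). L f \<in> U}"
      using fU by (intro openin_continuous_map_preimage[OF continuous_map_product_projection]) auto
    moreover have "s = {\<mu> \<in> borel_probabilities X. integral_functional X \<mu> \<in> {L \<in> topspace (?T). L f \<in> U}}"
      using fU by (auto simp: integral_functional_def)
    ultimately show ?case by blast
  qed
qed

text \<open>By Tychonoff's theorem the functionals \<open>f \<mapsto> \<integral>f d\<mu>\<close>, \<open>\<mu> \<in> S\<close>, have a compact closure in the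
  product space; uniform smoothness makes every functional in this closure a Daniell integral.\<close>

theorem weakly_compactI:
  assumes S: "S \<subseteq> borel_probabilities X"
    and cozero: "\<And>U. openin X U \<Longrightarrow> \<exists>h\<in>Cb X. (\<forall>x\<in>topspace X. 0 \<le> h x) \<and> U = {x \<in> topspace X. 0 < h x}"
    and smooth: "\<And>f e. (\<And>k. f k \<in> Cb X) \<Longrightarrow>
      (\<And>k x. x \<in> topspace X \<Longrightarrow> f (Suc k) x \<le> f k x) \<Longrightarrow>
      (\<And>x. x \<in> topspace X \<Longrightarrow> (\<lambda>k. f k x) \<longlonglongrightarrow> 0) \<Longrightarrow> 0 < e \<Longrightarrow> \<exists>k::nat. \<forall>\<mu>\<in>S. (\<integral>x. f k x \<partial>\<mu>) \<le> e"
  shows "weakly_compact X S"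
proof -
  let ?I = "Cb X" and ?T = "functional_topology X" and ?\<Phi> = "integral_functional X"
  define C where "C = ?T closure_of (?\<Phi> ` S)"
  have \<Phi>T: "?\<Phi> \<mu> \<in> topspace ?T" for \<mu> by (simp add: integral_functional_def)
  have space: "space \<mu> = topspace X" and prob: "prob_space \<mu>" if "\<mu> \<in> borel_probabilities X" for \<mu>
    using that sets_eq_imp_space_eq[of \<mu> "borel_of X"] by (auto simp: borel_probabilities_def)
  \<comment> \<open>A point of the closure is matched by a member of S on any finite set of test
    functions; each Daniell axiom on L other than smoothness involves at most three.\<close>
  have approx: "\<exists>\<mu>\<in>S. \<forall>f\<in>J. \<bar>L f - (\<integral>x. f x \<partial>\<mu>)\<bar> < e"
    if L: "L \<in> C" and J: "finite J" "J \<subseteq> ?I" and e: "0 < e" for L J e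
  proof -
    define W where "W = PiE ?I (\<lambda>f. if f \<in> J then ball (L f) e else UNIV)"
    have "openin ?T W"
      unfolding W_def using J by (intro product_topology_basis) (auto elim: finite_subset[rotated])
    moreover have "L \<in> W"
      using L e by (auto simp: C_def W_def in_closure_of PiE_def Pi_def)
    ultimately obtain \<mu> where "\<mu> \<in> S" "?\<Phi> \<mu> \<in> W"
      using L unfolding C_def in_closure_of by blast
    moreover from this have "\<bar>L f - (\<integral>x. f x \<partial>\<mu>)\<bar> < e" if "f \<in> J" for f
    proof -
      have fI: "f \<in> ?I" using that J by auto
      then have "?\<Phi> \<mu> f \<in> (if f \<in> J then ball (L f) e else UNIV)"
        using \<open>?\<Phi> \<mu> \<in> W\<close> unfolding W_def by (rule PiE_mem[rotated])
      then show ?thesis using that fI by (simp add: integral_functional_def dist_real_def)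
    qed
    ultimately show ?thesis by blast
  qed
  have zero: "a = 0" if "\<And>e::real. 0 < e \<Longrightarrow> \<bar>a\<bar> \<le> 3 * e" for a :: real
  proof (rule ccontr)
    assume "a \<noteq> 0"
    then show False using that[of "\<bar>a\<bar> / 6"] by simp
  qed
  have repr: "\<exists>\<mu>\<in>borel_probabilities X. ?\<Phi> \<mu> = L" if L: "L \<in> C" for L
  proof -
    note app = approx[OF L]
    interpret daniell X L
    proof
      fix f g assume f: "f \<in> ?I" and g: "g \<in> ?I"
      have fg: "(\<lambda>x. f x + g x) \<in> ?I" using f g by (rule Cb_add)
      have "L (\<lambda>x. f x + g x) - (L f + L g) = 0"
      proof (rule zero)
        fix e :: real assume "0 < e"
        with app[of "{f, g, \<lambda>x. f x + g x}" e] f g fg obtain \<mu> where \<mu>: "\<mu> \<in> S"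
          "\<bar>L f - (\<integral>x. f x \<partial>\<mu>)\<bar> < e" "\<bar>L g - (\<integral>x. g x \<partial>\<mu>)\<bar> < e"
          "\<bar>L (\<lambda>x. f x + g x) - (\<integral>x. f x + g x \<partial>\<mu>)\<bar> < e" by auto
        have "(\<integral>x. f x + g x \<partial>\<mu>) = (\<integral>x. f x \<partial>\<mu>) + (\<integral>x. g x \<partial>\<mu>)"
          using \<mu>(1) S f g by (intro Bochner_Integration.integral_add Cb_integrable) auto
        with \<mu> show "\<bar>L (\<lambda>x. f x + g x) - (L f + L g)\<bar> \<le> 3 * e" by linarith
      qed
      then show "L (\<lambda>x. f x + g x) = L f + L g" by simp
    next
      fix f and c :: real assume f: "f \<in> ?I"
      have cf: "(\<lambda>x. c * f x) \<in> ?I" using f by (rule Cb_cmult)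
      have "L (\<lambda>x. c * f x) - c * L f = 0"
      proof (rule zero)
        fix e :: real assume e: "0 < e"
        define e' where "e' = e / (1 + \<bar>c\<bar>)"
        have c: "0 < 1 + \<bar>c\<bar>" by simp
        have e': "0 < e'" unfolding e'_def using e c by (rule divide_pos_pos)
        have e'': "e' + \<bar>c\<bar> * e' = e"
        proof -
          have "e' + \<bar>c\<bar> * e' = (1 + \<bar>c\<bar>) * e'" by (simp add: distrib_right)
          also have "\<dots> = e" using c by (simp add: e'_def)
          finally show ?thesis .
        qed
        from app[of "{f, \<lambda>x. c * f x}" e'] e' f cf obtain \<mu> where \<mu>:
          "\<bar>L f - (\<integral>x. f x \<partial>\<mu>)\<bar> < e'" "\<bar>L (\<lambda>x. c * f x) - c * (\<integral>x. f x \<partial>\<mu>)\<bar> < e'" by auto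
        have "\<bar>c * (\<integral>x. f x \<partial>\<mu>) - c * L f\<bar> \<le> \<bar>c\<bar> * e'"
          using \<mu>(1) by (simp add: abs_mult abs_minus_commute mult_left_mono flip: right_diff_distrib)
        with \<mu>(2) e'' e show "\<bar>L (\<lambda>x. c * f x) - c * L f\<bar> \<le> 3 * e" by linarith
      qed
      then show "L (\<lambda>x. c * f x) = c * L f" by simp
    next
      fix f g assume f: "f \<in> ?I" and g: "g \<in> ?I" and le: "\<And>x. x \<in> topspace X \<Longrightarrow> f x \<le> g x"
      show "L f \<le> L g"
      proof (rule field_le_epsilon)
        fix e :: real assume "0 < e"
        with app[of "{f, g}" "e / 2"] f g obtain \<mu> where \<mu>: "\<mu> \<in> S"
          "\<bar>L f - (\<integral>x. f x \<partial>\<mu>)\<bar> < e / 2" "\<bar>L g - (\<integral>x. g x \<partial>\<mu>)\<bar> < e / 2" by auto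
        have "(\<integral>x. f x \<partial>\<mu>) \<le> (\<integral>x. g x \<partial>\<mu>)"
          using \<mu>(1) S f g le space by (intro integral_mono Cb_integrable) auto
        with \<mu> show "L f \<le> L g + e" by linarith
      qed
    next
      have "L (\<lambda>x. 1) - 1 = 0"
      proof (rule zero)
        fix e :: real assume "0 < e"
        with app[of "{\<lambda>x. 1}" e] obtain \<mu> where \<mu>: "\<mu> \<in> S" "\<bar>L (\<lambda>x. 1) - (\<integral>x. 1 \<partial>\<mu>)\<bar> < e" by auto
        interpret prob_space \<mu> using \<mu>(1) S prob by auto
        show "\<bar>L (\<lambda>x. 1) - 1\<bar> \<le> 3 * e" using \<mu>(2) \<open>0 < e\<close> by (simp add: prob_space)
      qed
      then show "L (\<lambda>x. 1) = 1" by simp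
    next
      fix f :: "nat \<Rightarrow> 'a \<Rightarrow> real" assume f: "\<And>k. f k \<in> ?I"
        and mono: "\<And>k x. x \<in> topspace X \<Longrightarrow> f (Suc k) x \<le> f k x"
        and lim: "\<And>x. x \<in> topspace X \<Longrightarrow> (\<lambda>k. f k x) \<longlonglongrightarrow> 0"
      have anti: "f l x \<le> f k x" if "x \<in> topspace X" "k \<le> l" for k l x
        using lift_Suc_antimono_le[of "\<lambda>k. f k x"] mono that by blast
      have nonneg: "0 \<le> f k x" if "x \<in> topspace X" for k x
        using lim[OF that] anti[OF that] by (intro decseq_ge[of "\<lambda>k. f k x"]) (auto simp: decseq_def)
      show "(\<lambda>k. L (f k)) \<longlonglongrightarrow> 0"
      proof (rule LIMSEQ_I)
        fix r :: real assume r: "0 < r"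
        \<comment> \<open>k serves all of S, whereas the \<mu> later compared with L depends on l.
          This uniformity lets smoothness pass to the limit functional.\<close>
        obtain k where k: "\<And>\<mu>. \<mu> \<in> S \<Longrightarrow> (\<integral>x. f k x \<partial>\<mu>) \<le> r / 4"
          using smooth[OF f mono lim, of "r / 4"] r by auto
        have "norm (L (f l) - 0) < r" if l: "k \<le> l" for l
        proof -
          obtain \<mu> where \<mu>: "\<mu> \<in> S" "\<bar>L (f l) - (\<integral>x. f l x \<partial>\<mu>)\<bar> < r / 4"
            using app[of "{f l}" "r / 4"] f r by auto
          have \<mu>P: "\<mu> \<in> borel_probabilities X" using \<mu> S by auto
          have "(\<integral>x. f l x \<partial>\<mu>) \<le> (\<integral>x. f k x \<partial>\<mu>)"
            using anti l space[OF \<mu>P] by (intro integral_mono Cb_integrable[OF \<mu>P] f) auto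
          moreover have "0 \<le> (\<integral>x. f l x \<partial>\<mu>)"
            using nonneg space[OF \<mu>P] by (intro integral_nonneg_AE AE_I2) auto
          ultimately have "\<bar>L (f l)\<bar> < r" using \<mu>(2) k[OF \<mu>(1)] r by linarith
          then show ?thesis by simp
        qed
        then show "\<exists>no. \<forall>n\<ge>no. norm (L (f n) - 0) < r" by blast
      qed
    qed (rule cozero)
    have "?\<Phi> repr = L"
    proof
      fix f
      have "L \<in> topspace ?T" using L by (simp add: C_def in_closure_of)
      then show "?\<Phi> repr f = L f"
        using integral_repr[of f] by (auto simp: integral_functional_def PiE_iff extensional_def)
    qed
    then show ?thesis using repr_prob by blast
  qed
  \<comment> \<open>Each f bounds its own coordinate, so the functionals from S lie in a product of
    compact intervals.\<close>
  have compC: "compactin ?T C"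
  proof -
    have "\<forall>f. \<exists>B. f \<in> ?I \<longrightarrow> (\<forall>x\<in>topspace X. \<bar>f x\<bar> \<le> B)"
      by (meson CbE)
    then obtain B where B: "\<And>f x. f \<in> ?I \<Longrightarrow> x \<in> topspace X \<Longrightarrow> \<bar>f x\<bar> \<le> B f" by metis
    define K where "K = PiE ?I (\<lambda>f. {- B f..B f})"
    have K: "compactin ?T K" unfolding K_def compactin_PiE by (simp add: compactin_euclidean_iff)
    have "closedin ?T K" unfolding K_def by (simp add: closedin_product_topology)
    moreover have "?\<Phi> ` S \<subseteq> K"
    proof
      fix l assume "l \<in> ?\<Phi> ` S"
      then obtain \<mu> where \<mu>: "\<mu> \<in> S" "l = ?\<Phi> \<mu>" by auto
      then have \<mu>P: "\<mu> \<in> borel_probabilities X" using S by auto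
      interpret prob_space \<mu> by (rule prob[OF \<mu>P])
      have "\<bar>\<integral>x. f x \<partial>\<mu>\<bar> \<le> B f" if f: "f \<in> ?I" for f
      proof -
        have "\<bar>\<integral>x. f x \<partial>\<mu>\<bar> \<le> (\<integral>x. \<bar>f x\<bar> \<partial>\<mu>)" by (rule integral_abs_bound)
        also have "\<dots> \<le> (\<integral>x. B f \<partial>\<mu>)"
          using B[OF f] Cb_integrable[OF \<mu>P f] space[OF \<mu>P] by (intro integral_mono) auto
        finally show ?thesis by (simp add: prob_space)
      qed
      then show "l \<in> K" using \<mu> by (auto simp: K_def integral_functional_def abs_le_iff minus_le_iff)
    qed
    ultimately have "C \<subseteq> K" unfolding C_def by (rule closure_of_minimal[rotated])
    then show ?thesis
      by (rule closed_compactin[OF K]) (simp only: C_def closedin_closure_of)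
  qed
  \<comment> \<open>A cover of the weak closure lifts to a cover of C, because every L in C is
    represented by a measure and this measure lies in the weak closure. A finite subcover pulls
    back, because the weak closure is mapped into C.\<close>
  have "compactin (weak_topology X) (weak_topology X closure_of S)"
    unfolding compactin_def
  proof (intro conjI allI impI)
    show "weak_topology X closure_of S \<subseteq> topspace (weak_topology X)" by (rule closure_of_subset_topspace)
    fix \<U> assume U: "(\<forall>U\<in>\<U>. openin (weak_topology X) U) \<and> weak_topology X closure_of S \<subseteq> \<Union>\<U>"
    then have "\<forall>U\<in>\<U>. \<exists>W. openin ?T W \<and> (\<forall>\<mu>. \<mu> \<in> U \<longleftrightarrow> \<mu> \<in> borel_probabilities X \<and> ?\<Phi> \<mu> \<in> W)"
      using openin_weak_topology_preimage[of X] by blast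
    from bchoice[OF this] obtain W where W: "\<And>U. U \<in> \<U> \<Longrightarrow> openin ?T (W U)"
      "\<And>U \<mu>. U \<in> \<U> \<Longrightarrow> \<mu> \<in> U \<longleftrightarrow> \<mu> \<in> borel_probabilities X \<and> ?\<Phi> \<mu> \<in> W U" by blast
    have "C \<subseteq> \<Union>(W ` \<U>)"
    proof
      fix L assume L: "L \<in> C"
      then obtain \<mu> where \<mu>: "\<mu> \<in> borel_probabilities X" "?\<Phi> \<mu> = L" using repr by blast
      have "\<mu> \<in> weak_topology X closure_of S"
        unfolding in_closure_of
      proof (intro conjI allI impI)
        fix U assume U: "\<mu> \<in> U \<and> openin (weak_topology X) U"
        then obtain V where V: "openin ?T V" "U = {\<mu> \<in> borel_probabilities X. ?\<Phi> \<mu> \<in> V}"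
          using openin_weak_topology_preimage by blast
        then have "L \<in> V" using U \<mu> by auto
        with V(1) L obtain \<nu> where "\<nu> \<in> S" "?\<Phi> \<nu> \<in> V" unfolding C_def in_closure_of by blast
        with V(2) S show "\<exists>y. y \<in> S \<and> y \<in> U" by auto
      qed (use \<mu> in simp)
      then obtain U where "U \<in> \<U>" "\<mu> \<in> U" using U by blast
      with W(2)[of U] \<mu> show "L \<in> \<Union>(W ` \<U>)" by auto
    qed
    moreover have "\<forall>U\<in>W ` \<U>. openin ?T U" using W(1) by blast
    ultimately have "\<exists>\<F>. finite \<F> \<and> \<F> \<subseteq> W ` \<U> \<and> C \<subseteq> \<Union>\<F>"
      using compC unfolding compactin_def by simp
    then obtain \<F> where F: "finite \<F>" "\<F> \<subseteq> W ` \<U>" "C \<subseteq> \<Union>\<F>" by blast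
    obtain \<G> where G: "finite \<G>" "\<G> \<subseteq> \<U>" "\<F> = W ` \<G>"
      using finite_subset_image[OF F(1,2)] by blast
    have "weak_topology X closure_of S \<subseteq> \<Union>\<G>"
    proof
      fix \<mu> assume \<mu>: "\<mu> \<in> weak_topology X closure_of S"
      then have \<mu>P: "\<mu> \<in> borel_probabilities X" by (simp add: in_closure_of)
      have "?\<Phi> \<mu> \<in> C"
        using continuous_map_image_closure_subset[OF continuous_map_integral_functional, of X S] \<mu> by (auto simp: C_def)
      then obtain U where "U \<in> \<G>" "?\<Phi> \<mu> \<in> W U" using F G by auto
      with W(2)[of U] G(2) \<mu>P show "\<mu> \<in> \<Union>\<G>" by auto
    qed
    with G show "\<exists>\<F>. finite \<F> \<and> \<F> \<subseteq> \<U> \<and> weak_topology X closure_of S \<subseteq> \<Union>\<F>" by blast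
  qed
  then show ?thesis using S by (simp add: weakly_compact_def relatively_compactin_def)
qed

section \<open>Continuous functions on a compact semi-metric space\<close>

text \<open>The distance to the complement, cut off at 1 to be bounded, is 1-Lipschitz and positive
  exactly on U. If U is the whole space there is no complement, and the constant 1 serves.\<close>

lemma mtopology_of_cozero:
  assumes U: "openin (mtopology_of m) U"
  shows "\<exists>h\<in>Cb (mtopology_of m). (\<forall>x\<in>topspace (mtopology_of m). 0 \<le> h x) \<and>
    U = {x \<in> topspace (mtopology_of m). 0 < h x}"
proof -
  interpret Metric_space "mspace m" "mdist m" by (rule Metric_space_mspace_mdist)
  have U': "U \<subseteq> mspace m" "\<And>x. x \<in> U \<Longrightarrow> \<exists>r>0. mball x r \<subseteq> U"
    using U by (auto simp: mtopology_of_def openin_mtopology)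
  show ?thesis
  proof (cases "U = mspace m")
    case True
    then show ?thesis by (intro bexI[of _ "\<lambda>x. 1"]) auto
  next
    case False
    then obtain z where z: "z \<in> mspace m - U" using U' by auto
    define h where "h x = (INF y\<in>mspace m - U. min 1 (mdist m x y))" for x
    have bdd: "bdd_below ((\<lambda>y. min 1 (mdist m x y)) ` (mspace m - U))" for x
      by (intro bdd_belowI2[of _ 0]) simp
    have h0: "0 \<le> h x" for x unfolding h_def using z by (intro cINF_greatest) auto
    have h_le: "h x \<le> min 1 (mdist m x y)" if "y \<in> mspace m - U" for x y
      unfolding h_def by (intro cINF_lower bdd that)
    have h1: "\<bar>h x\<bar> \<le> 1" for x using h_le[OF z, of x] h0[of x] by simp
    have lip: "h x \<le> h y + mdist m x y" if xy: "x \<in> mspace m" "y \<in> mspace m" for x y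
    proof -
      have "h x - mdist m x y \<le> h y"
        unfolding h_def[of y]
      proof (rule cINF_greatest)
        fix w assume w: "w \<in> mspace m - U"
        have "mdist m x w \<le> mdist m x y + mdist m y w" using triangle[of x y w] xy w by simp
        with h_le[OF w, of x] show "h x - mdist m x y \<le> min 1 (mdist m y w)"
          using nonneg[of x y] by linarith
      qed (use z in auto)
      then show ?thesis by simp
    qed
    have cont: "continuous_map (mtopology_of m) euclideanreal h"
      unfolding continuous_map_def
    proof (intro conjI allI impI)
      fix W :: "real set" assume "openin euclidean W"
      then have W: "open W" by simp
      show "openin (mtopology_of m) {x \<in> topspace (mtopology_of m). h x \<in> W}"
        unfolding mtopology_of_def openin_mtopology
      proof (intro conjI allI impI)
        fix x assume "x \<in> {x \<in> topspace mtopology. h x \<in> W}"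
        then have x: "x \<in> mspace m" "h x \<in> W" by auto
        then obtain e where e: "0 < e" "ball (h x) e \<subseteq> W" using W openE by blast
        have "mball x e \<subseteq> {x \<in> topspace mtopology. h x \<in> W}"
        proof
          fix y assume y: "y \<in> mball x e"
          then have "h x \<le> h y + mdist m x y" "h y \<le> h x + mdist m y x" using lip x by auto
          with y have "\<bar>h x - h y\<bar> < e" using commute[of x y] by auto
          then have "h y \<in> ball (h x) e" by (simp add: dist_real_def)
          with e y show "y \<in> {x \<in> topspace mtopology. h x \<in> W}" by auto
        qed
        with e show "\<exists>r>0. mball x r \<subseteq> {x \<in> topspace mtopology. h x \<in> W}" by blast
      qed auto
    qed auto
    have "0 < h x \<longleftrightarrow> x \<in> U" if x: "x \<in> mspace m" for x
    proof
      assume "0 < h x"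
      then show "x \<in> U" using h_le[of x x] x by (cases "x \<in> U") auto
    next
      assume "x \<in> U"
      then obtain r where r: "0 < r" "mball x r \<subseteq> U" using U' by blast
      have "min 1 r \<le> h x"
        unfolding h_def
      proof (rule cINF_greatest)
        fix y assume y: "y \<in> mspace m - U"
        then have "y \<notin> mball x r" using r by auto
        then have "r \<le> mdist m x y" using x y by auto
        then show "min 1 r \<le> min 1 (mdist m x y)" by auto
      qed (use z in auto)
      with r show "0 < h x" by linarith
    qed
    then show ?thesis
      using U' h0 by (intro bexI[of _ h] CbI[OF cont h1]) auto
  qed
qed

section \<open>Compact semi-metric spaces and sets of continuous functions on them\<close>

locale compact_semimetric =
  fixes V :: "'v set" and d :: "'v \<Rightarrow> 'v \<Rightarrow> ennreal"
  assumes d_self: "d v v = 0" and d_commute: "d v w = d w v"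
    and d_triangle: "u \<in> V \<Longrightarrow> v \<in> V \<Longrightarrow> w \<in> V \<Longrightarrow> d u w \<le> d u v + d v w"
    and compact: "compact_space (semimetric_topology V d)"
    and nonempty: "V \<noteq> {}"
begin

abbreviation "T \<equiv> semimetric_topology V d"
abbreviation "CV \<equiv> cont_space V d"

sublocale C: Metric_space "mspace CV" "mdist CV" by (rule Metric_space_mspace_mdist)

lemma openin_ball:
  assumes v: "v \<in> V" shows "openin T {w \<in> V. d v w < ennreal e}"
  unfolding openin_semimetric_topology
proof (intro conjI ballI)
  fix x assume x: "x \<in> {w \<in> V. d v w < ennreal e}"
  define r where "r = ennreal e - d v x"
  have "0 < r" using x by (simp add: r_def diff_gr0_ennreal)
  moreover have "y \<in> {w \<in> V. d v w < ennreal e}" if y: "y \<in> V" "d x y < r" for y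
  proof -
    have "d v x \<noteq> \<top>" using x by (metis (no_types, lifting) ennreal_less_top mem_Collect_eq not_less_iff_gr_or_eq order_less_trans)
    then have "d v x + d x y < d v x + r" using y by (simp add: ennreal_add_left_cancel_less)
    also have "\<dots> = ennreal e" using x unfolding r_def by (intro add_diff_inverse_ennreal) auto
    finally show ?thesis using d_triangle[OF v _ y(1), of x] x y by auto
  qed
  ultimately show "\<exists>e'>0. \<forall>y\<in>V. d x y < e' \<longrightarrow> y \<in> {w \<in> V. d v w < ennreal e}" by blast
qed auto

lemma continuous_mapI:
  assumes x: "\<And>v e. v \<in> V \<Longrightarrow> 0 < e \<Longrightarrow> \<exists>\<delta>>0. \<forall>w\<in>V. d v w < ennreal \<delta> \<longrightarrow> \<bar>x v - x w\<bar> < e"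
  shows "continuous_map T euclideanreal x"
  unfolding continuous_map_def
proof (intro conjI allI impI)
  fix U :: "real set" assume "openin euclidean U"
  then have U: "open U" by simp
  show "openin T {v \<in> topspace T. x v \<in> U}"
    unfolding openin_semimetric_topology
  proof (intro conjI ballI)
    fix v assume "v \<in> {v \<in> topspace T. x v \<in> U}"
    then have v: "v \<in> V" "x v \<in> U" by auto
    then obtain e where e: "0 < e" "ball (x v) e \<subseteq> U" using U openE by blast
    from x[OF v(1) e(1)] obtain \<delta> where \<delta>: "0 < \<delta>" "\<And>w. w \<in> V \<Longrightarrow> d v w < ennreal \<delta> \<Longrightarrow> \<bar>x v - x w\<bar> < e" by blast
    have "w \<in> {v \<in> topspace T. x v \<in> U}" if "w \<in> V" "d v w < ennreal \<delta>" for w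
    proof -
      have "x w \<in> ball (x v) e" using \<delta>(2)[OF that] by (simp add: dist_real_def)
      with e that show ?thesis by auto
    qed
    with \<delta>(1) show "\<exists>e>0. \<forall>y\<in>V. d v y < e \<longrightarrow> y \<in> {v \<in> topspace T. x v \<in> U}"
      by (intro exI[of _ "ennreal \<delta>"]) auto
  qed auto
qed auto

lemma mspace_CV: "mspace CV = {x \<in> extensional V. continuous_map T euclideanreal x}"
proof -
  have "compactin T (topspace T)" using compact by (simp add: compact_space_def)
  from compactin_mspace_cfunspace[OF this, of euclidean_metric] show ?thesis
    by (auto simp: cont_space_def)
qed

lemma mdist_le_iff:
  assumes "x \<in> mspace CV" "y \<in> mspace CV"
  shows "mdist CV x y \<le> a \<longleftrightarrow> (\<forall>v\<in>V. \<bar>x v - y v\<bar> \<le> a)"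
proof -
  have "topspace T \<noteq> {}" using nonempty by simp
  from cfunspace_mdist_le[OF _ _ this, of x euclidean_metric y a] assms show ?thesis
    by (simp add: cont_space_def dist_real_def)
qed

text \<open>If two continuous functions differ by more than a at v, they do so on a ball around v,
  which meets D. A countable D thus turns a closed ball into countably many conditions on
  values.\<close>

lemma mdist_le_dense_iff:
  assumes x: "x \<in> mspace CV" "y \<in> mspace CV"
    and D: "D \<subseteq> V" "\<And>v e. v \<in> V \<Longrightarrow> 0 < e \<Longrightarrow> \<exists>c\<in>D. d v c < e"
  shows "mdist CV x y \<le> a \<longleftrightarrow> (\<forall>v\<in>D. \<bar>x v - y v\<bar> \<le> a)"
  unfolding mdist_le_iff[OF x]
proof (intro iffI ballI)
  fix v assume H: "\<forall>v\<in>D. \<bar>x v - y v\<bar> \<le> a" and v: "v \<in> V"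
  show "\<bar>x v - y v\<bar> \<le> a"
  proof (rule ccontr)
    assume "\<not> ?thesis"
    have "continuous_map T euclideanreal (\<lambda>v. \<bar>x v - y v\<bar>)"
      using x by (intro continuous_intros) (auto simp: mspace_CV)
    then have "openin T {v \<in> topspace T. \<bar>x v - y v\<bar> \<in> {a<..}}"
      by (rule openin_continuous_map_preimage) auto
    with v \<open>\<not> ?thesis\<close> obtain e where "0 < e" "\<And>w. w \<in> V \<Longrightarrow> d v w < e \<Longrightarrow> a < \<bar>x w - y w\<bar>"
      unfolding openin_semimetric_topology by auto
    moreover obtain c where "c \<in> D" "d v c < e" using D(2)[OF v] \<open>0 < e\<close> by blast
    ultimately show False using H D(1) by (auto simp: not_le[symmetric] subset_iff)
  qed
qed (use D in auto)

lemma mcomplete_CV: "C.mcomplete"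
proof -
  have "mcomplete_of (cfunspace T (euclidean_metric :: real metric))"
  proof -
    have "Met_TC.mcomplete TYPE(real)" by (simp add: complete_UNIV)
    then have "mcomplete_of (cfunspace T (Met_TC.Self :: real metric))" by (rule Met_TC.mcomplete_cfunspace)
    then show ?thesis by (simp add: Met_TC.Self_def euclidean_metric_def)
  qed
  then show ?thesis by (simp add: mcomplete_of_def cont_space_def)
qed

text \<open>The sets of the Arzela-Ascoli theorem, cut out by countably many levels m so that the
  exceptional probabilities of the paths can be summed.\<close>

definition equi :: "(nat \<Rightarrow> real) \<Rightarrow> (nat \<Rightarrow> 'v set) \<Rightarrow> (nat \<Rightarrow> real) \<Rightarrow> ('v \<Rightarrow> real) set" where
  "equi \<delta> N A = {x \<in> extensional V. \<forall>m. (\<forall>c\<in>N m. \<bar>x c\<bar> \<le> A m) \<and>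
     (\<forall>v\<in>V. \<forall>w\<in>V. d v w < ennreal (\<delta> m) \<longrightarrow> \<bar>x v - x w\<bar> \<le> (1/2) ^ m)}"

lemma equi_subset:
  assumes \<delta>: "\<And>m. 0 < \<delta> m"
  shows "equi \<delta> N A \<subseteq> mspace CV"
proof
  fix x assume x: "x \<in> equi \<delta> N A"
  have "continuous_map T euclideanreal x"
  proof (rule continuous_mapI)
    fix v and e :: real assume v: "v \<in> V" and e: "0 < e"
    obtain m where "(1/2::real) ^ m < e" using real_arch_pow_inv[OF e, of "1/2"] by auto
    with x v \<delta>[of m] show "\<exists>\<delta>>0. \<forall>w\<in>V. d v w < ennreal \<delta> \<longrightarrow> \<bar>x v - x w\<bar> < e"
      unfolding equi_def by (intro exI[of _ "\<delta> m"]) fastforce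
  qed
  with x show "x \<in> mspace CV" by (simp add: mspace_CV equi_def)
qed

text \<open>The values on the finite net \<open>N m\<close>, rounded down to multiples of \<eta>,
  form finitely many patterns. Functions with the same pattern differ by at most \<eta> on the net
  and by at most 3 \<eta> everywhere.\<close>

lemma mtotally_bounded_equi:
  assumes \<delta>: "\<And>m. 0 < \<delta> m" and N: "\<And>m. finite (N m)" "\<And>m. N m \<subseteq> V"
    "\<And>m v. v \<in> V \<Longrightarrow> \<exists>c\<in>N m. d c v < ennreal (\<delta> m)"
  shows "C.mtotally_bounded (equi \<delta> N A)"
  unfolding C.mtotally_bounded_def
proof (intro allI impI)
  let ?K = "equi \<delta> N A"
  fix e :: real assume e: "0 < e"
  obtain m where m: "(1/2::real) ^ m < e / 4" using real_arch_pow_inv[of "e / 4" "1/2"] e by auto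
  define \<eta> where "\<eta> = (1/2::real) ^ m"
  have \<eta>: "0 < \<eta>" "4 * \<eta> < e" using m by (auto simp: \<eta>_def)
  define \<phi> where "\<phi> x = (\<lambda>c\<in>N m. \<lfloor>x c / \<eta>\<rfloor>)" for x :: "'v \<Rightarrow> real"
  have "\<phi> ` ?K \<subseteq> PiE (N m) (\<lambda>_. {\<lfloor>- A m / \<eta>\<rfloor>..\<lfloor>A m / \<eta>\<rfloor>})"
  proof
    fix z assume "z \<in> \<phi> ` ?K"
    then obtain x where x: "x \<in> ?K" "z = \<phi> x" by auto
    have "\<lfloor>- A m / \<eta>\<rfloor> \<le> \<lfloor>x c / \<eta>\<rfloor> \<and> \<lfloor>x c / \<eta>\<rfloor> \<le> \<lfloor>A m / \<eta>\<rfloor>" if "c \<in> N m" for c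
    proof -
      have "\<bar>x c\<bar> \<le> A m" using x that by (auto simp: equi_def)
      then have "- A m \<le> x c" "x c \<le> A m" by auto
      then show ?thesis using \<eta> by (intro conjI floor_mono divide_right_mono) auto
    qed
    with x show "z \<in> PiE (N m) (\<lambda>_. {\<lfloor>- A m / \<eta>\<rfloor>..\<lfloor>A m / \<eta>\<rfloor>})" by (auto simp: \<phi>_def)
  qed
  then have "finite (\<phi> ` ?K)" by (rule finite_subset) (intro finite_PiE N, auto)
  from finite_subset_image[OF this subset_refl] obtain F where F: "F \<subseteq> ?K" "finite F" "\<phi> ` ?K = \<phi> ` F" by blast
  note sub = equi_subset[of \<delta> N A, OF \<delta>]
  have "?K \<subseteq> (\<Union>x\<in>F. C.mball x e)"
  proof
    fix y assume y: "y \<in> ?K"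
    then obtain x where x: "x \<in> F" "\<phi> y = \<phi> x" using F(3) by (metis imageE imageI)
    then have xK: "x \<in> ?K" using F by auto
    have "\<bar>x v - y v\<bar> \<le> 3 * \<eta>" if v: "v \<in> V" for v
    proof -
      obtain c where c: "c \<in> N m" "d c v < ennreal (\<delta> m)" using N(3)[OF v] by blast
      have cV: "c \<in> V" using c N(2) by auto
      have "\<bar>x c - x v\<bar> \<le> \<eta>" "\<bar>y c - y v\<bar> \<le> \<eta>"
        using xK y c cV v by (auto simp: equi_def \<eta>_def)
      moreover have "\<bar>x c - y c\<bar> \<le> \<eta>"
      proof -
        have "\<lfloor>y c / \<eta>\<rfloor> = \<lfloor>x c / \<eta>\<rfloor>" using fun_cong[OF x(2), of c] c by (simp add: \<phi>_def)
        then have "\<bar>x c / \<eta> - y c / \<eta>\<bar> \<le> 1" by linarith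
        then have "\<bar>x c - y c\<bar> / \<eta> \<le> 1" using \<eta> by (simp flip: diff_divide_distrib add: abs_divide)
        then show ?thesis using \<eta> by (simp add: pos_divide_le_eq)
      qed
      ultimately show ?thesis by linarith
    qed
    then have "mdist CV x y \<le> 3 * \<eta>" using xK y sub by (subst mdist_le_iff) auto
    with \<eta> xK y sub have "y \<in> C.mball x e" by auto
    with x show "y \<in> (\<Union>x\<in>F. C.mball x e)" by blast
  qed
  with F show "\<exists>F. finite F \<and> F \<subseteq> ?K \<and> ?K \<subseteq> (\<Union>x\<in>F. C.mball x e)" by blast
qed

text \<open>By completeness the closure of K is compact, and the open sets where \<open>f k\<close>
  is below e increase with k and cover it.\<close>

lemma Dini:
  assumes K: "C.mtotally_bounded K" and f: "\<And>k::nat. f k \<in> Cb C.mtopology"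
    and mono: "\<And>k x. x \<in> mspace CV \<Longrightarrow> f (Suc k) x \<le> f k x"
    and lim: "\<And>x. x \<in> mspace CV \<Longrightarrow> (\<lambda>k. f k x) \<longlonglongrightarrow> 0" and e: "0 < e"
  obtains k where "\<And>x. x \<in> K \<Longrightarrow> f k x < e"
proof -
  have KC: "K \<subseteq> mspace CV" and cK: "compactin C.mtopology (C.mtopology closure_of K)"
    using C.mtotally_bounded_eq_compact_closure_of[OF mcomplete_CV] K by auto
  define U where "U k = {x \<in> topspace C.mtopology. f k x < e}" for k
  have U: "openin C.mtopology (U k)" for k unfolding U_def by (rule openin_less[OF f])
  have "C.mtopology closure_of K \<subseteq> \<Union>(range U)"
  proof
    fix x assume "x \<in> C.mtopology closure_of K"
    then have x: "x \<in> mspace CV" by (simp add: in_closure_of)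
    from order_tendstoD(2)[OF lim[OF x] e] obtain k where "f k x < e"
      by (auto simp: eventually_sequentially)
    with x show "x \<in> \<Union>(range U)" by (auto simp: U_def)
  qed
  then obtain \<F> where F: "finite \<F>" "\<F> \<subseteq> range U" "C.mtopology closure_of K \<subseteq> \<Union>\<F>"
    using cK U unfolding compactin_def by (metis (no_types, lifting) rangeE)
  from finite_subset_image[OF F(1,2)] obtain J where J: "finite J" "\<F> = U ` J" by blast
  have anti: "f l x \<le> f k x" if "x \<in> mspace CV" "k \<le> l" for k l x
    using lift_Suc_antimono_le[of "\<lambda>k. f k x"] mono that by blast
  show ?thesis
  proof (rule that[of "Max (insert 0 J)"])
    fix x assume x: "x \<in> K"
    then have "x \<in> C.mtopology closure_of K" using closure_of_subset[of K C.mtopology] KC by auto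
    then obtain k where k: "k \<in> J" "f k x < e" using F J by (auto simp: U_def)
    have "f (Max (insert 0 J)) x \<le> f k x" using x KC k J by (intro anti) auto
    with k show "f (Max (insert 0 J)) x < e" by simp
  qed
qed

lemma countable_dense_UN:
  assumes K: "\<And>j::nat. C.mtotally_bounded (K j)"
  obtains Q where "countable Q" "Q \<subseteq> mspace CV"
    "\<And>x e. x \<in> (\<Union>j. K j) \<Longrightarrow> 0 < e \<Longrightarrow> \<exists>q\<in>Q. mdist CV x q < e"
proof -
  have "\<forall>j i. \<exists>F. finite F \<and> F \<subseteq> K j \<and> K j \<subseteq> (\<Union>x\<in>F. C.mball x (inverse (real (Suc i))))"
    using K unfolding C.mtotally_bounded_def by simp
  then obtain F where F: "\<And>j i. finite (F j i)" "\<And>j i. F j i \<subseteq> K j"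
    "\<And>j i. K j \<subseteq> (\<Union>x\<in>F j i. C.mball x (inverse (real (Suc i))))" by metis
  have KC: "K j \<subseteq> mspace CV" for j using C.mtotally_bounded_imp_subset[OF K] .
  show ?thesis
  proof (rule that[of "\<Union>j i. F j i"])
    show "countable (\<Union>j i. F j i)" using F(1) by (simp add: countable_finite)
    show "(\<Union>j i. F j i) \<subseteq> mspace CV" using F(2) KC by blast
    fix x and e :: real assume x: "x \<in> (\<Union>j. K j)" and e: "0 < e"
    then obtain j where j: "x \<in> K j" by auto
    obtain i where i: "inverse (real (Suc i)) < e" using reals_Archimedean[OF e] by auto
    obtain q where "q \<in> F j i" "x \<in> C.mball q (inverse (real (Suc i)))" using F(3)[of j i] j by blast
    with i show "\<exists>q\<in>\<Union>j i. F j i. mdist CV x q < e"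
      using C.commute by (intro bexI[of _ q]) auto
  qed
qed

text \<open>As Q approximates the range, the preimage of an open set is a countable union of
  preimages of closed balls with centres in Q, and these are events because such balls are tested on
  the countable D.\<close>

lemma measurable_into_CV:
  fixes g :: "'a \<Rightarrow> 'v \<Rightarrow> real"
  assumes g: "\<And>\<omega>. \<omega> \<in> space M \<Longrightarrow> g \<omega> \<in> mspace CV"
    and D: "countable D" "D \<subseteq> V" "\<And>v e. v \<in> V \<Longrightarrow> 0 < e \<Longrightarrow> \<exists>c\<in>D. d v c < e"
    and gm: "\<And>v. v \<in> D \<Longrightarrow> (\<lambda>\<omega>. g \<omega> v) \<in> borel_measurable M"
    and Q: "countable Q" "Q \<subseteq> mspace CV" "\<And>\<omega> e. \<omega> \<in> space M \<Longrightarrow> 0 < e \<Longrightarrow> \<exists>q\<in>Q. mdist CV (g \<omega>) q < e"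
  shows "g \<in> measurable M (borel_of (mtopology_of CV))"
proof (rule measurable_sigma_sets[OF sets_borel_of opens_subset_Pow])
  show "g \<in> space M \<rightarrow> topspace (mtopology_of CV)" using g by simp
  fix U assume "U \<in> {U. openin (mtopology_of CV) U}"
  then have U: "openin C.mtopology U" by (simp add: mtopology_of_def)
  let ?r = "\<lambda>i. inverse (real (Suc i))"
  let ?B = "\<lambda>q i. {\<omega> \<in> space M. \<forall>v\<in>D. \<bar>q v - g \<omega> v\<bar> \<le> ?r i}"
  define I where "I = {(q, i). q \<in> Q \<and> C.mcball q (?r i) \<subseteq> U}"
  have cI: "countable I"
    by (rule countable_subset[of _ "Q \<times> UNIV"]) (auto simp: I_def Q)
  have "g -` U \<inter> space M = (\<Union>(q, i)\<in>I. ?B q i)"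
  proof (intro set_eqI iffI)
    fix \<omega> assume "\<omega> \<in> g -` U \<inter> space M"
    then have \<omega>: "\<omega> \<in> space M" "g \<omega> \<in> U" by auto
    then obtain r where r: "0 < r" "C.mball (g \<omega>) r \<subseteq> U" using U unfolding C.openin_mtopology by blast
    obtain i where i: "?r i < r / 2" using reals_Archimedean[of "r / 2"] r by auto
    obtain q where q: "q \<in> Q" "mdist CV (g \<omega>) q < ?r i" using Q(3)[OF \<omega>(1), of "?r i"] by auto
    have qC: "q \<in> mspace CV" using q Q by auto
    have "C.mcball q (?r i) \<subseteq> C.mball (g \<omega>) r"
    proof
      fix y assume y: "y \<in> C.mcball q (?r i)"
      then have "mdist CV (g \<omega>) y \<le> mdist CV (g \<omega>) q + mdist CV q y"
        using g[OF \<omega>(1)] qC by (intro C.triangle) auto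
      with y q i g[OF \<omega>(1)] show "y \<in> C.mball (g \<omega>) r" by auto
    qed
    with r q have "(q, i) \<in> I" by (auto simp: I_def)
    moreover have "\<forall>v\<in>D. \<bar>q v - g \<omega> v\<bar> \<le> ?r i"
    proof -
      have "mdist CV q (g \<omega>) \<le> ?r i" using q C.commute[of q "g \<omega>"] by simp
      then show ?thesis using mdist_le_dense_iff[OF qC g[OF \<omega>(1)] D(2,3)] by blast
    qed
    ultimately show "\<omega> \<in> (\<Union>(q, i)\<in>I. ?B q i)"
      using \<omega> by blast
  next
    fix \<omega> assume "\<omega> \<in> (\<Union>(q, i)\<in>I. ?B q i)"
    then obtain q i where qi: "(q, i) \<in> I" and \<omega>: "\<omega> \<in> space M" "\<forall>v\<in>D. \<bar>q v - g \<omega> v\<bar> \<le> ?r i" by blast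
    have qC: "q \<in> mspace CV" using qi Q by (auto simp: I_def)
    have "mdist CV q (g \<omega>) \<le> ?r i"
      using mdist_le_dense_iff[OF qC g[OF \<omega>(1)] D(2,3)] \<omega> by auto
    then have "g \<omega> \<in> C.mcball q (?r i)" using qC g[OF \<omega>(1)] by auto
    with qi \<omega> show "\<omega> \<in> g -` U \<inter> space M" by (auto simp: I_def)
  qed
  also have "\<dots> \<in> sets M"
  proof (rule sets.countable_UN''[OF cI])
    fix z assume z: "z \<in> I"
    obtain q i where qi: "z = (q, i)" by (cases z)
    have "?B q i \<in> sets M"
    proof -
      have "?B q i
          = space M - (\<Union>v\<in>D. {\<omega> \<in> space M. \<not> \<bar>q v - g \<omega> v\<bar> \<le> ?r i})" by auto
      also have "\<dots> \<in> sets M"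
      proof (intro sets.Diff sets.top sets.countable_UN''[OF D(1)])
        fix v assume "v \<in> D"
        note [measurable] = gm[OF this]
        show "{\<omega> \<in> space M. \<not> \<bar>q v - g \<omega> v\<bar> \<le> ?r i} \<in> sets M" by measurable
      qed
      finally show ?thesis .
    qed
    then show "(case z of (q, i) \<Rightarrow> ?B q i) \<in> sets M"
      by (simp add: qi)
  qed
  finally show "g -` U \<inter> space M \<in> sets M" .
qed

end

section \<open>Tightness of the normed sums\<close>

text \<open>f itself need not be measurable. Its preimages differ from those of g inside null sets,
  so in the completion they are events of the same probability.\<close>

lemma distr_completion_cong_AE:
  assumes g: "g \<in> measurable M N" and ae: "AE x in M. f x = g x"
  shows "distr (completion M) N f = distr M N g"
proof -
  have "distr (completion M) N f = distr (completion M) N g"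
    unfolding distr_def
  proof (rule measure_of_eq[OF sets.space_closed])
    fix A assume "A \<in> sigma_sets (space N) (sets N)"
    then have A: "A \<in> sets N" by (simp add: sets.sigma_sets_eq)
    have gA: "g -` A \<inter> space M \<in> sets (completion M)" using measurable_sets[OF g A] by auto
    have ae': "AE x in completion M. f x = g x" using ae by (rule AE_completion)
    have AEf: "AE x in completion M. x \<in> g -` A \<inter> space M \<longleftrightarrow> x \<in> f -` A \<inter> space M"
      using ae' by eventually_elim auto
    have fA: "f -` A \<inter> space M \<in> sets (completion M)"
      by (rule completion.in_sets_AE[OF AEf gA]) auto
    show "emeasure (completion M) (f -` A \<inter> space (completion M)) = emeasure (completion M) (g -` A \<inter> space (completion M))"
      using AEf fA gA by (intro emeasure_eq_AE) auto
  qed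
  also have "\<dots> = distr M N g" by (rule distr_completion[OF g])
  finally show ?thesis .
qed

locale entropy_field = martingale_field M F V \<xi>
  for M :: "'a measure" and F and V :: "'v set" and \<xi> +
  assumes compact_V: "compact_space (semimetric_topology V (rho M V \<xi>))"
    and separable: "\<And>n. n \<ge> 1 \<Longrightarrow> separable_field M (semimetric_topology V (rho M V \<xi>)) (S n)"
    and entropy: "(\<integral>\<^sup>+\<epsilon>\<in>{0<..<1}. entropy_term \<epsilon> \<partial>lborel) < \<infinity>"
begin

sublocale compact_semimetric V "rho M V \<xi>"
  by (intro compact_semimetric.intro rho_self rho_commute rho_triangle compact_V V_nonempty)

definition sum_path :: "nat \<Rightarrow> 'a \<Rightarrow> 'v \<Rightarrow> real" where
  "sum_path n \<omega> = (\<lambda>v\<in>V. S n v \<omega>)"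

text \<open>Markov's inequality at every level m, once for the modulus and once for the maximum over
  a net, puts the path into a fixed set \<open>equi\<close> outside an event of probability at most
  \<epsilon>. The modulus concerns pairs in D only; separability carries the bound over to
  V.\<close>

lemma paths_tight:
  obtains D where "countable D" "D \<subseteq> V" "\<And>v e. v \<in> V \<Longrightarrow> 0 < e \<Longrightarrow> \<exists>c\<in>D. d v c < e"
    "\<And>\<epsilon>. 0 < \<epsilon> \<Longrightarrow> \<exists>K. C.mtotally_bounded K \<and>
       (\<forall>n\<ge>1. \<exists>B\<in>sets M. prob B \<ge> 1 - \<epsilon> \<and> (\<forall>\<omega>\<in>B. sum_path n \<omega> \<in> K))"
proof -
  note thesisI = that
  define sep where "sep n D0 N0 \<longleftrightarrow> countable D0 \<and> D0 \<subseteq> V \<and> N0 \<in> null_sets M \<and>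
      (\<forall>G K. openin T G \<longrightarrow> closed K \<longrightarrow>
         {\<omega>\<in>space M. \<forall>v\<in>G \<inter> D0. S n v \<omega> \<in> K} - {\<omega>\<in>space M. \<forall>v\<in>G. S n v \<omega> \<in> K} \<subseteq> N0)"
    for n D0 N0
  have "\<exists>D0 N0. sep n D0 N0" if "n \<ge> 1" for n
    using separable[OF that] unfolding separable_field_def topspace_semimetric_topology sep_def .
  then obtain D0 N0 where sep: "\<And>n. n \<ge> 1 \<Longrightarrow> sep n (D0 n) (N0 n)" by metis
  have D0: "countable (D0 n)" "D0 n \<subseteq> V" "N0 n \<in> null_sets M" if "n \<ge> 1" for n
    using sep[OF that] unfolding sep_def by blast+
  obtain v1 where v1: "v1 \<in> V" using V_nonempty by blast
  \<comment> \<open>Collects the separating sets of all n, so that one D serves every n; v1 makes it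
    nonempty.\<close>
  define E where "E = insert v1 (\<Union>n\<in>{1..}. D0 n)"
  have E: "countable E" "E \<subseteq> V" "E \<noteq> {}" using D0(1,2) v1 by (auto simp: E_def)
  obtain D C where D: "countable D" "E \<subseteq> D" "D \<subseteq> V"
    and C: "\<And>k. finite (C k)" "\<And>k. C k \<subseteq> D" "\<And>k v. v \<in> V \<Longrightarrow> \<exists>c\<in>C k. d c v \<le> ennreal ((1/2) ^ k)"
    and mod: "\<And>e. 0 < e \<Longrightarrow> \<exists>\<delta>>0. \<forall>n\<in>{1..}. (\<integral>\<^sup>+x. modulus d D \<delta> (\<lambda>v. S n v x) \<partial>M) \<le> ennreal e"
    by (rule uniform_modulus[OF entropy E]) blast
  have net: "\<exists>k. \<forall>v\<in>V. \<exists>c\<in>C k. d c v < e" if e: "0 < e" for e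
  proof -
    obtain r where r: "0 < r" "ennreal r \<le> e"
      using e by (cases e) (auto intro: that[of 1])
    obtain k where "(1/2::real) ^ k < r" using real_arch_pow_inv[OF r(1), of "1/2"] by auto
    then have "ennreal ((1/2) ^ k) < ennreal r" using r(1) by (intro ennreal_lessI) auto
    then have k: "ennreal ((1/2) ^ k) < e" using r(2) by (rule less_le_trans)
    show ?thesis using C(3) k by (meson le_less_trans)
  qed
  have dense: "\<exists>c\<in>D. d v c < e" if "v \<in> V" "0 < e" for v e
    using net[OF that(2)] C(2) that(1) d_commute by (metis subsetD)
  \<comment> \<open>One fixed exponent suffices for the values at finitely many net points, whose
    moments are bounded by \<tau> directly.\<close>
  obtain q0 where q0: "2 < q0" "ereal q0 < tau_sup M V \<xi>" using ereal_dense2[OF tau_sup] by auto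
  define B0 where "B0 = 2 * \<tau>r q0"
  have B0: "0 \<le> B0" using \<tau>r_nonneg by (simp add: B0_def)
  have tight: "\<exists>K. C.mtotally_bounded K \<and>
       (\<forall>n\<ge>1. \<exists>B\<in>sets M. prob B \<ge> 1 - \<epsilon> \<and> (\<forall>\<omega>\<in>B. sum_path n \<omega> \<in> K))" if \<epsilon>: "0 < \<epsilon>" for \<epsilon> :: real
  proof -
    define \<eta> where "\<eta> m = (1/2::real) ^ (m + 1)" for m :: nat
    \<comment> \<open>There are two bad events at each level, and 2 (1/2)^(m + 2) sums to 1 over
      m.\<close>
    define \<epsilon>' where "\<epsilon>' m = \<epsilon> * (1/2::real) ^ (m + 2)" for m :: nat
    have \<eta>: "0 < \<eta> m" and \<epsilon>': "0 < \<epsilon>' m" for m using \<epsilon> by (simp_all add: \<eta>_def \<epsilon>'_def)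
    define Q where "Q \<delta> n \<omega> = modulus d D \<delta> (\<lambda>v. S n v \<omega>)" for \<delta> n \<omega>
    have "\<forall>m. \<exists>\<delta>>0. \<forall>n\<in>{1..}. (\<integral>\<^sup>+x. Q \<delta> n x \<partial>M) \<le> ennreal (\<epsilon>' m * \<eta> m)"
      unfolding Q_def using mod \<eta> \<epsilon>' by (intro allI mod mult_pos_pos)
    then obtain \<delta> where \<delta>: "\<And>m. 0 < \<delta> m" "\<And>m n. n \<ge> 1 \<Longrightarrow> (\<integral>\<^sup>+x. Q (\<delta> m) n x \<partial>M) \<le> ennreal (\<epsilon>' m * \<eta> m)"
      by (metis atLeast_iff)
    \<comment> \<open>Two points of an open ball of radius \<open>\<delta>' m\<close> are less than
      \<open>\<delta> m\<close> apart.\<close>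
    define \<delta>' where "\<delta>' m = \<delta> m / 2" for m
    have \<delta>': "0 < \<delta>' m" for m using \<delta>(1) by (simp add: \<delta>'_def)
    have "\<forall>m. \<exists>k. \<forall>v\<in>V. \<exists>c\<in>C k. d c v < ennreal (\<delta>' m)" using net \<delta>' by simp
    then obtain k where k: "\<And>m v. v \<in> V \<Longrightarrow> \<exists>c\<in>C (k m). d c v < ennreal (\<delta>' m)" by metis
    define N where "N m = C (k m)" for m
    have NV: "N m \<subseteq> V" for m using C(2) D(3) by (auto simp: N_def)
    define b where "b m = real (card (N m)) powr (1 / q0) * B0" for m
    have b: "0 \<le> b m" for m using B0 by (simp add: b_def)
    \<comment> \<open>Markov's inequality then gives a probability of at most b / A \<le>
      \<epsilon>' at level m; the added 1 keeps A positive.\<close>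
    define A where "A m = (b m + 1) / \<epsilon>' m" for m
    have A: "0 < A m" for m using b[of m] \<epsilon>'[of m] by (simp add: A_def add_nonneg_pos)
    define R where "R m n \<omega> = (SUP c\<in>N m. ennreal \<bar>S n c \<omega>\<bar>)" for m n \<omega>
    have Qm [measurable]: "Q \<delta> n \<in> borel_measurable M" for \<delta> n
    proof -
      have "countable {(v, w). v \<in> D \<and> w \<in> D \<and> d v w < ennreal \<delta>}"
        by (rule countable_subset[of _ "D \<times> D"]) (auto simp: D(1))
      then show ?thesis unfolding Q_def modulus_def
        using D(3) by (intro borel_measurable_SUP) (auto intro!: measurable_compose[OF _ measurable_ennreal]
          borel_measurable_abs borel_measurable_diff measurable_normed_sum)
    qed
    have Rm [measurable]: "R m n \<in> borel_measurable M" for m n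
      unfolding R_def using NV[of m] C(1)
      by (intro borel_measurable_SUP) (auto simp: N_def countable_finite intro!: measurable_compose[OF _ measurable_ennreal]
          borel_measurable_abs measurable_normed_sum)
    have ER: "(\<integral>\<^sup>+x. R m n x \<partial>M) \<le> ennreal (b m)" if n: "n \<ge> 1" for m n
      unfolding R_def b_def
    proof (rule nn_integral_SUP_finite_le)
      fix c assume "c \<in> N m"
      then show "moment_le M q0 (S n c) B0"
        unfolding B0_def using NV by (intro normed_sum_moment_bound q0 n) auto
    qed (use q0 B0 C(1) NV in \<open>auto simp: N_def intro!: measurable_normed_sum\<close>)
    define bad where "bad n m = {\<omega>\<in>space M. 1 \<le> ennreal (1 / \<eta> m) * Q (\<delta> m) n \<omega>} \<union>
        {\<omega>\<in>space M. 1 \<le> ennreal (1 / A m) * R m n \<omega>}" for n m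
    have bad_sets: "bad n m \<in> sets M" for n m unfolding bad_def by measurable
    have bad_le: "emeasure M (bad n m) \<le> ennreal (\<epsilon> * (1/2) ^ Suc m)" if n: "n \<ge> 1" for n m
    proof -
      have "emeasure M {\<omega>\<in>space M. 1 \<le> ennreal (1 / \<eta> m) * Q (\<delta> m) n \<omega>}
          \<le> ennreal (1 / \<eta> m) * (\<integral>\<^sup>+x. Q (\<delta> m) n x * indicator (space M) x \<partial>M)"
        by (rule nn_integral_Markov_inequality) auto
      also have "(\<integral>\<^sup>+x. Q (\<delta> m) n x * indicator (space M) x \<partial>M) = (\<integral>\<^sup>+x. Q (\<delta> m) n x \<partial>M)"
        by (intro nn_integral_cong) auto
      also have "ennreal (1 / \<eta> m) * \<dots> \<le> ennreal (1 / \<eta> m) * ennreal (\<epsilon>' m * \<eta> m)"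
        by (intro mult_left_mono \<delta> n) auto
      also have "\<dots> = ennreal (\<epsilon>' m)"
        using \<eta>[of m] \<epsilon>'[of m] by (simp flip: ennreal_mult)
      finally have 1: "emeasure M {\<omega>\<in>space M. 1 \<le> ennreal (1 / \<eta> m) * Q (\<delta> m) n \<omega>} \<le> ennreal (\<epsilon>' m)" .
      have "emeasure M {\<omega>\<in>space M. 1 \<le> ennreal (1 / A m) * R m n \<omega>}
          \<le> ennreal (1 / A m) * (\<integral>\<^sup>+x. R m n x * indicator (space M) x \<partial>M)"
        by (rule nn_integral_Markov_inequality) auto
      also have "(\<integral>\<^sup>+x. R m n x * indicator (space M) x \<partial>M) = (\<integral>\<^sup>+x. R m n x \<partial>M)"
        by (intro nn_integral_cong) auto
      also have "ennreal (1 / A m) * \<dots> \<le> ennreal (1 / A m) * ennreal (b m)"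
        by (intro mult_left_mono ER n) auto
      also have "\<dots> = ennreal (1 / A m * b m)" using A[of m] b[of m] by (simp flip: ennreal_mult)
      also have "\<dots> \<le> ennreal (\<epsilon>' m)"
      proof (rule ennreal_leI)
        have "b m * \<epsilon>' m \<le> \<epsilon>' m * (b m + 1)" using \<epsilon>'[of m] by (simp add: algebra_simps)
        then show "1 / A m * b m \<le> \<epsilon>' m"
          using b[of m] by (simp add: A_def pos_divide_le_eq mult.commute add_nonneg_pos)
      qed
      finally have 2: "emeasure M {\<omega>\<in>space M. 1 \<le> ennreal (1 / A m) * R m n \<omega>} \<le> ennreal (\<epsilon>' m)" .
      have "emeasure M (bad n m) \<le> ennreal (\<epsilon>' m) + ennreal (\<epsilon>' m)"
        unfolding bad_def by (rule order_trans[OF emeasure_subadditive add_mono[OF 1 2]]) measurable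
      also have "\<dots> = ennreal (\<epsilon>' m + \<epsilon>' m)" using \<epsilon>'[of m] by (intro ennreal_plus[symmetric]) auto
      also have "\<epsilon>' m + \<epsilon>' m = \<epsilon> * (1/2) ^ Suc m" by (simp add: \<epsilon>'_def)
      finally show ?thesis .
    qed
    define Z where "Z n = (\<Union>m. bad n m) \<union> N0 n" for n
    have Z: "Z n \<in> sets M" "prob (Z n) \<le> \<epsilon>" if n: "n \<ge> 1" for n
    proof -
      have N0: "N0 n \<in> sets M" "emeasure M (N0 n) = 0" using D0(3)[OF n] by auto
      show "Z n \<in> sets M" unfolding Z_def using bad_sets N0 by auto
      have "emeasure M (Z n) \<le> emeasure M (\<Union>m. bad n m) + emeasure M (N0 n)"
        unfolding Z_def using bad_sets N0 by (intro emeasure_subadditive) auto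
      also have "\<dots> \<le> (\<Sum>m. emeasure M (bad n m))"
        using bad_sets N0 by (simp add: emeasure_subadditive_countably image_subset_iff)
      also have "\<dots> \<le> (\<Sum>m. ennreal (\<epsilon> * (1/2) ^ Suc m))" using bad_le[OF n] by (intro suminf_le) auto
      also have "\<dots> = ennreal \<epsilon>"
        using \<epsilon> sums_mult[OF power_half_series, of \<epsilon>] by (intro suminf_ennreal_eq) auto
      finally show "prob (Z n) \<le> \<epsilon>" using \<epsilon> by (simp add: emeasure_eq_measure)
    qed
    have good: "sum_path n \<omega> \<in> equi \<delta>' N A" if n: "n \<ge> 1" and \<omega>: "\<omega> \<in> space M - Z n" for n \<omega>
    proof -
      have less: "x < ennreal r" if "\<not> 1 \<le> ennreal (1 / r) * x" "0 < r" for x r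
      proof (rule ccontr)
        assume "\<not> x < ennreal r"
        then have "ennreal (1 / r) * ennreal r \<le> ennreal (1 / r) * x" by (intro mult_left_mono) auto
        with that show False by (simp flip: ennreal_mult)
      qed
      have QR: "Q (\<delta> m) n \<omega> < ennreal (\<eta> m)" "R m n \<omega> < ennreal (A m)" for m
      proof -
        have "\<omega> \<notin> bad n m" "\<omega> \<in> space M" using \<omega> by (auto simp: Z_def)
        then show "Q (\<delta> m) n \<omega> < ennreal (\<eta> m)" "R m n \<omega> < ennreal (A m)"
          by (auto simp: bad_def intro!: less \<eta> A)
      qed
      let ?S = "\<lambda>v. S n v \<omega>"
      have 1: "\<bar>?S c\<bar> \<le> A m" if c: "c \<in> N m" for c m
      proof -
        have "ennreal \<bar>?S c\<bar> \<le> R m n \<omega>" unfolding R_def using c by (intro SUP_upper)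
        also have "\<dots> < ennreal (A m)" by (rule QR)
        finally show ?thesis by (simp add: ennreal_less_iff)
      qed
      \<comment> \<open>In the ball G around v, the values at points of D lie in a closed interval
        of radius \<eta> about the value at one such point a. Separability, applied to the open G
        and this closed interval, extends this to all of G, in particular to v and w.\<close>
      have 2: "\<bar>?S v - ?S w\<bar> \<le> (1/2) ^ m" if vw: "v \<in> V" "w \<in> V" "d v w < ennreal (\<delta>' m)" for v w m
      proof -
        define G where "G = {w \<in> V. d v w < ennreal (\<delta>' m)}"
        have Go: "openin T G" unfolding G_def by (rule openin_ball[OF vw(1)])
        have close: "\<bar>?S x - ?S y\<bar> \<le> \<eta> m" if xy: "x \<in> G" "x \<in> D" "y \<in> G" "y \<in> D" for x y
        proof -
          have add: "x + y < ennreal (2 * r)" if "x < ennreal r" "y < ennreal r" for x y r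
            using that by (cases x; cases y) (auto simp: ennreal_less_iff simp flip: ennreal_plus)
          have "d x y \<le> d v x + d v y"
            using d_triangle[of x v y] d_commute[of v x] vw xy by (auto simp: G_def)
          also have "\<dots> < ennreal (2 * \<delta>' m)" using xy by (intro add) (auto simp: G_def)
          finally have "d x y < ennreal (\<delta> m)" by (simp add: \<delta>'_def)
          then have "ennreal \<bar>?S x - ?S y\<bar> \<le> Q (\<delta> m) n \<omega>"
            unfolding Q_def modulus_def using xy by (intro SUP_upper2[of "(x, y)"]) auto
          also have "\<dots> < ennreal (\<eta> m)" by (rule QR)
          finally show ?thesis by (simp add: ennreal_less_iff)
        qed
        have "0 < ennreal (\<delta>' m)" using \<delta>'[of m] by simp
        from dense[OF vw(1) this] obtain a where a: "a \<in> D" "a \<in> G" using D(3) by (auto simp: G_def)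
        define K where "K = {?S a - \<eta> m..?S a + \<eta> m}"
        have "\<omega> \<in> {\<omega>\<in>space M. \<forall>v\<in>G \<inter> D0 n. S n v \<omega> \<in> K}"
        proof -
          have "D0 n \<subseteq> D" using D(2) n by (auto simp: E_def)
          then have "?S x \<in> K" if "x \<in> G \<inter> D0 n" for x
            using close[of a x] a that unfolding K_def by (auto simp: abs_le_iff)
          then show ?thesis using \<omega> by auto
        qed
        moreover have "\<omega> \<notin> N0 n" using \<omega> by (auto simp: Z_def)
        moreover have "closed K" by (simp add: K_def)
        ultimately have "\<forall>v\<in>G. ?S v \<in> K" using sep[OF n] Go unfolding sep_def by blast
        moreover have "v \<in> G" "w \<in> G" using vw d_self \<open>0 < ennreal (\<delta>' m)\<close> by (auto simp: G_def)
        ultimately have "?S v \<in> K" "?S w \<in> K" by auto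
        then have "\<bar>?S v - ?S w\<bar> \<le> 2 * \<eta> m" by (auto simp: K_def abs_le_iff)
        then show ?thesis by (simp add: \<eta>_def)
      qed
      show ?thesis using 1 2 NV by (auto simp: equi_def sum_path_def subset_iff)
    qed
    show ?thesis
    proof (intro exI[of _ "equi \<delta>' N A"] conjI allI impI)
      show "C.mtotally_bounded (equi \<delta>' N A)"
        using k by (intro mtotally_bounded_equi \<delta>' NV) (auto simp: N_def C(1))
      fix n :: nat assume n: "1 \<le> n"
      show "\<exists>B\<in>sets M. 1 - \<epsilon> \<le> prob B \<and> (\<forall>\<omega>\<in>B. sum_path n \<omega> \<in> equi \<delta>' N A)"
        using Z[OF n] good[OF n] prob_compl[OF Z(1)[OF n]] by (intro bexI[of _ "space M - Z n"]) auto
    qed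
  qed
  show ?thesis by (rule thesisI[OF D(1,3) dense tight])
qed

section \<open>Continuity of the paths and weak compactness of their laws\<close>

theorem normed_sums_weakly_compact:
  shows "\<forall>n\<ge>1. AE \<omega> in M. sum_path n \<omega> \<in> mspace CV"
    and "weakly_compact (mtopology_of CV) ((\<lambda>n. field_law M V d (S n)) ` {1..})"
proof -
  obtain D where D: "countable D" "D \<subseteq> V" "\<And>v e. v \<in> V \<Longrightarrow> 0 < e \<Longrightarrow> \<exists>c\<in>D. d v c < e"
    and tight: "\<And>\<epsilon>. 0 < \<epsilon> \<Longrightarrow> \<exists>K. C.mtotally_bounded K \<and>
       (\<forall>n\<ge>1. \<exists>B\<in>sets M. prob B \<ge> 1 - \<epsilon> \<and> (\<forall>\<omega>\<in>B. sum_path n \<omega> \<in> K))"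
    by (rule paths_tight) blast
  have "\<forall>j. \<exists>K. C.mtotally_bounded K \<and>
       (\<forall>n\<ge>1. \<exists>B\<in>sets M. prob B \<ge> 1 - inverse (real (Suc j)) \<and> (\<forall>\<omega>\<in>B. sum_path n \<omega> \<in> K))"
    by (intro allI tight) simp
  then obtain K where K: "\<And>j. C.mtotally_bounded (K j)"
    "\<And>j n. n \<ge> 1 \<Longrightarrow> \<exists>B\<in>sets M. prob B \<ge> 1 - inverse (real (Suc j)) \<and> (\<forall>\<omega>\<in>B. sum_path n \<omega> \<in> K j)"
    by metis
  have KC: "K j \<subseteq> mspace CV" for j using C.mtotally_bounded_imp_subset[OF K(1)] .
  \<comment> \<open>Almost every path lies in a countable union of totally bounded sets. This yields
    continuity and also the separable range from which Borel measurability is derived.\<close>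
  have "\<exists>U\<in>sets M. prob U = 1 \<and> (\<forall>\<omega>\<in>U. sum_path n \<omega> \<in> (\<Union>j. K j))" if n: "n \<ge> 1" for n
  proof -
    obtain B where B: "\<And>j. B j \<in> sets M" "\<And>j. prob (B j) \<ge> 1 - inverse (real (Suc j))"
      "\<And>j \<omega>. \<omega> \<in> B j \<Longrightarrow> sum_path n \<omega> \<in> K j" using K(2)[OF n] by metis
    have "1 \<le> prob (\<Union>j. B j)"
    proof (rule field_le_epsilon)
      fix e :: real assume "0 < e"
      then obtain j where j: "inverse (real (Suc j)) < e" using reals_Archimedean by blast
      have "prob (B j) \<le> prob (\<Union>j. B j)" using B(1) by (intro finite_measure_mono) auto
      with B(2)[of j] j show "1 \<le> prob (\<Union>j. B j) + e" by linarith
    qed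
    then have "prob (\<Union>j. B j) = 1" using prob_le_1[of "\<Union>j. B j"] by linarith
    moreover have "\<forall>\<omega>\<in>\<Union>j. B j. sum_path n \<omega> \<in> (\<Union>j. K j)" using B(3) by blast
    moreover have "(\<Union>j. B j) \<in> sets M" using B(1) by auto
    ultimately show ?thesis by blast
  qed
  then obtain U where U: "\<And>n. n \<ge> 1 \<Longrightarrow> U n \<in> sets M" "\<And>n. n \<ge> 1 \<Longrightarrow> prob (U n) = 1"
    "\<And>n \<omega>. n \<ge> 1 \<Longrightarrow> \<omega> \<in> U n \<Longrightarrow> sum_path n \<omega> \<in> (\<Union>j. K j)" by metis
  have AEU: "AE \<omega> in M. \<omega> \<in> U n" if "n \<ge> 1" for n using U(1,2)[OF that] prob_eq_1 by auto
  show "\<forall>n\<ge>1. AE \<omega> in M. sum_path n \<omega> \<in> mspace CV"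
  proof (intro allI impI)
    fix n :: nat assume n: "1 \<le> n"
    show "AE \<omega> in M. sum_path n \<omega> \<in> mspace CV"
      using AEU[OF n] by eventually_elim (use U(3)[OF n] KC in blast)
  qed
  obtain Q where Q: "countable Q" "Q \<subseteq> mspace CV" "\<And>x e. x \<in> (\<Union>j. K j) \<Longrightarrow> 0 < e \<Longrightarrow> \<exists>q\<in>Q. mdist CV x q < e"
    by (rule countable_dense_UN[of K, OF K(1)]) (rule that)
  define z where "z = (\<lambda>v\<in>V. 0::real)"
  have z: "z \<in> mspace CV"
  proof -
    have "continuous_map T euclideanreal z" by (rule continuous_mapI) (auto simp: z_def intro: exI[of _ 1])
    then show ?thesis by (simp add: mspace_CV z_def)
  qed
  \<comment> \<open>A version of the path that lies in the function space everywhere and is Borel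
    measurable; its law is the \<open>field_law\<close>.\<close>
  define g where "g n \<omega> = (if \<omega> \<in> U n then sum_path n \<omega> else z)" for n \<omega>
  have g: "g n \<omega> \<in> mspace CV" if "n \<ge> 1" for n \<omega> using U(3)[OF that] KC z by (auto simp: g_def)
  have gm: "g n \<in> measurable M (borel_of (mtopology_of CV))" if n: "n \<ge> 1" for n
  proof (rule measurable_into_CV[OF g[OF n] D])
    fix v assume "v \<in> D"
    then have v: "v \<in> V" using D by auto
    have "(\<lambda>\<omega>. g n \<omega> v) = (\<lambda>\<omega>. if \<omega> \<in> U n then S n v \<omega> else 0)"
      using v by (auto simp: g_def sum_path_def z_def)
    also have "\<dots> \<in> borel_measurable M"
      using U(1)[OF n] measurable_normed_sum[OF v] by measurable
    finally show "(\<lambda>\<omega>. g n \<omega> v) \<in> borel_measurable M" .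
  next
    show "countable (insert z Q)" "insert z Q \<subseteq> mspace CV" using Q z by auto
    fix \<omega> and e :: real assume "0 < e"
    then show "\<exists>q\<in>insert z Q. mdist CV (g n \<omega>) q < e"
      using Q(3)[OF U(3)[OF n]] z by (auto simp: g_def)
  qed
  have law: "field_law M V d (S n) = distr M (borel_of (mtopology_of CV)) (g n)" if n: "n \<ge> 1" for n
    unfolding field_law_def sum_path_def[symmetric]
    by (rule distr_completion_cong_AE[OF gm[OF n]]) (use AEU[OF n] in \<open>auto simp: g_def\<close>)
  show "weakly_compact (mtopology_of CV) ((\<lambda>n. field_law M V d (S n)) ` {1..})"
  proof (rule weakly_compactI[OF _ mtopology_of_cozero])
    show "(\<lambda>n. field_law M V d (S n)) ` {1..} \<subseteq> borel_probabilities (mtopology_of CV)"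
      using law gm by (auto simp: borel_probabilities_def intro!: prob_space_distr)
    fix f :: "nat \<Rightarrow> ('v \<Rightarrow> real) \<Rightarrow> real" and e :: real
    assume f: "\<And>k. f k \<in> Cb (mtopology_of CV)"
      and mono: "\<And>k x. x \<in> topspace (mtopology_of CV) \<Longrightarrow> f (Suc k) x \<le> f k x"
      and lim: "\<And>x. x \<in> topspace (mtopology_of CV) \<Longrightarrow> (\<lambda>k. f k x) \<longlonglongrightarrow> 0" and e: "0 < e"
    \<comment> \<open>A bound for the first function bounds the decreasing sequence from above.
      Dini's theorem makes the integrand small on K', and the remaining mass, at most \<epsilon>,
      contributes at most B \<epsilon> = e / 2.\<close>
    obtain B where B: "0 < B" "\<And>x. x \<in> mspace CV \<Longrightarrow> \<bar>f 0 x\<bar> \<le> B"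
      by (rule CbE[OF f[of 0]]) auto
    define \<epsilon> where "\<epsilon> = e / (2 * B)"
    have \<epsilon>: "0 < \<epsilon>" "B * \<epsilon> = e / 2" using e B by (simp_all add: \<epsilon>_def)
    obtain K' where K': "C.mtotally_bounded K'"
      "\<And>n. n \<ge> 1 \<Longrightarrow> \<exists>B\<in>sets M. prob B \<ge> 1 - \<epsilon> \<and> (\<forall>\<omega>\<in>B. sum_path n \<omega> \<in> K')"
      using tight[OF \<epsilon>(1)] by auto
    obtain k where k: "\<And>x. x \<in> K' \<Longrightarrow> f k x < e / 2"
      using Dini[OF K'(1), of f "e / 2"] f mono lim e by (auto simp: mtopology_of_def)
    have fB: "f k x \<le> B" if "x \<in> mspace CV" for x
    proof -
      have "f k x \<le> f 0 x" using lift_Suc_antimono_le[of "\<lambda>k. f k x" 0 k] mono that by auto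
      with B(2)[OF that] show ?thesis by linarith
    qed
    have "(\<integral>x. f k x \<partial>field_law M V d (S n)) \<le> e" if n: "n \<ge> 1" for n
    proof -
      obtain Bn where Bn: "Bn \<in> sets M" "prob Bn \<ge> 1 - \<epsilon>" "\<And>\<omega>. \<omega> \<in> Bn \<Longrightarrow> sum_path n \<omega> \<in> K'" using K'(2)[OF n] by auto
      have fm: "f k \<in> borel_measurable (borel_of (mtopology_of CV))"
        using f by (intro Cb_measurable) auto
      have P: "distr M (borel_of (mtopology_of CV)) (g n) \<in> borel_probabilities (mtopology_of CV)"
        using gm[OF n] by (auto simp: borel_probabilities_def intro!: prob_space_distr)
      have int: "integrable M (\<lambda>\<omega>. f k (g n \<omega>))"
        using Cb_integrable[OF P f] integrable_distr_eq[OF gm[OF n] fm] by simp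
      have "(\<integral>x. f k x \<partial>field_law M V d (S n)) = (\<integral>\<omega>. f k (g n \<omega>) \<partial>M)"
        unfolding law[OF n] by (rule integral_distr[OF gm[OF n] fm])
      also have "\<dots> \<le> (\<integral>\<omega>. e / 2 + B * indicator (space M - Bn) \<omega> \<partial>M)"
      proof (rule integral_mono_AE[OF int])
        show "integrable M (\<lambda>\<omega>. e / 2 + B * indicator (space M - Bn) \<omega>)"
          using Bn(1) by (intro Bochner_Integration.integrable_add integrable_const integrable_mult_right integrable_real_indicator)
            (auto simp: emeasure_eq_measure)
        show "AE \<omega> in M. f k (g n \<omega>) \<le> e / 2 + B * indicator (space M - Bn) \<omega>"
          using AEU[OF n] AE_space
        proof eventually_elim
          case (elim \<omega>)
          show ?case
          proof (cases "\<omega> \<in> Bn")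
            case True
            with Bn(3) k elim show ?thesis by (auto simp: g_def intro: less_imp_le)
          next
            case False
            with elim fB[OF g[OF n], of \<omega>] e show ?thesis by simp
          qed
        qed
      qed
      also have "\<dots> = e / 2 + B * prob (space M - Bn)"
        using Bn(1) by (subst Bochner_Integration.integral_add) (auto simp: emeasure_eq_measure prob_space)
      also have "\<dots> \<le> e / 2 + B * \<epsilon>"
        using Bn prob_compl[OF Bn(1)] B by (intro add_left_mono mult_left_mono) auto
      also have "\<dots> = e" using \<epsilon> by simp
      finally show ?thesis .
    qed
    then show "\<exists>k. \<forall>\<mu>\<in>(\<lambda>n. field_law M V d (S n)) ` {1..}. (\<integral>x. f k x \<partial>\<mu>) \<le> e"
      by (intro exI[of _ k]) auto
  qed
qed

end

theorem theorem6p3: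
  fixes M :: "'a measure" and F :: "nat \<Rightarrow> 'a measure"
    and V :: "'v set" and \<xi> :: "nat \<Rightarrow> 'v \<Rightarrow> 'a \<Rightarrow> real" and v0 :: 'v
  assumes "prob_space M"
    and "prob_filtration M F"
    and "\<And>v. v \<in> V \<Longrightarrow> centered_martingale_differences M F (\<lambda>i. \<xi> i v)"
    and "tau_sup M V \<xi> > 2"
    and "compact_space (semimetric_topology V (rho M V \<xi>))"
    and "\<And>n. n \<ge> 1 \<Longrightarrow> separable_field M (semimetric_topology V (rho M V \<xi>)) (normed_sum \<xi> n)"
    and "(\<integral>\<^sup>+ \<epsilon>\<in>{0<..<1}. ereal_exp (tau_star (tau M V \<xi>)
            (ereal (ln 2) + metric_entropy V (rho M V \<xi>) \<epsilon>)) \<partial>lborel) < \<infinity>"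
    and "v0 \<in> V"
    and "weakly_compact euclideanreal ((\<lambda>n. distr M borel (normed_sum \<xi> n v0)) ` {1..})"
  shows "(\<forall>n\<ge>1. AE \<omega> in M. (\<lambda>v\<in>V. normed_sum \<xi> n v \<omega>) \<in> mspace (cont_space V (rho M V \<xi>)))
    \<and> weakly_compact (mtopology_of (cont_space V (rho M V \<xi>)))
        ((\<lambda>n. field_law M V (rho M V \<xi>) (normed_sum \<xi> n)) ` {1..})"
proof -
  interpret prob_space M by fact
  interpret entropy_field M F V \<xi>
    using assms by unfold_locales auto
  show ?thesis using normed_sums_weakly_compact unfolding sum_path_def by blast
qed

end
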